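(* Let $K$ be a norm-Euclidean Galois number field of prime degree $\ell$ and conductor $f$ with $3\leq \ell\leq 30$ and $f\leq 10^4$. Then $f$ belongs to the following list corresponding to $\ell$: - $\ell=3$: $7, 9, 13, 19, 31, 37, 43, 61, 67, 73, 103, 109, 127, 157, 277, 439, 643, 997, 1597$; - $\ell=5$: $11, 25, 31, 41, 61, 71, 151, 311, 431$; - $\ell=7$: $29, 43, 49, 127, 239, 673, 701, 911$; - $\ell=11$: $23, 67, 89, 121, 331, 353, 419, 617$; - $\ell=13$: $53, 79, 131, 157, 169, 313, 443, 521, 937$; - $\ell=17$: $137, 289, 443, 1259, 2687$; - $\ell=19$: $191, 229, 361, 1103$; - $\ell=23$: $47, 139, 277, 461, 529, 599, 691, 967, 1013, 1289$; - $\ell=29$: $59, 233, 523, 841, 929, 2843, 3191$. (It is not asserted that every field with a listed degree and conductor is norm-Euclidean.)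
   Context: A number field $K$ with ring of integers $\mathcal{O}_K$ and absolute norm $N=N_{K/\mathbb{Q}}$ is called norm-Euclidean if for every $\alpha,\beta\in\mathcal{O}_K$ with $\beta\neq 0$ there exists $\gamma\in\mathcal{O}_K$ such that $|N(\alpha-\gamma\beta)|<|N(\beta)|$. A Galois number field is a number field that is Galois over $\mathbb{Q}$. The conductor of an abelian number field $K$ is the smallest positive integer $f$ such that $K\subseteq\mathbb{Q}(\zeta_f)$, where $\zeta_f$ is a primitive $f$-th root of unity. *)

theory Defs
  imports Complex_Main "HOL-Library.FuncSet" "HOL-Algebra.Algebra" "HOL-Algebra.Algebraic_Closure_Type"
begin

text \<open>
  Number fields are taken inside the field of complex numbers, so that the inclusion of \<open>K\<close> in
  a cyclotomic field is a literal inclusion of sets. Every abstract number field embeds there,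
  and for a Galois field the image does not depend on the embedding.
\<close>

abbreviation complex_field :: "complex ring" where
  "complex_field \<equiv> ring_of_type_algebra"

definition number_field :: "complex set \<Rightarrow> bool" where
  "number_field K \<longleftrightarrow>
     subfield K complex_field \<and> ring.finite_dimension complex_field \<rat> K"

definition field_degree :: "complex set \<Rightarrow> nat" where
  "field_degree K = ring.dim complex_field \<rat> K"

definition ring_of_integers :: "complex set \<Rightarrow> complex set" where
  "ring_of_integers K = {x \<in> K. algebraic_int x}"

text \<open>
  Each embedding is represented once, by its extension that is \<open>undefined\<close> outside \<open>K\<close>.
  Unital ring homomorphisms fix the rationals pointwise, so this need not be required.
\<close>

definition embeddings :: "complex set \<Rightarrow> (complex \<Rightarrow> complex) set" where
  "embeddings K = ring_hom (complex_field\<lparr>carrier := K\<rparr>) complex_field \<inter> extensional K"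

text \<open>The absolute norm is rational, but is given here as a complex number.\<close>

definition absolute_norm :: "complex set \<Rightarrow> complex \<Rightarrow> complex" where
  "absolute_norm K x = (\<Prod>\<sigma>\<in>embeddings K. \<sigma> x)"

definition norm_euclidean :: "complex set \<Rightarrow> bool" where
  "norm_euclidean K \<longleftrightarrow>
     (\<forall>\<alpha>\<in>ring_of_integers K. \<forall>\<beta>\<in>ring_of_integers K. \<beta> \<noteq> 0 \<longrightarrow>
       (\<exists>\<gamma>\<in>ring_of_integers K.
          cmod (absolute_norm K (\<alpha> - \<gamma> * \<beta>)) < cmod (absolute_norm K \<beta>)))"

text \<open>The extension \<open>K/\<rat>\<close> is Galois if the fixed field of its automorphism group is \<open>\<rat>\<close>.\<close>

definition galois_over_rat :: "complex set \<Rightarrow> bool" where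
  "galois_over_rat K \<longleftrightarrow>
     {x \<in> K. \<forall>\<sigma>\<in>ring_iso (complex_field\<lparr>carrier := K\<rparr>) (complex_field\<lparr>carrier := K\<rparr>). \<sigma> x = x}
       = \<rat>"

definition cyclotomic_field :: "nat \<Rightarrow> complex set" where
  "cyclotomic_field n = generate_field complex_field {cis (2 * pi / real n)}"

text \<open>
  A relation rather than a function: that every abelian number field has a conductor is the
  Kronecker--Weber theorem.
\<close>

definition has_conductor :: "complex set \<Rightarrow> nat \<Rightarrow> bool" where
  "has_conductor K f \<longleftrightarrow>
     f > 0 \<and> K \<subseteq> cyclotomic_field f \<and>
     (\<forall>g. g > 0 \<and> K \<subseteq> cyclotomic_field g \<longrightarrow> f \<le> g)"

end

theory Submission
  imports Defs "Jordan_Normal_Form.Char_Poly" "HOL-Number_Theory.Number_Theory"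
begin

text \<open>
  Write \<open>\<sigma>\<^sub>a\<close> for the automorphism \<open>\<zeta>\<^sub>f \<mapsto> \<zeta>\<^sub>f\<^sup>a\<close> of \<open>\<rat>(\<zeta>\<^sub>f)\<close>, where \<open>f\<close> is the conductor of \<open>K\<close>. By the
  minimality of \<open>f\<close>, every prime \<open>p\<close> dividing \<open>f\<close> admits some \<open>a \<equiv> 1 (mod f/p)\<close> such that \<open>\<sigma>\<^sub>a\<close> is
  not the identity on \<open>K\<close>, and then \<open>\<sigma>\<^sub>a\<close> generates the Galois group of \<open>K\<close>, whose order \<open>l\<close> is prime.
  As \<open>\<sigma>\<^sub>a\<close> acts trivially on the integers modulo the radical of \<open>p\<close>, the prime \<open>p\<close> is totally
  ramified: every integer \<open>x\<close> of \<open>K\<close> is congruent to a rational integer \<open>n\<close> modulo this radical, so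
  that \<open>N(x) \<equiv> n\<^sup>l (mod p)\<close>. The order of \<open>\<sigma>\<^sub>a\<close> shows in addition that \<open>f\<close> is a product of distinct
  primes \<open>\<equiv> 1 (mod l)\<close>, possibly times \<open>l\<^sup>2\<close>.

  Now let \<open>K\<close> be norm-Euclidean, so that ideals are principal. If \<open>|N(x)| = u v\<close> with \<open>u\<close>, \<open>v\<close>
  coprime, then a generator of the ideal \<open>(x, u)\<close> has norm \<open>\<plusminus>u\<close>, so \<open>u\<close> is an \<open>l\<close>-th power residue
  modulo every ramified prime \<open>p \<equiv> 1 (mod l)\<close> that does not divide \<open>u\<close>. On the other hand, if \<open>M\<close> is a
  product of distinct ramified primes and \<open>a = n\<^sup>l mod M\<close>, then \<open>a\<close> or \<open>M - a\<close> is the absolute value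
  of a norm (Heilbronn). Whenever both \<open>a\<close> and \<open>M - a\<close> have a unitary divisor that is not an \<open>l\<close>-th
  power residue, the conductor \<open>f\<close> is impossible. Such a certificate exists for every prime conductor
  missing from the list; for composite conductors it suffices to combine the few surviving primes
  in pairs.
\<close>

section \<open>Algebraic integers\<close>

text \<open>The obstacle is integrality. The effect of \<open>\<sigma>\<^sub>a\<close> is
  transparent on integer polynomials in \<open>\<zeta>\<^sub>f\<close>, but an integer of
  \<open>K\<close> is a priori only a rational polynomial in it. Instead of determining all integers
  of \<open>\<rat>(\<zeta>\<^sub>f)\<close>, it is enough to find for each of them a denominator
  coprime to the given \<open>p\<close>, since such denominators cancel modulo the radical of
  \<open>p\<close>. Congruences are taken in the ring of all algebraic integers, so that no prime
  ideals have to be factored or chosen. Principality is used twice: to split a norm into coprime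
  factors, and to obtain an element of norm \<open>\<plusminus>p\<close> for each ramified
  \<open>p\<close>, from which the divisor in Heilbronn's argument is built. Signs never matter:
  \<open>l\<close> is odd, so -1 is an \<open>l\<close>-th power. Modulo \<open>l\<close> every
  residue is an \<open>l\<close>-th power; hence \<open>l\<close> can contribute to the modulus
  \<open>M\<close> but gives no residue test, and the conductor \<open>l\<^sup>2\<close> is never
  excluded.\<close>

lemma algebraic_int_if_int_eigen:
  fixes e :: "nat \<Rightarrow> complex"
  assumes step: "\<And>k. k < N \<Longrightarrow> \<exists>c :: nat \<Rightarrow> int. z * e k = (\<Sum>j<N. of_int (c j) * e j)"
    and k0: "k0 < N" "e k0 \<noteq> 0"
  shows "algebraic_int z"
proof -
  obtain c :: "nat \<Rightarrow> nat \<Rightarrow> int" where c: "\<And>k. k < N \<Longrightarrow> z * e k = (\<Sum>j<N. of_int (c k j) * e j)"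
    using step by metis
  define A :: "int mat" where "A = mat N N (\<lambda>(i, j). c i j)"
  define v where "v = vec N e"
  have A: "A \<in> carrier_mat N N" and v: "v \<in> carrier_vec N" by (auto simp: A_def v_def)
  let ?A = "map_mat of_int A :: complex mat"
  \<comment> \<open>Determinant trick: \<open>z\<close> is an eigenvalue of the integer matrix of
    multiplication by \<open>z\<close>, hence a root of a monic integer polynomial. The
    \<open>e k\<close> may be dependent; only the vector \<open>v\<close> must not vanish.\<close>
  have "?A *\<^sub>v v = z \<cdot>\<^sub>v v"
  proof (rule eq_vecI)
    show "dim_vec (?A *\<^sub>v v) = dim_vec (z \<cdot>\<^sub>v v)" using A v by auto
    fix i assume "i < dim_vec (z \<cdot>\<^sub>v v)"
    then have i: "i < N" using v by auto
    then show "(?A *\<^sub>v v) $ i = (z \<cdot>\<^sub>v v) $ i"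
      using A v by (simp add: scalar_prod_def A_def v_def c lessThan_atLeast0)
  qed
  moreover have "v \<noteq> 0\<^sub>v N" using k0 unfolding v_def by (metis index_vec index_zero_vec(1))
  ultimately have "eigenvalue ?A z"
    unfolding eigenvalue_def eigenvector_def using A v by auto
  then have "poly (char_poly ?A) z = 0"
    using eigenvalue_root_char_poly[of ?A N z] A by auto
  moreover have "char_poly ?A = map_poly of_int (char_poly A)"
    by (rule of_int_hom.char_poly_hom[OF A])
  ultimately show ?thesis
    unfolding algebraic_int_altdef_ipoly using degree_monic_char_poly[OF A] by auto
qed

lemma monic_int_relation:
  fixes x :: complex
  assumes "algebraic_int x"
  obtains n and a :: "nat \<Rightarrow> int" where "n > 0" "x ^ n = (\<Sum>i<n. of_int (a i) * x ^ i)"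
proof -
  obtain p :: "int poly" where p: "poly (map_poly of_int p) x = 0" "lead_coeff p = 1"
    using assms unfolding algebraic_int_altdef_ipoly by auto
  let ?n = "degree p"
  have "?n \<noteq> 0"
  proof
    assume "?n = 0"
    then obtain c where "p = [:c:]" by (rule degree_eq_zeroE)
    then show False using p by auto
  qed
  have "0 = (\<Sum>i\<le>?n. of_int (coeff p i) * x ^ i)"
    using p by (simp add: poly_altdef degree_map_poly coeff_map_poly)
  also have "\<dots> = x ^ ?n + (\<Sum>i<?n. of_int (coeff p i) * x ^ i)"
    using p(2) by (simp add: lessThan_Suc_atMost[symmetric])
  finally have "x ^ ?n = (\<Sum>i<?n. of_int (- coeff p i) * x ^ i)"
    by (simp add: sum_negf eq_neg_iff_add_eq_0)
  then show thesis using that[of ?n "\<lambda>i. - coeff p i"] \<open>?n \<noteq> 0\<close> by blast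
qed

text \<open>The products \<open>x ^ i * y ^ j\<close> with \<open>i < n\<close> and
  \<open>j < m\<close> span an additive group that is stable under multiplication by
  \<open>x\<close> and by \<open>y\<close>, hence by \<open>x + y\<close> and
  \<open>x * y\<close>.\<close>

lemma
  fixes x y :: complex
  assumes x: "algebraic_int x" and y: "algebraic_int y"
  shows algebraic_int_plus: "algebraic_int (x + y)"
    and algebraic_int_times: "algebraic_int (x * y)"
proof -
  obtain n and a :: "nat \<Rightarrow> int" where n: "n > 0" "x ^ n = (\<Sum>i<n. of_int (a i) * x ^ i)"
    using monic_int_relation[OF x] by metis
  obtain m and b :: "nat \<Rightarrow> int" where m: "m > 0" "y ^ m = (\<Sum>i<m. of_int (b i) * y ^ i)"
    using monic_int_relation[OF y] by metis
  \<comment> \<open>Mixed radix enumeration of the pairs: \<open>k = i * m + j\<close> stands for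
    \<open>x ^ i * y ^ j\<close>.\<close>
  define e where "e k = x ^ (k div m) * y ^ (k mod m)" for k
  define S where "S z \<longleftrightarrow> (\<exists>c :: nat \<Rightarrow> int. z = (\<Sum>k<n*m. of_int (c k) * e k))" for z
  have S_add: "S (u + w)" if "S u" "S w" for u w
  proof -
    from that obtain c d :: "nat \<Rightarrow> int" where "u = (\<Sum>k<n*m. of_int (c k) * e k)"
      "w = (\<Sum>k<n*m. of_int (d k) * e k)" unfolding S_def by auto
    then have "u + w = (\<Sum>k<n*m. of_int (c k + d k) * e k)"
      by (simp add: sum.distrib ring_distribs)
    then show ?thesis unfolding S_def by (intro exI[of _ "\<lambda>k. c k + d k"])
  qed
  have S_scale: "S (of_int t * u)" if "S u" for u t
  proof -
    from that obtain c :: "nat \<Rightarrow> int" where "u = (\<Sum>k<n*m. of_int (c k) * e k)"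
      unfolding S_def by auto
    then have "of_int t * u = (\<Sum>k<n*m. of_int (t * c k) * e k)"
      by (simp add: sum_distrib_left mult.assoc)
    then show ?thesis unfolding S_def by (intro exI[of _ "\<lambda>k. t * c k"])
  qed
  have S_0: "S 0" unfolding S_def by (rule exI[of _ "\<lambda>_. 0"]) simp
  have S_sum: "S (\<Sum>i\<in>I. of_int (t i) * u i)" if "\<And>i. i \<in> I \<Longrightarrow> S (u i)" for I :: "nat set" and t u
    using that by (induction I rule: infinite_finite_induct) (auto simp: S_0 intro!: S_add S_scale)
  have S_e: "S (e k)" if "k < n * m" for k
    unfolding S_def using that
    by (intro exI[of _ "\<lambda>j. if j = k then 1 else 0"]) (simp add: if_distrib[of "\<lambda>t. t * _"] if_distrib[of of_int] cong: if_cong)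
  have S_xy: "S (x ^ i * y ^ j)" if "i < n" "j < m" for i j
  proof -
    have "i * m + j < Suc i * m" using that by simp
    also have "\<dots> \<le> n * m" using that by (intro mult_right_mono) auto
    finally have "i * m + j < n * m" .
    moreover have "e (i * m + j) = x ^ i * y ^ j" using that by (simp add: e_def)
    ultimately show ?thesis using S_e by metis
  qed
  have xe: "S (x * e k)" if "k < n * m" for k
  proof -
    have k: "k div m < n" "k mod m < m" using that m(1) by (auto simp: less_mult_imp_div_less)
    show ?thesis
    proof (cases "Suc (k div m) < n")
      case True
      then show ?thesis using S_xy[OF True k(2)] by (simp add: e_def mult.assoc)
    next
      case False
      then have *: "Suc (k div m) = n" using k by auto
      have "x * e k = x ^ n * y ^ (k mod m)" unfolding e_def by (subst *[symmetric]) (simp add: mult.assoc)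
      also have "\<dots> = (\<Sum>i<n. of_int (a i) * (x ^ i * y ^ (k mod m)))"
        by (simp add: n(2) sum_distrib_right mult.assoc)
      finally show ?thesis using k S_xy by (auto intro: S_sum)
    qed
  qed
  have ye: "S (y * e k)" if "k < n * m" for k
  proof -
    have k: "k div m < n" "k mod m < m" using that m(1) by (auto simp: less_mult_imp_div_less)
    show ?thesis
    proof (cases "Suc (k mod m) < m")
      case True
      then show ?thesis using S_xy[OF k(1) True] by (simp add: e_def mult_ac)
    next
      case False
      then have *: "Suc (k mod m) = m" using k by auto
      have "y * e k = x ^ (k div m) * y ^ m" unfolding e_def by (subst (4) *[symmetric]) (simp add: mult_ac)
      also have "\<dots> = (\<Sum>i<m. of_int (b i) * (x ^ (k div m) * y ^ i))"
        by (simp add: m(2) sum_distrib_left mult_ac)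
      finally show ?thesis using k S_xy by (auto intro: S_sum)
    qed
  qed
  have xS: "S (x * u)" if "S u" for u
  proof -
    from that obtain c :: "nat \<Rightarrow> int" where u: "u = (\<Sum>k<n*m. of_int (c k) * e k)"
      unfolding S_def by auto
    have "x * u = (\<Sum>k<n*m. of_int (c k) * (x * e k))"
      unfolding u by (simp add: sum_distrib_left mult_ac)
    then show ?thesis using xe by (auto intro!: S_sum)
  qed
  have nm: "0 < n * m" "e 0 \<noteq> 0" using n m by (auto simp: e_def)
  have "S ((x + y) * e k)" "S (x * y * e k)" if "k < n * m" for k
    using S_add[OF xe ye, OF that that] xS[OF ye, OF that] by (simp_all add: ring_distribs mult.assoc)
  then show "algebraic_int (x + y)" "algebraic_int (x * y)"
    unfolding S_def using algebraic_int_if_int_eigen[of "n * m" _ e 0] nm by blast+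
qed

lemma algebraic_int_diff: "algebraic_int x \<Longrightarrow> algebraic_int y \<Longrightarrow> algebraic_int (x - y)" for x y :: complex
  using algebraic_int_plus[of x "- y"] by simp

lemma algebraic_int_power: "algebraic_int x \<Longrightarrow> algebraic_int (x ^ k)" for x :: complex
  by (induction k) (auto intro: algebraic_int_times)

lemma algebraic_int_sum: "(\<And>i. i \<in> I \<Longrightarrow> algebraic_int (g i)) \<Longrightarrow> algebraic_int (\<Sum>i\<in>I. g i)"
  for g :: "'i \<Rightarrow> complex"
  by (induction I rule: infinite_finite_induct) (auto intro: algebraic_int_plus)

lemma algebraic_int_prod: "(\<And>i. i \<in> I \<Longrightarrow> algebraic_int (g i)) \<Longrightarrow> algebraic_int (\<Prod>i\<in>I. g i)"
  for g :: "'i \<Rightarrow> complex"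
  by (induction I rule: infinite_finite_induct) (auto intro: algebraic_int_times)

text \<open>Factors \<open>X\<close> are stripped from an integral equation of \<open>z\<close>
  until the constant term is nonzero; what remains expresses a nonzero integer as \<open>z\<close>
  times a polynomial in \<open>z\<close>. That \<open>w\<close> is such a polynomial keeps it in
  every ring containing \<open>z\<close>, which later yields inverses in cyclotomic fields.\<close>

lemma algebraic_int_divides_int:
  fixes z :: complex
  assumes "algebraic_int z" "z \<noteq> 0"
  obtains w c where "algebraic_int w" "c \<noteq> 0" "z * w = of_int c"
    "\<exists>q :: int poly. w = poly (map_poly of_int q) z"
proof -
  obtain p :: "int poly" where p: "poly (map_poly of_int p) z = 0" "lead_coeff p = 1"
    using assms unfolding algebraic_int_altdef_ipoly by auto
  have "\<exists>c q. c \<noteq> 0 \<and> z * poly (map_poly of_int q) z = of_int c"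
    if "poly (map_poly of_int p) z = 0" "p \<noteq> 0" for p :: "int poly"
    using that
  proof (induction p)
    case (pCons a p)
    show ?case
    proof (cases "a = 0")
      case True
      then have "p \<noteq> 0" "poly (map_poly of_int p) z = 0"
        using pCons.prems assms(2) by (auto simp: map_poly_pCons)
      then show ?thesis using pCons.IH by blast
    next
      case False
      have "of_int a + z * poly (map_poly of_int p) z = 0"
        using pCons.prems pCons.hyps by (simp add: map_poly_pCons)
      then have "z * poly (map_poly of_int p) z = of_int (- a)"
        by (simp add: eq_neg_iff_add_eq_0 add.commute)
      then show ?thesis using False by (intro exI[of _ "- a"] exI[of _ p]) auto
    qed
  qed auto
  moreover have "p \<noteq> 0" using p by auto
  ultimately obtain c q where cq: "c \<noteq> 0" "z * poly (map_poly of_int q) z = of_int c"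
    using p by metis
  moreover have "algebraic_int (poly (map_poly of_int q) z)"
    unfolding poly_altdef
    by (intro algebraic_int_sum algebraic_int_times algebraic_int_power assms(1)) (auto simp: coeff_map_poly)
  ultimately show thesis using that by blast
qed

section \<open>Polynomials over subrings and roots of unity\<close>

text \<open>One interface for all the rings involved: \<open>\<int>\<close>, \<open>\<rat>\<close>,
  all algebraic integers, \<open>\<int>[\<zeta>]\<close>, \<open>\<rat>(\<zeta>)\<close>,
  \<open>K\<close> and its ring of integers.\<close>

locale num_ring =
  fixes S :: "complex set"
  assumes one_mem: "1 \<in> S"
    and diff_mem: "\<And>x y. x \<in> S \<Longrightarrow> y \<in> S \<Longrightarrow> x - y \<in> S"
    and mult_mem: "\<And>x y. x \<in> S \<Longrightarrow> y \<in> S \<Longrightarrow> x * y \<in> S"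
begin

lemma zero_mem: "0 \<in> S"
  using diff_mem[OF one_mem one_mem] by simp

lemma minus_mem: "x \<in> S \<Longrightarrow> - x \<in> S"
  using diff_mem[OF zero_mem] by fastforce

lemma add_mem: "x \<in> S \<Longrightarrow> y \<in> S \<Longrightarrow> x + y \<in> S"
  using diff_mem[of x "- y"] minus_mem by simp

lemma power_mem: "x \<in> S \<Longrightarrow> x ^ k \<in> S"
  by (induction k) (auto intro: one_mem mult_mem)

lemma sum_mem: "(\<And>i. i \<in> I \<Longrightarrow> g i \<in> S) \<Longrightarrow> sum g I \<in> S"
  by (induction I rule: infinite_finite_induct) (auto intro: zero_mem add_mem)

lemma prod_mem: "(\<And>i. i \<in> I \<Longrightarrow> g i \<in> S) \<Longrightarrow> prod g I \<in> S"
  by (induction I rule: infinite_finite_induct) (auto intro: one_mem mult_mem)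

lemma of_nat_mem: "of_nat n \<in> S"
  by (induction n) (auto intro: zero_mem one_mem add_mem)

lemma of_int_mem: "of_int n \<in> S"
  by (cases n) (auto simp del: of_nat_Suc intro: of_nat_mem minus_mem diff_mem)

text \<open>The inner binomial coefficients are multiples of \<open>p\<close>. The point is that the
  cofactor \<open>r\<close> stays in the ring \<open>S\<close>.\<close>

lemma freshman_dream:
  assumes p: "Factorial_Ring.prime p" and "x \<in> S" "y \<in> S"
  shows "\<exists>r\<in>S. (x + y) ^ p = x ^ p + y ^ p + of_nat p * r"
proof -
  define r where "r = (\<Sum>k\<in>{0<..<p}. of_nat ((p choose k) div p) * x ^ k * y ^ (p - k))"
  have p0: "p > 0" using p prime_gt_0_nat by blast
  have "(x + y) ^ p = (\<Sum>k\<le>p. of_nat (p choose k) * x ^ k * y ^ (p - k))"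
    by (rule binomial_ring)
  also have "{..p} = insert 0 (insert p {0<..<p})" using p0 by auto
  also have "(\<Sum>k\<in>insert 0 (insert p {0<..<p}). of_nat (p choose k) * x ^ k * y ^ (p - k)) =
      x ^ p + y ^ p + (\<Sum>k\<in>{0<..<p}. of_nat (p choose k) * x ^ k * y ^ (p - k))"
    using p0 by simp
  also have "(\<Sum>k\<in>{0<..<p}. of_nat (p choose k) * x ^ k * y ^ (p - k)) = of_nat p * r"
    unfolding r_def sum_distrib_left
  proof (rule sum.cong)
    fix k assume "k \<in> {0<..<p}"
    then have "p dvd (p choose k)" by (intro dvd_choose_prime p) auto
    then have "of_nat (p choose k) = (of_nat p * of_nat ((p choose k) div p) :: complex)"
      by (metis dvd_mult_div_cancel of_nat_mult)
    then show "of_nat (p choose k) * x ^ k * y ^ (p - k) =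
        of_nat p * (of_nat ((p choose k) div p) * x ^ k * y ^ (p - k))" by simp
  qed simp
  finally show ?thesis
    using assms by (intro bexI[of _ r]) (auto simp: r_def intro!: sum_mem mult_mem of_nat_mem power_mem)
qed

end

interpretation Ints: num_ring \<int> by unfold_locales auto
interpretation Rats: num_ring \<rat> by unfold_locales auto
interpretation alg_ints: num_ring "Collect algebraic_int"
  by unfold_locales (auto intro: algebraic_int_times algebraic_int_diff)

definition polys_over :: "complex set \<Rightarrow> complex poly set" where
  "polys_over S = {P. \<forall>i. coeff P i \<in> S}"

definition adjoin :: "complex set \<Rightarrow> complex \<Rightarrow> complex set" where
  "adjoin S z = (\<lambda>P. poly P z) ` polys_over S"

context num_ring
begin

lemma polys_over_pCons_iff: "pCons a P \<in> polys_over S \<longleftrightarrow> a \<in> S \<and> P \<in> polys_over S"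
  unfolding polys_over_def by (auto simp: coeff_pCons split: nat.splits)

lemma polys_over_0: "0 \<in> polys_over S"
  unfolding polys_over_def by (auto intro: zero_mem)

lemma polys_over_const: "a \<in> S \<Longrightarrow> [:a:] \<in> polys_over S"
  by (simp add: polys_over_pCons_iff polys_over_0)

lemma polys_over_monom: "a \<in> S \<Longrightarrow> Polynomial.monom a n \<in> polys_over S"
  unfolding polys_over_def by (auto intro: zero_mem)

lemma polys_over_diff: "P \<in> polys_over S \<Longrightarrow> Q \<in> polys_over S \<Longrightarrow> P - Q \<in> polys_over S"
  unfolding polys_over_def by (auto intro: diff_mem)

lemma polys_over_add: "P \<in> polys_over S \<Longrightarrow> Q \<in> polys_over S \<Longrightarrow> P + Q \<in> polys_over S"
  unfolding polys_over_def by (auto intro: add_mem)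

lemma polys_over_mult: "P \<in> polys_over S \<Longrightarrow> Q \<in> polys_over S \<Longrightarrow> P * Q \<in> polys_over S"
  unfolding polys_over_def by (auto simp: coeff_mult intro!: sum_mem mult_mem)

lemma polys_over_smult: "a \<in> S \<Longrightarrow> P \<in> polys_over S \<Longrightarrow> smult a P \<in> polys_over S"
  unfolding polys_over_def by (auto intro: mult_mem)

lemma polys_over_1: "1 \<in> polys_over S"
  using polys_over_const[OF one_mem] by (simp add: one_pCons)

lemma polys_over_prod: "(\<And>i. i \<in> I \<Longrightarrow> g i \<in> polys_over S) \<Longrightarrow> prod g I \<in> polys_over S"
  by (induction I rule: infinite_finite_induct) (auto intro: polys_over_1 polys_over_mult)

lemma polys_over_pcompose: "P \<in> polys_over S \<Longrightarrow> Q \<in> polys_over S \<Longrightarrow> pcompose P Q \<in> polys_over S"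
proof (induction P)
  case (pCons a P)
  then show ?case
    by (auto simp: pcompose_pCons polys_over_pCons_iff polys_over_0 intro!: polys_over_add polys_over_mult)
qed (simp add: polys_over_0)

lemma poly_mem: "P \<in> polys_over S \<Longrightarrow> x \<in> S \<Longrightarrow> poly P x \<in> S"
  by (induction P) (auto simp: polys_over_pCons_iff intro: zero_mem add_mem mult_mem)

lemma poly_diff_dvd:
  assumes "P \<in> polys_over S" "x \<in> S" "y \<in> S"
  shows "\<exists>r\<in>S. poly P x - poly P y = (x - y) * r"
  using assms(1)
proof (induction P)
  case 0
  then show ?case using zero_mem by (intro bexI[of _ 0]) auto
next
  case (pCons a P)
  then obtain r where r: "r \<in> S" "poly P x - poly P y = (x - y) * r" and P: "P \<in> polys_over S"
    by (auto simp: polys_over_pCons_iff)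
  have "poly (pCons a P) x - poly (pCons a P) y = (x - y) * poly P x + y * (poly P x - poly P y)"
    by (simp add: algebra_simps)
  also have "\<dots> = (x - y) * (poly P x + y * r)" by (simp add: r(2) algebra_simps)
  finally show ?case using r(1) P assms by (auto intro!: bexI add_mem mult_mem poly_mem)
qed

lemma adjoin_num_ring: "num_ring (adjoin S z)"
proof
  show "1 \<in> adjoin S z" unfolding adjoin_def by (rule image_eqI[OF _ polys_over_1]) simp
next
  fix x y assume "x \<in> adjoin S z" "y \<in> adjoin S z"
  then obtain P Q where PQ: "P \<in> polys_over S" "x = poly P z" "Q \<in> polys_over S" "y = poly Q z"
    unfolding adjoin_def by auto
  show "x - y \<in> adjoin S z"
    unfolding adjoin_def by (rule image_eqI[OF _ polys_over_diff[OF PQ(1,3)]]) (simp add: PQ)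
  show "x * y \<in> adjoin S z"
    unfolding adjoin_def by (rule image_eqI[OF _ polys_over_mult[OF PQ(1,3)]]) (simp add: PQ)
qed

lemma adjoin_gen: "z \<in> adjoin S z"
  unfolding adjoin_def
  by (rule image_eqI[of _ _ "[:0, 1:]"]) (auto simp: polys_over_pCons_iff polys_over_0 zero_mem one_mem)

lemma adjoin_base: "a \<in> S \<Longrightarrow> a \<in> adjoin S z"
  unfolding adjoin_def by (rule image_eqI[OF _ polys_over_const]) auto

lemma adjoin_mono:
  assumes "S \<subseteq> T" "num_ring T" "z \<in> T" shows "adjoin S z \<subseteq> T"
  using num_ring.poly_mem[OF assms(2) _ assms(3)] assms(1) unfolding adjoin_def polys_over_def by auto

text \<open>A monic divisor permits division without leaving the coefficient ring. It is used over
  \<open>\<rat>\<close> to recognise multiples of a minimal polynomial and over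
  \<open>\<int>\<close> to keep the cofactor integral.\<close>

lemma poly_division_monic:
  assumes H: "H \<in> polys_over S" "lead_coeff H = 1"
    and P: "P \<in> polys_over S"
  shows "\<exists>Q\<in>polys_over S. \<exists>R\<in>polys_over S. P = Q * H + R \<and> (R = 0 \<or> degree R < degree H)"
  using P
proof (induction P)
  case 0
  then show ?case by (intro bexI[of _ 0]) (auto simp: polys_over_0)
next
  case (pCons a P)
  then obtain Q R where QR: "Q \<in> polys_over S" "R \<in> polys_over S" "P = Q * H + R"
      "R = 0 \<or> degree R < degree H" and a: "a \<in> S"
    by (auto simp: polys_over_pCons_iff)
  define R' where "R' = pCons a R"
  define c where "c = coeff R' (degree H)"
  have R': "R' \<in> polys_over S" using QR a by (simp add: R'_def polys_over_pCons_iff)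
  then have c: "c \<in> S" by (simp add: c_def polys_over_def)
  have dR': "degree R' \<le> degree H" using QR(4) by (auto simp: R'_def)
  have "pCons a P = pCons 0 Q * H + R'" by (simp add: QR(3) R'_def)
  also have "\<dots> = (pCons 0 Q + [:c:]) * H + (R' - smult c H)" by (simp add: algebra_simps)
  finally have eq: "pCons a P = (pCons 0 Q + [:c:]) * H + (R' - smult c H)" .
  have "R' - smult c H = 0 \<or> degree (R' - smult c H) < degree H"
  proof (cases "degree H = 0")
    case True
    then have "H = 1" using H(2) by (metis degree_eq_zeroE lead_coeff_pCons(2) one_pCons)
    then show ?thesis using dR' by (auto simp: c_def elim!: degree_eq_zeroE)
  next
    case False
    have "degree (R' - smult c H) \<le> degree H" using dR' by (intro degree_diff_le) auto
    moreover have "coeff (R' - smult c H) (degree H) = 0" using H(2) by (simp add: c_def)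
    ultimately show ?thesis
      by (metis leading_coeff_0_iff le_neq_implies_less)
  qed
  moreover have "pCons 0 Q + [:c:] \<in> polys_over S" "R' - smult c H \<in> polys_over S"
    using QR c R' H by (auto intro!: polys_over_add polys_over_diff polys_over_smult
        simp: polys_over_pCons_iff polys_over_0 zero_mem)
  ultimately show ?case using eq by blast
qed

end

section \<open>Frobenius congruences and conjugate roots of unity\<close>

lemma of_int_divide_of_nat_in_Ints:
  assumes "(of_int a / of_nat p :: complex) \<in> \<int>" "p > 0"
  shows "int p dvd a"
proof -
  obtain c where "(of_int a / of_nat p :: complex) = of_int c" using assms(1) by (auto elim: Ints_cases)
  then have "(of_int a :: complex) = of_int (c * int p)" using assms(2) by (simp add: field_simps)
  then have "a = c * int p" by (simp only: of_int_eq_iff)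
  then show ?thesis by simp
qed

lemma polys_over_mono: "S \<subseteq> T \<Longrightarrow> polys_over S \<subseteq> polys_over T"
  unfolding polys_over_def by auto

lemma fermat_int:
  assumes p: "Factorial_Ring.prime p" shows "[n ^ p = n] (mod int p)"
proof (cases "int p dvd n")
  case True
  moreover have "n dvd n ^ p" using prime_gt_0_nat[OF p] by (simp add: dvd_power)
  ultimately have "int p dvd n ^ p - n" by (meson dvd_diff dvd_trans)
  then show ?thesis by (simp add: cong_iff_dvd_diff)
next
  case False
  define m where "m = nat (n mod int p)"
  have m: "[int m = n] (mod int p)" using prime_gt_0_nat[OF p] by (simp add: m_def cong_def)
  then have "\<not> int p dvd int m" using False cong_dvd_iff by blast
  then have "\<not> p dvd m" by simp
  then have "[m ^ (p - 1) = 1] (mod p)" using fermat_theorem[OF p] by simp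
  then have "[m ^ (p - 1) * m = 1 * m] (mod p)" by (rule cong_mult) simp
  then have "[m ^ p = m] (mod p)" using prime_gt_0_nat[OF p] by (simp add: power_eq_if mult.commute)
  then have mm: "[int m ^ p = int m] (mod int p)" by (metis cong_int_iff of_nat_power)
  have "[n ^ p = int m ^ p] (mod int p)" using m by (intro cong_pow cong_sym[OF m])
  then show ?thesis using mm m cong_trans by blast
qed

text \<open>Integer coefficients are fixed by the \<open>p\<close>-th power modulo \<open>p\<close>,
  so raising a value to the \<open>p\<close>-th power amounts to replacing \<open>z\<close> by
  \<open>z ^ p\<close>.\<close>

lemma poly_frobenius:
  assumes p: "Factorial_Ring.prime p" and P: "P \<in> polys_over \<int>"
  shows "\<exists>r\<in>adjoin \<int> z. poly P z ^ p = poly P (z ^ p) + of_nat p * r"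
  using P
proof (induction P)
  case 0
  interpret R: num_ring "adjoin \<int> z" by (rule Ints.adjoin_num_ring)
  show ?case using p prime_gt_0_nat[OF p] R.zero_mem by (intro bexI[of _ 0]) auto
next
  case (pCons a P)
  interpret R: num_ring "adjoin \<int> z" by (rule Ints.adjoin_num_ring)
  from pCons obtain r where r: "r \<in> adjoin \<int> z" "poly P z ^ p = poly P (z ^ p) + of_nat p * r"
    and a: "a \<in> \<int>" and P: "P \<in> polys_over \<int>"
    by (auto simp: Ints.polys_over_pCons_iff)
  then have aR: "a \<in> adjoin \<int> z" and PR: "poly P z \<in> adjoin \<int> z" and zR: "z \<in> adjoin \<int> z"
    by (auto simp: adjoin_def intro: Ints.adjoin_base Ints.adjoin_gen[unfolded adjoin_def] Ints.adjoin_base[unfolded adjoin_def])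
  obtain s where s: "s \<in> adjoin \<int> z"
      "(a + z * poly P z) ^ p = a ^ p + (z * poly P z) ^ p + of_nat p * s"
    using R.freshman_dream[OF p aR R.mult_mem[OF zR PR]] by auto
  obtain n where n: "a = of_int n" using a by (auto elim: Ints_cases)
  have "[n ^ p = n] (mod int p)" by (rule fermat_int[OF p])
  then have "int p dvd n ^ p - n" by (simp add: cong_iff_dvd_diff)
  then obtain t where "n ^ p - n = int p * t" by (elim dvdE)
  then have t: "n ^ p = n + int p * t" by simp
  have tR: "of_int t \<in> adjoin \<int> z" by (rule R.of_int_mem)
  have "poly (pCons a P) z ^ p = a ^ p + z ^ p * poly P z ^ p + of_nat p * s"
    using s by (simp add: power_mult_distrib)
  also have "a ^ p = a + of_nat p * of_int t" unfolding n using arg_cong[OF t, of "of_int :: int \<Rightarrow> complex"] by simp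
  also have "a + of_nat p * of_int t + z ^ p * poly P z ^ p + of_nat p * s
      = poly (pCons a P) (z ^ p) + of_nat p * (of_int t + z ^ p * r + s)"
    by (simp add: r(2) algebra_simps)
  finally show ?case
    using tR r s zR by (intro bexI[of _ "of_int t + z ^ p * r + s"]) (auto intro!: R.add_mem R.mult_mem R.power_mem)
qed

lemma minimal_poly_exists:
  assumes "P0 \<in> polys_over \<rat>" "P0 \<noteq> 0" "poly P0 z = 0"
  obtains h where "h \<in> polys_over \<rat>" "lead_coeff h = 1" "poly h z = 0"
    "\<And>P. P \<in> polys_over \<rat> \<Longrightarrow> P \<noteq> 0 \<Longrightarrow> poly P z = 0 \<Longrightarrow> degree h \<le> degree P"
proof -
  define good where "good P \<longleftrightarrow> P \<in> polys_over \<rat> \<and> P \<noteq> 0 \<and> poly P z = 0" for P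
  define P1 where "P1 = arg_min degree good"
  have "good P0" using assms by (simp add: good_def)
  then have P1: "good P1" and min: "\<And>P. good P \<Longrightarrow> degree P1 \<le> degree P"
    unfolding P1_def by (metis arg_min_natI, metis arg_min_nat_le)
  define h where "h = smult (inverse (lead_coeff P1)) P1"
  show thesis
  proof (rule that[of h])
    have "inverse (lead_coeff P1) \<in> \<rat>" using P1 by (auto simp: good_def polys_over_def)
    then show "h \<in> polys_over \<rat>" using P1 by (auto simp: h_def good_def intro: Rats.polys_over_smult)
    show "lead_coeff h = 1" "poly h z = 0" using P1 by (auto simp: h_def good_def)
    show "degree h \<le> degree P" if "P \<in> polys_over \<rat>" "P \<noteq> 0" "poly P z = 0" for P
      using min[of P] that P1 by (auto simp: h_def good_def)
  qed
qed

text \<open>The coefficients of a monic polynomial are integer polynomials in its roots. Applied to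
  the ring of all algebraic integers this takes the place of Gauss's lemma: rational coefficients
  that are integral are integers.\<close>

lemma monic_poly_split_mem:
  assumes "num_ring S" "lead_coeff h = 1" "\<And>r. poly h r = 0 \<Longrightarrow> r \<in> S"
  shows "h \<in> polys_over S"
proof -
  interpret num_ring S by fact
  have "h \<noteq> 0" using assms(2) by auto
  obtain root where h: "(\<Prod>i<degree h. [:- root i, 1:]) = h"
    using complex_poly_decompose'[of h] assms(2) by auto
  have "root i \<in> S" if "i < degree h" for i
    by (rule assms(3)) (subst h[symmetric], use that in \<open>auto simp: poly_prod\<close>)
  then have "(\<Prod>i<degree h. [:- root i, 1:]) \<in> polys_over S"
    by (intro polys_over_prod) (auto simp: polys_over_pCons_iff polys_over_0 one_mem intro: minus_mem)
  then show ?thesis by (simp only: h)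
qed

lemma algebraic_int_root_of_unity: "w ^ n = 1 \<Longrightarrow> n > 0 \<Longrightarrow> algebraic_int (w :: complex)"
  by (rule algebraic_int_root[of 1 "Polynomial.monom 1 n"]) (auto simp: poly_monom degree_monom_eq)

text \<open>Dedekind's argument for the irreducibility of cyclotomic polynomials. Let
  \<open>X ^ f - 1 = k * h\<close> with \<open>h\<close> the minimal polynomial of \<open>w\<close>.
  If \<open>w ^ q\<close> were not a root of \<open>h\<close>, it would be one of \<open>k\<close>,
  and the derivative at \<open>w ^ q\<close> would make \<open>h(w ^ q)\<close> a divisor of
  \<open>f\<close> among the algebraic integers. But \<open>h(w ^ q)\<close> is a multiple of
  \<open>q\<close> by the Frobenius congruence.\<close>

lemma poly_root_of_unity_prime_power:
  assumes f: "f > 0" "w ^ f = 1" and q: "Factorial_Ring.prime q" "\<not> q dvd f"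
    and P: "P \<in> polys_over \<rat>" "poly P w = 0"
  shows "poly P (w ^ q) = 0"
proof -
  define XF where "XF = Polynomial.monom 1 f - (1 :: complex poly)"
  have XF: "XF \<in> polys_over \<int>"
    unfolding XF_def by (intro Ints.polys_over_diff Ints.polys_over_monom Ints.polys_over_1) auto
  then have XQ: "XF \<in> polys_over \<rat>" using polys_over_mono[of \<int> \<rat>] Ints_subset_Rats by blast
  have Xp: "poly XF y = y ^ f - 1" for y by (simp add: XF_def poly_monom)
  have X0: "XF \<noteq> 0"
  proof
    assume "XF = 0"
    then have "poly XF 0 = 0" by simp
    then show False using f by (simp add: Xp power_0_left)
  qed
  obtain h where h: "h \<in> polys_over \<rat>" "lead_coeff h = 1" "poly h w = 0"
    and hmin: "\<And>P. P \<in> polys_over \<rat> \<Longrightarrow> P \<noteq> 0 \<Longrightarrow> poly P w = 0 \<Longrightarrow> degree h \<le> degree P"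
    using minimal_poly_exists[OF XQ X0, of w] f by (auto simp: Xp)
  have div: "\<exists>Q\<in>polys_over S. P = Q * h" if S: "num_ring S" "S \<subseteq> \<rat>" and "h \<in> polys_over S" and P: "P \<in> polys_over S" "poly P w = 0" for S P
  proof -
    interpret num_ring S by fact
    from poly_division_monic[OF that(3) h(2) P(1)]
    obtain Q R where QR: "Q \<in> polys_over S" "R \<in> polys_over S" "P = Q * h + R" "R = 0 \<or> degree R < degree h"
      by auto
    have "poly R w = 0" using P(2) h(3) by (simp add: QR(3))
    moreover have "R \<in> polys_over \<rat>" using QR(2) polys_over_mono[OF S(2)] by auto
    ultimately have "R = 0" using hmin[of R] QR(4) by (auto simp: not_less[symmetric])
    then show ?thesis using QR by auto
  qed
  have hdX: "\<exists>Q. XF = Q * h" using div[OF Rats.num_ring_axioms _ h(1) XQ] f by (auto simp: Xp)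
  have "h \<in> polys_over (Collect algebraic_int)"
  proof (rule monic_poly_split_mem[OF alg_ints.num_ring_axioms h(2)])
    fix r assume "poly h r = 0"
    then have "poly XF r = 0" using hdX by auto
    then show "r \<in> Collect algebraic_int" using f by (auto simp: Xp intro: algebraic_int_root_of_unity)
  qed
  then have hZ: "h \<in> polys_over \<int>"
    using h(1) by (auto simp: polys_over_def intro: rational_algebraic_int_is_int)
  obtain k where k: "k \<in> polys_over \<int>" "XF = k * h"
    using div[OF Ints.num_ring_axioms _ hZ XF] f Ints_subset_Rats by (auto simp: Xp)
  obtain Q where Q: "P = Q * h" using div[OF Rats.num_ring_axioms _ h(1) P] by auto
  have "poly h (w ^ q) = 0"
  proof (rule ccontr)
    assume nz: "poly h (w ^ q) \<noteq> 0"
    let ?y = "w ^ q"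
    have y: "?y ^ f = 1" using f by (metis power_mult mult.commute power_one)
    then have ky: "poly k ?y = 0" using Xp[of ?y] nz by (simp add: k(2))
    have "pderiv XF = k * pderiv h + h * pderiv k" by (simp add: k(2) pderiv_mult)
    then have "poly (pderiv XF) ?y = poly h ?y * poly (pderiv k) ?y" using ky by simp
    moreover have "poly (pderiv XF) ?y = of_nat f * ?y ^ (f - 1)"
      by (simp add: XF_def pderiv_diff pderiv_monom poly_monom)
    ultimately have "of_nat f * (?y ^ (f - 1) * ?y) = poly h ?y * poly (pderiv k) ?y * ?y"
      by (metis mult.assoc)
    moreover have "?y ^ (f - 1) * ?y = 1" using y f by (metis power_minus_mult)
    ultimately have f_eq: "of_nat f = poly h ?y * poly (pderiv k) ?y * ?y"
      by (simp only: mult_1_right)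
    have wA: "algebraic_int w" using f by (auto intro: algebraic_int_root_of_unity)
    then have yA: "algebraic_int ?y" by (rule algebraic_int_power)
    have "pderiv k \<in> polys_over (Collect algebraic_int)"
      using k(1) by (auto simp: polys_over_def coeff_pderiv simp del: of_nat_Suc
          intro!: algebraic_int_times int_imp_algebraic_int)
    then have kA: "algebraic_int (poly (pderiv k) ?y)" using alg_ints.poly_mem yA by auto
    obtain r where r: "r \<in> adjoin \<int> w" "poly h w ^ q = poly h ?y + of_nat q * r"
      using poly_frobenius[OF q(1) hZ] by auto
    have rA: "algebraic_int r"
      using Ints.adjoin_mono[OF _ alg_ints.num_ring_axioms] wA r(1) by (auto intro: int_imp_algebraic_int)
    have "poly h ?y = - of_nat q * r"
      using r(2) h(3) prime_gt_0_nat[OF q(1)] by (simp add: eq_neg_iff_add_eq_0 power_0_left)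
    then have "of_nat f / of_nat q = - r * poly (pderiv k) ?y * ?y"
      using f_eq prime_gt_0_nat[OF q(1)] by (simp add: field_simps)
    moreover have "algebraic_int (- r * poly (pderiv k) ?y * ?y)"
      by (intro algebraic_int_times kA yA) (use rA in auto)
    ultimately have "algebraic_int (of_nat f / of_nat q :: complex)" by simp
    then have "(of_nat f / of_nat q :: complex) \<in> \<int>"
      by (rule rational_algebraic_int_is_int) (auto intro: Rats_divide)
    then have "q dvd f"
      using of_int_divide_of_nat_in_Ints[of "int f" q] prime_gt_0_nat[OF q(1)] by simp
    then show False using q by simp
  qed
  then show ?thesis by (simp add: Q)
qed

text \<open>Prime factors of \<open>a\<close> are removed one at a time, with \<open>w ^ q\<close>
  in place of \<open>w\<close>. This is what makes the automorphisms of cyclotomic fields well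
  defined.\<close>

lemma poly_root_of_unity_coprime_power:
  assumes f: "f > 0" and P: "P \<in> polys_over \<rat>"
    and "w ^ f = 1" "Rings.coprime a f" "poly P w = 0"
  shows "poly P (w ^ a) = 0"
  using assms(3-)
proof (induction a arbitrary: w rule: less_induct)
  case (less a)
  consider "a = 0" | "a = 1" | "a > 1" by linarith
  then show ?case
  proof cases
    case 1
    \<comment> \<open>The number 0 is coprime to \<open>f\<close> only for \<open>f = 1\<close>, and
      then \<open>w = 1\<close>.\<close>
    then have "f = 1" using less.prems by simp
    then show ?thesis using less.prems 1 by simp
  next
    case 2
    then show ?thesis using less.prems by simp
  next
    case 3
    then have "a \<noteq> 1" by simp
    then obtain q where q: "Factorial_Ring.prime q" "q dvd a"
      using prime_factor_nat by blast
    then obtain b where b: "a = q * b" by (elim dvdE)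
    then have "b > 0" using 3 by (cases b) auto
    then have "b < a" using prime_gt_1_nat[OF q(1)] b by simp
    have "Rings.coprime q f" "Rings.coprime b f" using less.prems(2) b by simp_all
    then have "\<not> q dvd f"
      using q(1) by (metis coprime_absorb_left not_prime_unit)
    then have "poly P (w ^ q) = 0"
      by (intro poly_root_of_unity_prime_power[OF f less.prems(1) q(1) _ P less.prems(3)])
    moreover have "(w ^ q) ^ f = 1" using less.prems(1) by (metis power_mult mult.commute power_one)
    ultimately have "poly P ((w ^ q) ^ b) = 0"
      by (intro less.IH[OF \<open>b < a\<close>] \<open>Rings.coprime b f\<close>)
    then show ?thesis by (simp add: b power_mult)
  qed
qed

section \<open>The radical of a prime\<close>

text \<open>The radical of the ideal generated by \<open>p\<close> in the ring of all algebraic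
  integers. The exponent \<open>k = 0\<close> never qualifies for a prime \<open>p\<close>, because
  \<open>1 / p\<close> is not integral.\<close>

definition rad :: "nat \<Rightarrow> complex \<Rightarrow> bool" where
  "rad p x \<longleftrightarrow> algebraic_int x \<and> (\<exists>k. algebraic_int (x ^ k / of_nat p))"

lemma rad_algebraic_int: "rad p x \<Longrightarrow> algebraic_int x"
  by (simp add: rad_def)

lemma rad_mult: "rad p x \<Longrightarrow> algebraic_int y \<Longrightarrow> rad p (x * y)"
proof -
  assume x: "rad p x" and y: "algebraic_int y"
  then obtain k where k: "algebraic_int (x ^ k / of_nat p)" by (auto simp: rad_def)
  have "(x * y) ^ k / of_nat p = x ^ k / of_nat p * y ^ k" by (simp add: power_mult_distrib)
  then have "algebraic_int ((x * y) ^ k / of_nat p)"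
    using k y by (metis algebraic_int_power algebraic_int_times)
  then show ?thesis using x y by (auto simp: rad_def intro: algebraic_int_times)
qed

lemma rad_mult_left: "rad p x \<Longrightarrow> algebraic_int y \<Longrightarrow> rad p (y * x)"
  using rad_mult[of p x y] by (simp add: mult.commute)

lemma rad_minus: "rad p x \<Longrightarrow> rad p (- x)"
  using rad_mult[of p x "- 1"] by simp

lemma rad_self: "rad p (of_nat p)"
  unfolding rad_def by (auto intro!: exI[of _ 1])

lemma rad_0: "rad p 0"
  using rad_mult[OF rad_self, of 0] by simp

text \<open>In the expansion of \<open>(x + y) ^ (k + l)\<close> every term contains
  \<open>x ^ k\<close> or \<open>y ^ l\<close>.\<close>

lemma rad_add: 
  assumes "rad p x" "rad p y" shows "rad p (x + y)"
proof -
  from assms obtain k l where k: "algebraic_int (x ^ k / of_nat p)" and l: "algebraic_int (y ^ l / of_nat p)"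
    by (auto simp: rad_def)
  have A: "algebraic_int x" "algebraic_int y" using assms by (auto simp: rad_def)
  have "(x + y) ^ (k + l) / of_nat p = (\<Sum>i\<le>k+l. of_nat ((k + l) choose i) * x ^ i * y ^ (k + l - i) / of_nat p)"
    by (simp add: binomial_ring sum_divide_distrib)
  moreover have "algebraic_int (of_nat ((k + l) choose i) * x ^ i * y ^ (k + l - i) / of_nat p)" if "i \<le> k + l" for i
  proof (cases "k \<le> i")
    case True
    then have "x ^ i = x ^ k * x ^ (i - k)" by (simp add: power_add[symmetric])
    then have "of_nat ((k + l) choose i) * x ^ i * y ^ (k + l - i) / of_nat p =
        x ^ k / of_nat p * (of_nat ((k + l) choose i) * x ^ (i - k) * y ^ (k + l - i))" by simp
    then show ?thesis
      using k A by (metis algebraic_int_times algebraic_int_power algebraic_int_of_nat)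
  next
    case False
    then have "k + l - i = l + (k - i)" by simp
    then have "y ^ (k + l - i) = y ^ l * y ^ (k - i)" by (simp only: power_add)
    then have "of_nat ((k + l) choose i) * x ^ i * y ^ (k + l - i) / of_nat p =
        y ^ l / of_nat p * (of_nat ((k + l) choose i) * x ^ i * y ^ (k - i))" by simp
    then show ?thesis
      using l A by (metis algebraic_int_times algebraic_int_power algebraic_int_of_nat)
  qed
  ultimately have "algebraic_int ((x + y) ^ (k + l) / of_nat p)" by (auto intro!: algebraic_int_sum)
  then show ?thesis using A unfolding rad_def by (auto intro: algebraic_int_plus)
qed

lemma rad_diff: "rad p x \<Longrightarrow> rad p y \<Longrightarrow> rad p (x - y)"
  using rad_add[of p x "- y"] rad_minus by simp

lemma rad_sum: "(\<And>i. i \<in> I \<Longrightarrow> rad p (g i)) \<Longrightarrow> rad p (\<Sum>i\<in>I. g i)"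
  by (induction I rule: infinite_finite_induct) (auto intro: rad_0 rad_add)

lemma rad_power_iff: "rad p (x ^ n) \<Longrightarrow> algebraic_int x \<Longrightarrow> rad p x"
  unfolding rad_def by (metis power_mult)

lemma rad_of_nat_mult: "algebraic_int x \<Longrightarrow> rad p (of_nat p * x)"
  by (rule rad_mult[OF rad_self])

lemma rad_of_int_iff:
  assumes p: "Factorial_Ring.prime p"
  shows "rad p (of_int m) \<longleftrightarrow> int p dvd m"
proof
  assume "int p dvd m"
  then obtain c where "m = int p * c" by (elim dvdE)
  then have "(of_int m :: complex) = of_nat p * of_int c" by simp
  then show "rad p (of_int m)" using rad_of_nat_mult[of "of_int c" p] by simp
next
  assume "rad p (of_int m)"
  then obtain k where "algebraic_int (of_int m ^ k / of_nat p :: complex)" by (auto simp: rad_def)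
  then have "(of_int (m ^ k) / of_nat p :: complex) \<in> \<int>"
    by (intro rational_algebraic_int_is_int) (auto intro: Rats_divide)
  then have "int p dvd m ^ k"
    using of_int_divide_of_nat_in_Ints prime_gt_0_nat[OF p] by blast
  then show "int p dvd m" using p by (meson prime_dvd_power prime_nat_int_transfer)
qed

text \<open>By Bezout, an integer prime to \<open>p\<close> is invertible modulo \<open>p\<close>.
  This makes denominators prime to \<open>p\<close> harmless.\<close>

lemma rad_cancel:
  assumes "rad p (of_int d * x)" "algebraic_int x" "Rings.coprime d (int p)"
  shows "rad p x"
proof -
  obtain u v where uv: "u * d + v * int p = 1"
    using bezout_int[of d "int p"] assms(3) by auto
  have "x = of_int (u * d + v * int p) * x" by (simp add: uv)
  also have "\<dots> = of_int u * (of_int d * x) + of_nat p * (of_int v * x)" by (simp add: algebra_simps)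
  finally show ?thesis
    using rad_add[OF rad_mult_left[OF assms(1)] rad_of_nat_mult, of "of_int u" "of_int v * x"] assms(2)
    by (auto intro: algebraic_int_times)
qed

lemma rad_diff_sym: "rad p (x - y) \<Longrightarrow> rad p (y - x)"
  using rad_minus[of p "x - y"] by simp

lemma rad_mult_diff:
  assumes "rad p (x - x')" "rad p (y - y')" "algebraic_int x'" "algebraic_int y"
  shows "rad p (x * y - x' * y')"
proof -
  have "x * y - x' * y' = (x - x') * y + x' * (y - y')" by (simp add: algebra_simps)
  then show ?thesis using assms by (metis rad_add rad_mult rad_mult_left)
qed

lemma rad_prod_diff:
  assumes "\<And>i. i \<in> I \<Longrightarrow> rad p (g i - h i)" "\<And>i. i \<in> I \<Longrightarrow> algebraic_int (g i)" "\<And>i. i \<in> I \<Longrightarrow> algebraic_int (h i)"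
  shows "rad p (prod g I - prod h I)"
  using assms
proof (induction I rule: infinite_finite_induct)
  case (insert i I)
  then show ?case by (auto intro!: rad_mult_diff algebraic_int_prod)
qed (auto simp: rad_0)

section \<open>Roots of unity and reduction modulo \<open>p\<close> in cyclotomic rings\<close>

definition zeta :: "nat \<Rightarrow> complex" where
  "zeta n = cis (2 * pi / real n)"

lemma zeta_power_self [simp]: "n > 0 \<Longrightarrow> zeta n ^ n = 1"
  by (simp add: zeta_def DeMoivre)

lemma zeta_mult_power: "m > 0 \<Longrightarrow> zeta (m * n) ^ m = zeta n"
  by (simp add: zeta_def DeMoivre)

lemma zeta_power_cong: "n > 0 \<Longrightarrow> [a = b] (mod n) \<Longrightarrow> zeta n ^ a = zeta n ^ b"
proof -
  assume n: "n > 0" and ab: "[a = b] (mod n)"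
  have "zeta n ^ c = zeta n ^ (c mod n)" for c
  proof -
    have "zeta n ^ c = zeta n ^ (n * (c div n) + c mod n)" by simp
    also have "\<dots> = zeta n ^ (c mod n)" using n by (simp only: power_add power_mult zeta_power_self) simp
    finally show ?thesis .
  qed
  then show ?thesis using ab unfolding cong_def by metis
qed

lemma zeta_power_eq_1_iff:
  assumes "n > 0" shows "zeta n ^ a = 1 \<longleftrightarrow> n dvd a"
proof
  assume "n dvd a" then show "zeta n ^ a = 1" using zeta_power_cong[OF assms, of a 0] by (simp add: cong_0_iff)
next
  assume "zeta n ^ a = 1"
  then have "cis (2 * pi * real a / real n) = 1" by (simp add: zeta_def DeMoivre mult_ac)
  then have "cos (2 * pi * real a / real n) = 1" by (metis cis.sel(1) one_complex.sel(1))
  then obtain k :: int where k: "2 * pi * real a / real n = of_int k * 2 * pi"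
    by (auto simp: cos_one_2pi_int)
  then have "real a = of_int k * real n" using assms by (simp add: field_simps)
  then have "real_of_int (int a) = of_int (k * int n)" by simp
  then have "int a = k * int n" by (simp only: of_int_eq_iff)
  then show "n dvd a" by (metis dvd_triv_right int_dvd_int_iff)
qed

lemma zeta_power_inj:
  assumes "n > 0" "a < n" "b < n" "zeta n ^ a = zeta n ^ b" shows "a = b"
proof -
  have *: "c = d" if "c \<le> d" "d < n" "zeta n ^ c = zeta n ^ d" for c d
  proof -
    have "zeta n ^ c * zeta n ^ (d - c) = zeta n ^ d" using that(1) by (simp add: power_add[symmetric])
    then have "zeta n ^ c * zeta n ^ (d - c) = zeta n ^ c * 1" using that(3) by simp
    moreover have "zeta n \<noteq> 0" by (simp add: zeta_def)
    ultimately have "n dvd d - c" using zeta_power_eq_1_iff[OF assms(1)] by simp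
    then show "c = d" using that by (auto dest: dvd_imp_le)
  qed
  show ?thesis using *[of a b] *[of b a] assms by (cases a b rule: linorder_cases) auto
qed

lemma algebraic_int_zeta: "n > 0 \<Longrightarrow> algebraic_int (zeta n)"
  by (rule algebraic_int_root_of_unity[OF zeta_power_self])

abbreviation cyclo_ints :: "nat \<Rightarrow> complex set" where
  "cyclo_ints n \<equiv> adjoin \<int> (zeta n)"

abbreviation cyclo :: "nat \<Rightarrow> complex set" where
  "cyclo n \<equiv> adjoin \<rat> (zeta n)"

interpretation cyclo_ints: num_ring "cyclo_ints n" for n by (rule Ints.adjoin_num_ring)
interpretation cyclo: num_ring "cyclo n" for n by (rule Rats.adjoin_num_ring)

lemma cyclo_ints_algebraic_int: "n > 0 \<Longrightarrow> x \<in> cyclo_ints n \<Longrightarrow> algebraic_int x"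
  using Ints.adjoin_mono[OF _ alg_ints.num_ring_axioms, of "zeta n"] algebraic_int_zeta
  by (auto intro: int_imp_algebraic_int)

lemma cyclo_ints_mult_mono: "m > 0 \<Longrightarrow> cyclo_ints n \<subseteq> cyclo_ints (m * n)"
  by (intro Ints.adjoin_mono) (auto intro: Ints.adjoin_base cyclo_ints.num_ring_axioms
      simp flip: zeta_mult_power[of m n] intro!: cyclo_ints.power_mem Ints.adjoin_gen)

lemma frobenius_power:
  assumes p: "Factorial_Ring.prime p" and P: "P \<in> polys_over \<int>"
  shows "\<exists>r\<in>adjoin \<int> z. poly P z ^ (p ^ i) = poly P (z ^ (p ^ i)) + of_nat p * r"
proof (induction i)
  case 0
  interpret R: num_ring "adjoin \<int> z" by (rule Ints.adjoin_num_ring)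
  show ?case by (intro bexI[of _ 0]) (auto intro: R.zero_mem)
next
  case (Suc i)
  interpret R: num_ring "adjoin \<int> z" by (rule Ints.adjoin_num_ring)
  let ?y = "z ^ (p ^ i)"
  obtain r where r: "r \<in> adjoin \<int> z" "poly P z ^ (p ^ i) = poly P ?y + of_nat p * r" using Suc by auto
  have y: "?y \<in> adjoin \<int> z" by (intro R.power_mem Ints.adjoin_gen)
  have Py: "poly P ?y \<in> adjoin \<int> z"
    using P y polys_over_mono[of \<int> "adjoin \<int> z"] Ints.adjoin_base by (intro R.poly_mem) auto
  obtain s where s: "s \<in> adjoin \<int> z" "(poly P ?y + of_nat p * r) ^ p = poly P ?y ^ p + (of_nat p * r) ^ p + of_nat p * s"
    using R.freshman_dream[OF p Py R.mult_mem[OF R.of_nat_mem r(1)]] by auto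
  obtain t where t: "t \<in> adjoin \<int> ?y" "poly P ?y ^ p = poly P (?y ^ p) + of_nat p * t"
    using poly_frobenius[OF p P] by auto
  have tz: "t \<in> adjoin \<int> z"
    using t(1) Ints.adjoin_mono[OF _ R.num_ring_axioms y] Ints.adjoin_base by blast
  have "poly P z ^ (p ^ Suc i) = (poly P z ^ (p ^ i)) ^ p" by (simp add: power_mult[symmetric] mult.commute)
  also have "\<dots> = poly P (?y ^ p) + of_nat p * t + (of_nat p * r) ^ p + of_nat p * s"
    by (simp only: r(2) s(2) t(2))
  also have "(of_nat p * r) ^ p = of_nat p * (r * (of_nat p * r) ^ (p - 1))"
    using prime_gt_0_nat[OF p] by (metis mult.assoc power_eq_if not_gr_zero)
  also have "poly P (?y ^ p) + of_nat p * t + \<dots> + of_nat p * s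
      = poly P (?y ^ p) + of_nat p * (t + r * (of_nat p * r) ^ (p - 1) + s)" by (simp add: algebra_simps)
  also have "?y ^ p = z ^ (p ^ Suc i)" by (simp add: power_mult[symmetric] mult.commute)
  finally show ?case
    using tz r s by (intro bexI[of _ "t + r * (of_nat p * r) ^ (p - 1) + s"])
      (auto intro!: R.add_mem R.mult_mem R.power_mem R.of_nat_mem)
qed

text \<open>By the Frobenius congruence, \<open>(1 - w) ^ (p ^ i)\<close> agrees with
  \<open>1 - w ^ (p ^ i) = 0\<close> modulo \<open>p\<close>.\<close>

lemma rad_one_minus_prime_power_root:
  assumes p: "Factorial_Ring.prime p" and w: "w ^ (p ^ i) = 1"
  shows "rad p (1 - w)"
proof -
  have wA: "algebraic_int w" using algebraic_int_root_of_unity[OF w] prime_gt_0_nat[OF p] by simp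
  have "[:1, -1:] \<in> polys_over \<int>" by (auto simp: Ints.polys_over_pCons_iff Ints.polys_over_0)
  from frobenius_power[OF p this, of w i]
  obtain r where r: "r \<in> adjoin \<int> w" "(1 - w) ^ (p ^ i) = of_nat p * r" by (auto simp: w)
  have "algebraic_int r"
    using r(1) Ints.adjoin_mono[OF _ alg_ints.num_ring_axioms, of w] wA by (auto intro: int_imp_algebraic_int)
  then have "rad p ((1 - w) ^ (p ^ i))" unfolding r(2) by (rule rad_of_nat_mult)
  then show ?thesis using wA by (auto intro: rad_power_iff algebraic_int_diff)
qed

text \<open>The quotient of \<open>\<int>[\<zeta>\<^sub>g]\<close> by \<open>p\<close> is reduced if \<open>p\<close> does not divide \<open>g\<close>:
  some power of the Frobenius map is the identity on it.\<close>

lemma cyclo_ints_rad_imp_dvd: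
  assumes p: "Factorial_Ring.prime p" and g: "g > 0" "\<not> p dvd g"
    and z: "z \<in> cyclo_ints g" "rad p z"
  shows "\<exists>w\<in>cyclo_ints g. z = of_nat p * w"
proof -
  have p0: "(of_nat p :: complex) \<noteq> 0" using prime_gt_0_nat[OF p] by simp
  obtain k where "algebraic_int (z ^ k / of_nat p)" using z(2) by (auto simp: rad_def)
  then obtain n and a :: "nat \<Rightarrow> int" where n: "n > 0"
      "(z ^ k / of_nat p) ^ n = (\<Sum>i<n. of_int (a i) * (z ^ k / of_nat p) ^ i)"
    using monic_int_relation by metis
  \<comment> \<open>Clearing denominators in an integral equation of \<open>z ^ k / p\<close> shows
    that \<open>p\<close> divides \<open>z ^ (k * n)\<close> inside
    \<open>\<int>[\<zeta>\<^sub>g]\<close>, and not just among all algebraic integers.\<close>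
  define u where "u = (\<Sum>i<n. of_int (a i) * of_nat p ^ (n - 1 - i) * z ^ (k * i))"
  have u: "u \<in> cyclo_ints g" unfolding u_def
    using z(1) by (intro cyclo_ints.sum_mem cyclo_ints.mult_mem cyclo_ints.of_int_mem cyclo_ints.power_mem cyclo_ints.of_nat_mem)
  have "z ^ (k * n) = of_nat p ^ n * (z ^ k / of_nat p) ^ n"
    using p0 by (simp add: power_divide power_mult)
  also have "\<dots> = of_nat p * u"
    unfolding n(2) u_def sum_distrib_left
  proof (rule sum.cong)
    fix i assume "i \<in> {..<n}"
    then have "(of_nat p :: complex) ^ n = of_nat p * of_nat p ^ (n - 1 - i) * of_nat p ^ i"
      by (simp flip: power_Suc power_add)
    then show "of_nat p ^ n * (of_int (a i) * (z ^ k / of_nat p) ^ i) =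
        of_nat p * (of_int (a i) * of_nat p ^ (n - 1 - i) * z ^ (k * i))"
      using p0 by (simp add: power_divide power_mult)
  qed simp
  finally have zN: "z ^ (k * n) = of_nat p * u" .
  define N where "N = k * n"
  define r where "r = totient g"
  have r: "[p ^ r = 1] (mod g)" "r > 0"
    using g p euler_theorem[of p g] prime_imp_coprime_nat[of p g] unfolding r_def by auto
  \<comment> \<open>The factor \<open>r\<close> makes \<open>p ^ e \<equiv> 1 (mod g)\<close>, so
    that this Frobenius power fixes \<open>zeta g\<close>; the factor \<open>N\<close> makes
    \<open>p ^ e\<close> at least \<open>N\<close>, so that \<open>z ^ (p ^ e)\<close> is a multiple
    of \<open>p\<close>.\<close>
  define e where "e = r * N"
  have pe: "[p ^ e = 1] (mod g)" unfolding e_def power_mult using cong_pow[OF r(1), of N] by simp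
  have eN: "N \<le> p ^ e"
  proof -
    have "N \<le> e" using r by (simp add: e_def)
    also have "e < p ^ e" using prime_gt_1_nat[OF p] by (simp add: power_gt_expt)
    finally show ?thesis by simp
  qed
  obtain P where P: "P \<in> polys_over \<int>" "z = poly P (zeta g)" using z(1) by (auto simp: adjoin_def)
  obtain s where s: "s \<in> cyclo_ints g" "z ^ (p ^ e) = poly P (zeta g ^ (p ^ e)) + of_nat p * s"
    using frobenius_power[OF p P(1), of "zeta g" e] P(2) by auto
  have "zeta g ^ (p ^ e) = zeta g" using zeta_power_cong[OF g(1) pe] by simp
  then have "z = z ^ (p ^ e) - of_nat p * s" using s P by simp
  also have "z ^ (p ^ e) = z ^ N * z ^ (p ^ e - N)" using eN by (simp add: power_add[symmetric])
  also have "\<dots> - of_nat p * s = of_nat p * (u * z ^ (p ^ e - N) - s)"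
    unfolding N_def zN by (simp add: algebra_simps)
  finally show ?thesis
    using u s z by (intro bexI[of _ "u * z ^ (p ^ e - N) - s"])
      (auto intro!: cyclo_ints.diff_mem cyclo_ints.mult_mem cyclo_ints.power_mem)
qed

section \<open>Integrality in cyclotomic fields\<close>

text \<open>The difference of two monic polynomials of equal degree has smaller degree, too small
  for the roots that it would have.\<close>

lemma monic_poly_eq_prod_roots:
  fixes h :: "complex poly"
  assumes S: "finite S" "card S = degree h" "\<And>r. r \<in> S \<Longrightarrow> poly h r = 0" and h: "lead_coeff h = 1"
  shows "h = (\<Prod>r\<in>S. [:- r, 1:])"
proof (rule ccontr)
  let ?q = "\<Prod>r\<in>S. [:- r, 1:]"
  assume "h \<noteq> ?q"
  then have nz: "h - ?q \<noteq> 0" by simp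
  have dq: "degree ?q = card S" by (subst degree_prod_eq_sum_degree) auto
  have lq: "lead_coeff ?q = 1" by (simp add: lead_coeff_prod)
  have "degree (h - ?q) \<le> degree h" using S dq by (intro degree_diff_le) auto
  moreover have "coeff (h - ?q) (degree h) = 0" using h lq dq S(2) by simp
  ultimately have "degree (h - ?q) < degree h" using nz by (metis leading_coeff_0_iff le_neq_implies_less)
  moreover have "S \<subseteq> {r. poly (h - ?q) r = 0}" using S by (auto simp: poly_prod)
  then have "card S \<le> card {r. poly (h - ?q) r = 0}" using poly_roots_finite[OF nz] by (intro card_mono) auto
  ultimately show False using card_poly_roots_bound[OF nz] S(2) by simp
qed

lemma prime_eq_prod_one_minus_zeta:
  assumes p: "Factorial_Ring.prime p" and e: "e > 0"
  defines "B \<equiv> {b. b < p ^ e \<and> \<not> p dvd b}"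
  shows "of_nat p = (\<Prod>b\<in>B. 1 - zeta (p ^ e) ^ b)" and "finite B" and "card B = p ^ (e - 1) * (p - 1)"
proof -
  define m where "m = p ^ (e - 1)"
  have p1: "p > 1" using p prime_gt_1_nat by blast
  have m0: "m > 0" using p1 by (simp add: m_def)
  have pe: "p ^ e = p * m" using e by (simp add: m_def power_eq_if)
  show finB: "finite B" unfolding B_def by simp
  have "B = {..<p ^ e} - (\<lambda>c. p * c) ` {..<m}" using p1 by (auto simp: B_def pe elim!: dvdE)
  moreover have "(\<lambda>c. p * c) ` {..<m} \<subseteq> {..<p ^ e}" using p1 by (auto simp: pe)
  moreover have "card ((\<lambda>c. p * c) ` {..<m}) = m" using p1 by (subst card_image) (auto simp: inj_on_def)
  ultimately have "card B = p * m - m" by (simp add: card_Diff_subset pe)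
  then show cB: "card B = p ^ (e - 1) * (p - 1)" by (simp add: m_def algebra_simps diff_mult_distrib2)
  let ?z = "zeta (p ^ e)"
  \<comment> \<open>The \<open>p ^ e\<close>-th cyclotomic polynomial
    \<open>(X ^ (p * m) - 1) / (X ^ m - 1)\<close>. Its roots are the \<open>?z ^ b\<close> with
    \<open>b \<in> B\<close>, and its value at 1 is \<open>p\<close>.\<close>
  define H where "H = (\<Sum>i<p. Polynomial.monom (1 :: complex) (i * m))"
  have coeffH: "coeff H k = (\<Sum>i<p. if i * m = k then 1 else 0)" for k
    by (simp add: H_def coeff_sum)
  have top: "coeff H ((p - 1) * m) = 1"
  proof -
    have "coeff H ((p - 1) * m) = (\<Sum>i<p. if i = p - 1 then 1 else 0)"
      unfolding coeffH using m0 by (intro sum.cong) auto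
    also have "\<dots> = 1" using p1 by (simp add: sum.delta)
    finally show ?thesis .
  qed
  have "degree H \<le> (p - 1) * m"
  proof (rule degree_le, intro allI impI)
    fix k assume k: "(p - 1) * m < k"
    have "i * m \<noteq> k" if "i < p" for i
      using that k mult_right_mono[of i "p - 1" m] by auto
    then show "coeff H k = 0" by (simp add: coeffH)
  qed
  then have degH: "degree H = (p - 1) * m" using top le_degree[of H "(p - 1) * m"] by simp
  have polyH: "poly H x = (\<Sum>i<p. (x ^ m) ^ i)" for x
    by (simp add: H_def poly_sum poly_monom power_mult[symmetric] mult.commute)
  have "H = (\<Prod>r\<in>(\<lambda>b. ?z ^ b) ` B. [:- r, 1:])"
  proof (rule monic_poly_eq_prod_roots)
    show "finite ((\<lambda>b. ?z ^ b) ` B)" using finB by simp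
    have "inj_on (\<lambda>b. ?z ^ b) B" using zeta_power_inj[of "p ^ e"] p1 by (auto simp: inj_on_def B_def)
    then show "card ((\<lambda>b. ?z ^ b) ` B) = degree H" by (simp add: card_image cB degH m_def mult.commute)
    show "lead_coeff H = 1" using top degH by simp
    fix r assume "r \<in> (\<lambda>b. ?z ^ b) ` B"
    then obtain b where b: "b \<in> B" "r = ?z ^ b" by auto
    have "(r ^ m) ^ p = (?z ^ (p ^ e)) ^ b" unfolding b(2) pe by (simp add: power_mult[symmetric] mult_ac)
    also have "\<dots> = 1" using p1 by simp
    finally have 1: "(r ^ m) ^ p = 1" .
    have "\<not> p * m dvd m * b" using b(1) m0 by (auto simp: B_def mult.commute[of p m])
    then have 2: "r ^ m \<noteq> 1" unfolding b(2) using zeta_power_eq_1_iff[of "p ^ e" "m * b"] p1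
      by (simp add: power_mult[symmetric] mult.commute pe)
    show "poly H r = 0" unfolding polyH using geometric_sum[OF 2, of p] 1 by simp
  qed
  moreover have "inj_on (\<lambda>b. ?z ^ b) B" using zeta_power_inj[of "p ^ e"] p1 by (auto simp: inj_on_def B_def)
  ultimately have "H = (\<Prod>b\<in>B. [:- (?z ^ b), 1:])" by (simp add: prod.reindex)
  then have "poly H 1 = (\<Prod>b\<in>B. 1 - ?z ^ b)" by (simp add: poly_prod)
  moreover have "poly H 1 = of_nat p" by (simp add: polyH)
  ultimately show "of_nat p = (\<Prod>b\<in>B. 1 - zeta (p ^ e) ^ b)" by simp
qed

text \<open>All factors \<open>1 - \<zeta>\<^sup>b\<close> of \<open>p\<close> are associated to
  \<open>1 - \<zeta>\<close>: the quotient is a geometric sum, and so is its inverse, because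
  \<open>\<zeta>\<close> is in turn a power of \<open>\<zeta>\<^sup>b\<close>. The inverse
  \<open>v\<close> is kept in order to cancel the unit \<open>u\<close> within the ring.\<close>

lemma prime_eq_unit_times_power:
  assumes p: "Factorial_Ring.prime p" and e: "e > 0"
  obtains n u v where "n > 0" "u \<in> cyclo_ints (p ^ e)" "v \<in> cyclo_ints (p ^ e)" "u * v = 1"
    "of_nat p = (1 - zeta (p ^ e)) ^ n * u"
proof -
  let ?z = "zeta (p ^ e)"
  define B where "B = {b. b < p ^ e \<and> \<not> p dvd b}"
  note B = prime_eq_prod_one_minus_zeta[OF p e, folded B_def]
  have p1: "p > 1" using p prime_gt_1_nat by blast
  have pe: "p ^ e > 1" using p1 e by (rule one_less_power)
  define s where "s b = (\<Sum>i<b. ?z ^ i)" for b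
  have s: "(1 - ?z) * s b = 1 - ?z ^ b" for b unfolding s_def by (simp add: one_diff_power_eq)
  have zR: "?z \<in> cyclo_ints (p ^ e)" by (rule Ints.adjoin_gen)
  have sR: "s b \<in> cyclo_ints (p ^ e)" for b
    unfolding s_def by (intro cyclo_ints.sum_mem cyclo_ints.power_mem zR)
  have "\<not> p ^ e dvd 1" using pe by (metis nat_dvd_1_iff_1 less_irrefl)
  moreover have pe0: "0 < p ^ e" using pe by linarith
  ultimately have "?z ^ 1 \<noteq> 1" using zeta_power_eq_1_iff by blast
  then have nz: "1 - ?z \<noteq> 0" by auto
  have "\<exists>t\<in>cyclo_ints (p ^ e). s b * t = 1" if "b \<in> B" for b
  proof -
    have "Rings.coprime b (p ^ e)"
      using that p prime_imp_coprime_nat[of p b] by (auto simp: B_def coprime_commute)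
    then obtain c where c: "[b * c = 1] (mod p ^ e)" using cong_solve_coprime_nat[of b "p ^ e"] by auto
    define t where "t = (\<Sum>i<c. (?z ^ b) ^ i)"
    have "(1 - ?z ^ b) * t = 1 - (?z ^ b) ^ c" unfolding t_def by (simp add: one_diff_power_eq)
    also have "(?z ^ b) ^ c = ?z ^ 1" using zeta_power_cong[OF pe0 c] by (simp add: power_mult[symmetric])
    finally have "(1 - ?z) * (s b * t) = (1 - ?z) * 1" by (simp add: s[symmetric] mult.assoc)
    then have "s b * t = 1" using nz by simp
    moreover have "t \<in> cyclo_ints (p ^ e)"
      unfolding t_def by (intro cyclo_ints.sum_mem cyclo_ints.power_mem zR)
    ultimately show ?thesis by auto
  qed
  then obtain t where t: "\<And>b. b \<in> B \<Longrightarrow> t b \<in> cyclo_ints (p ^ e)" "\<And>b. b \<in> B \<Longrightarrow> s b * t b = 1" by metis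
  show thesis
  proof (rule that)
    show "card B > 0" using B(3) p1 by simp
    show "prod s B \<in> cyclo_ints (p ^ e)" "prod t B \<in> cyclo_ints (p ^ e)"
      by (intro cyclo_ints.prod_mem sR t; assumption)+
    show "prod s B * prod t B = 1" using t(2) by (simp add: prod.distrib[symmetric])
    show "of_nat p = (1 - ?z) ^ card B * prod s B"
      unfolding B(1) by (simp add: s[symmetric] prod.distrib)
  qed
qed

lemma adjoin_Rats_denominator:
  assumes "x \<in> adjoin \<rat> z"
  shows "\<exists>d>0. of_nat d * x \<in> adjoin \<int> z"
proof -
  interpret R: num_ring "adjoin \<int> z" by (rule Ints.adjoin_num_ring)
  obtain P where P: "P \<in> polys_over \<rat>" "x = poly P z" using assms by (auto simp: adjoin_def)
  have "\<exists>d>0. of_nat d * poly P z \<in> adjoin \<int> z" using P(1)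
  proof (induction P)
    case 0
    then show ?case by (auto intro: R.zero_mem)
  next
    case (pCons a P)
    then obtain d where d: "d > 0" "of_nat d * poly P z \<in> adjoin \<int> z" and a: "a \<in> \<rat>"
      by (auto simp: Rats.polys_over_pCons_iff)
    obtain m n :: int where mn: "n > 0" "a = of_int m / of_int n" using a by (auto elim: Rats_cases')
    then have n: "of_nat (nat n) * a = of_int m" by simp
    have "of_nat (nat n * d) * poly (pCons a P) z
        = of_nat d * (of_nat (nat n) * a) + of_nat (nat n) * z * (of_nat d * poly P z)"
      by (simp add: algebra_simps)
    also have "\<dots> \<in> adjoin \<int> z" unfolding n
      by (rule R.add_mem[OF R.mult_mem[OF R.of_nat_mem R.of_int_mem]
            R.mult_mem[OF R.mult_mem[OF R.of_nat_mem Ints.adjoin_gen] d(2)]])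
    finally have "of_nat (nat n * d) * poly (pCons a P) z \<in> adjoin \<int> z" .
    moreover have "nat n * d > 0" using d mn by simp
    ultimately show ?case by blast
  qed
  then show ?thesis by (simp add: P(2))
qed

text \<open>Modulo \<open>1 - zeta (p ^ e)\<close> the \<open>p\<close>-part of the root of unity
  \<open>zeta (p ^ e * g)\<close> becomes 1, so that a polynomial in this root reduces to one in a
  power of \<open>zeta g\<close>.\<close>

lemma cyclo_ints_decomp:
  assumes p: "Factorial_Ring.prime p" and g: "g > 0" "\<not> p dvd g" and e: "e > 0"
    and z: "z \<in> cyclo_ints (p ^ e * g)"
  shows "\<exists>c\<in>cyclo_ints g. \<exists>w\<in>cyclo_ints (p ^ e * g). z = c + (1 - zeta (p ^ e)) * w"
proof -
  let ?f = "p ^ e * g"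
  let ?R = "cyclo_ints ?f"
  have p0: "p ^ e > 0" "p ^ e * g > 0" using prime_gt_0_nat[OF p] g by auto
  have cop: "Rings.coprime (p ^ e) g" using p g prime_imp_coprime_nat[of p g] by simp
  \<comment> \<open>The Chinese remainder theorem splits \<open>zeta ?f\<close> into a power of
    \<open>zeta g\<close> and a power of \<open>zeta (p ^ e)\<close>.\<close>
  obtain u where u: "[p ^ e * u = 1] (mod g)" using cong_solve_coprime_nat[OF cop] by auto
  obtain v where v: "[g * v = 1] (mod p ^ e)" using cong_solve_coprime_nat[OF coprime_commute[THEN iffD1, OF cop]] by auto
  have "[p ^ e * u + g * v = 1 + 0] (mod g)" by (intro cong_add u) (simp add: cong_0_iff)
  moreover have "[p ^ e * u + g * v = 0 + 1] (mod p ^ e)" by (intro cong_add v) (simp add: cong_0_iff)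
  ultimately have uv: "[p ^ e * u + g * v = 1] (mod ?f)"
    using coprime_cong_mult_nat[OF _ _ cop] by simp
  have "zeta ?f = zeta ?f ^ (p ^ e * u + g * v)" using zeta_power_cong[OF p0(2) uv] by simp
  also have "\<dots> = (zeta ?f ^ (p ^ e)) ^ u * (zeta ?f ^ g) ^ v" by (simp only: power_add power_mult)
  also have "zeta ?f ^ (p ^ e) = zeta g" by (rule zeta_mult_power[OF p0(1)])
  also have "zeta ?f ^ g = zeta (p ^ e)" using zeta_mult_power[OF g(1), of "p ^ e"] by (simp add: mult.commute)
  finally have zf: "zeta ?f = zeta g ^ u * zeta (p ^ e) ^ v" .
  let ?y = "zeta g ^ u"
  have gR: "cyclo_ints g \<subseteq> ?R" by (rule cyclo_ints_mult_mono[OF p0(1)])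
  have eR: "cyclo_ints (p ^ e) \<subseteq> ?R" using cyclo_ints_mult_mono[of g "p ^ e"] g by (simp add: mult.commute)
  have y: "?y \<in> cyclo_ints g" by (intro cyclo_ints.power_mem Ints.adjoin_gen)
  define s where "s = (\<Sum>i<v. zeta (p ^ e) ^ i)"
  have s: "s \<in> ?R" unfolding s_def
    by (intro cyclo_ints.sum_mem cyclo_ints.power_mem subsetD[OF eR] Ints.adjoin_gen)
  have "zeta ?f - ?y = - ?y * (1 - zeta (p ^ e) ^ v)" by (subst zf) (simp add: algebra_simps)
  also have "1 - zeta (p ^ e) ^ v = (1 - zeta (p ^ e)) * s" by (simp add: s_def one_diff_power_eq)
  finally have diff: "zeta ?f - ?y = (1 - zeta (p ^ e)) * (- ?y * s)" by simp
  obtain P where P: "P \<in> polys_over \<int>" "z = poly P (zeta ?f)" using z by (auto simp: adjoin_def)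
  have PR: "P \<in> polys_over ?R" using P(1) polys_over_mono[of \<int> ?R] Ints.adjoin_base by auto
  obtain r where r: "r \<in> ?R" "poly P (zeta ?f) - poly P ?y = (zeta ?f - ?y) * r"
    using cyclo_ints.poly_diff_dvd[OF PR Ints.adjoin_gen subsetD[OF gR y]] by auto
  have "poly P ?y \<in> cyclo_ints g"
    using P(1) y polys_over_mono[of \<int> "cyclo_ints g"] Ints.adjoin_base by (intro cyclo_ints.poly_mem) auto
  moreover have "z = poly P ?y + (1 - zeta (p ^ e)) * (- ?y * s * r)"
  proof -
    have "z - poly P ?y = (1 - zeta (p ^ e)) * (- ?y * s * r)"
      unfolding P(2) r(2) diff by (simp only: mult.assoc)
    then show ?thesis by (metis add.commute diff_add_cancel)
  qed
  moreover have "- ?y * s * r \<in> ?R"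
    using y gR s r by (intro cyclo_ints.mult_mem cyclo_ints.minus_mem) auto
  ultimately show ?thesis by blast
qed

text \<open>In the decomposition \<open>z = c + (1 - zeta (p ^ e)) * w\<close> the part
  \<open>c\<close> lies in the radical as well. Hence it is divisible by \<open>p\<close> in
  \<open>\<int>[\<zeta>\<^sub>g]\<close>, and \<open>p\<close> is a multiple of
  \<open>1 - zeta (p ^ e)\<close>.\<close>

lemma cyclo_ints_rad_imp_dvd_lambda:
  assumes p: "Factorial_Ring.prime p" and g: "g > 0" "\<not> p dvd g" and e: "e > 0"
    and z: "z \<in> cyclo_ints (p ^ e * g)" "rad p z"
  shows "\<exists>w\<in>cyclo_ints (p ^ e * g). z = (1 - zeta (p ^ e)) * w"
proof -
  let ?R = "cyclo_ints (p ^ e * g)" and ?l = "1 - zeta (p ^ e)"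
  have p0: "p ^ e > 0" "p ^ e * g > 0" using prime_gt_0_nat[OF p] g by auto
  obtain c w where cw: "c \<in> cyclo_ints g" "w \<in> ?R" "z = c + ?l * w"
    using cyclo_ints_decomp[OF p g e z(1)] by auto
  have "rad p ?l" by (rule rad_one_minus_prime_power_root[OF p, of _ e]) (use p0 in simp)
  then have "rad p (?l * w)" using cyclo_ints_algebraic_int[OF p0(2) cw(2)] by (rule rad_mult)
  then have "rad p c" using rad_diff[OF z(2)] cw(3) by (metis add_diff_cancel_right')
  then obtain b where b: "b \<in> cyclo_ints g" "c = of_nat p * b"
    using cyclo_ints_rad_imp_dvd[OF p g cw(1)] by auto
  obtain n u where n: "n > 0" "u \<in> cyclo_ints (p ^ e)" "of_nat p = ?l ^ n * u"
    using prime_eq_unit_times_power[OF p e] by metis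
  have gR: "cyclo_ints g \<subseteq> ?R" by (rule cyclo_ints_mult_mono[OF p0(1)])
  have eR: "cyclo_ints (p ^ e) \<subseteq> ?R" using cyclo_ints_mult_mono[of g "p ^ e"] g by (simp add: mult.commute)
  have l: "?l \<in> ?R" using eR by (intro cyclo_ints.diff_mem cyclo_ints.one_mem subsetD[OF eR] Ints.adjoin_gen)
  have "z = ?l * (?l ^ (n - 1) * u * b + w)"
    unfolding cw(3) b(2) n(3) using n(1) by (cases n) (auto simp: algebra_simps)
  moreover have "?l ^ (n - 1) * u * b + w \<in> ?R"
    using l n(2) eR b(1) gR cw(2) by (intro cyclo_ints.add_mem cyclo_ints.mult_mem cyclo_ints.power_mem) auto
  ultimately show ?thesis by blast
qed

text \<open>If \<open>p\<close> divides an element of \<open>\<int>[\<zeta>]\<close> in the ring of all algebraic integers, then it does so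
  in \<open>\<int>[\<zeta>]\<close>: the prime \<open>p\<close> is a unit times a power of \<open>1 - zeta (p ^ e)\<close>, and these factors can be
  removed one at a time.\<close>

lemma cyclo_integer_denominator:
  assumes p: "Factorial_Ring.prime p" and g: "g > 0" "\<not> p dvd g" and e: "e > 0"
    and x: "x \<in> cyclo (p ^ e * g)" "algebraic_int x"
  shows "\<exists>d>0. Rings.coprime d p \<and> of_nat d * x \<in> cyclo_ints (p ^ e * g)"
proof -
  let ?R = "cyclo_ints (p ^ e * g)" and ?l = "1 - zeta (p ^ e)"
  have p0: "p ^ e > 0" "p ^ e * g > 0" "p > 0" using prime_gt_0_nat[OF p] g by auto
  define good where "good d \<longleftrightarrow> d > 0 \<and> of_nat d * x \<in> ?R" for d
  \<comment> \<open>The least denominator: if \<open>p\<close> divided it, \<open>d div p\<close>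
    would turn out to be a denominator too.\<close>
  define d where "d = (LEAST d. good d)"
  have ex: "\<exists>d. good d" using adjoin_Rats_denominator[OF x(1)] by (auto simp: good_def)
  then have d: "good d" unfolding d_def by (rule LeastI_ex)
  have min: "\<not> good d'" if "d' < d" for d' using that unfolding d_def by (rule not_less_Least)
  obtain n u v where n: "n > 0" "u \<in> cyclo_ints (p ^ e)" "v \<in> cyclo_ints (p ^ e)" "u * v = 1" "of_nat p = ?l ^ n * u"
    using prime_eq_unit_times_power[OF p e] by metis
  have eR: "cyclo_ints (p ^ e) \<subseteq> ?R" using cyclo_ints_mult_mono[of g "p ^ e"] g by (simp add: mult.commute)
  have l0: "?l \<noteq> 0" using n(1,5) p0 by (auto simp: power_0_left)
  have lR: "rad p ?l" by (rule rad_one_minus_prime_power_root[OF p, of _ e]) (use p0 in simp)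
  have "\<not> p dvd d"
  proof
    assume "p dvd d"
    then obtain d' where d': "d = p * d'" by (elim dvdE)
    have d'0: "d' > 0" "d' < d" using d d' prime_gt_1_nat[OF p] by (auto simp: good_def intro!: Nat.gr0I)
    have dx: "of_nat d * x = of_nat p * (of_nat d' * x)" by (simp add: d')
    have "\<exists>w\<in>?R. of_nat d * x = ?l ^ i * w" if "i \<le> n" for i
      using that
    proof (induction i)
      case 0
      then show ?case using d by (auto simp: good_def)
    next
      case (Suc i)
      then obtain w where w: "w \<in> ?R" "of_nat d * x = ?l ^ i * w" by auto
      have "n = i + (n - i)" using Suc.prems by simp
      then have ln: "?l ^ n = ?l ^ i * ?l ^ (n - i)" by (metis power_add)
      have "?l ^ i * w = of_nat p * (of_nat d' * x)" using w(2) dx by metis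
      also have "\<dots> = ?l ^ i * (?l ^ (n - i) * (u * (of_nat d' * x)))"
        by (simp only: n(5) ln mult.assoc)
      finally have "w = ?l ^ (n - i) * (u * (of_nat d' * x))" using l0 by simp
      also have "?l ^ (n - i) = ?l ^ Suc (n - i - 1)" using Suc.prems by (intro arg_cong[of _ _ "power ?l"]) simp
      also have "\<dots> = ?l * ?l ^ (n - i - 1)" by (rule power_Suc)
      finally have weq: "w = ?l * (?l ^ (n - i - 1) * (u * (of_nat d' * x)))" by simp
      \<comment> \<open>While \<open>i < n\<close>, the element \<open>w\<close> still is
        \<open>?l\<close> times an algebraic integer and so lies in the radical of \<open>p\<close>.
        Therefore one more factor \<open>?l\<close> splits off within \<open>?R\<close>.\<close>
      have "algebraic_int u" using cyclo_ints_algebraic_int n(2) p0 by blast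
      then have "rad p w" unfolding weq using lR x(2)
        by (intro rad_mult algebraic_int_times algebraic_int_power rad_algebraic_int[OF lR]) auto
      then obtain w' where "w' \<in> ?R" "w = ?l * w'"
        using cyclo_ints_rad_imp_dvd_lambda[OF p g e w(1)] by auto
      then show ?case using w(2) by (auto intro!: bexI[of _ w'])
    qed
    then obtain w where w: "w \<in> ?R" "of_nat d * x = ?l ^ n * w" by auto
    \<comment> \<open>The unit \<open>v\<close> turns \<open>?l ^ n\<close> back into
      \<open>p\<close>, which cancels against the factor \<open>p\<close> of
      \<open>d\<close>.\<close>
    have "of_nat p * (v * w) = ?l ^ n * w * (u * v)" by (simp add: n(5) mult_ac)
    also have "\<dots> = of_nat p * (of_nat d' * x)" by (simp only: n(4) mult_1_right w(2)[symmetric] dx)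
    finally have "of_nat p * (of_nat d' * x) = of_nat p * (v * w)" ..
    then have "of_nat d' * x = v * w" using p0 by simp
    moreover have "v * w \<in> ?R" using n(3) eR w(1) by (intro cyclo_ints.mult_mem) auto
    ultimately have "good d'" using d'0 by (simp add: good_def)
    then show False using min d'0 by auto
  qed
  then have "Rings.coprime d p" using p prime_imp_coprime_nat coprime_commute by blast
  then show ?thesis using d by (auto simp: good_def)
qed

section \<open>Automorphisms of cyclotomic fields\<close>

text \<open>Any rational polynomial that represents \<open>x\<close> in terms of
  \<open>\<zeta>\<^sub>f\<close> is evaluated at \<open>\<zeta>\<^sub>f\<^sup>a\<close>. For
  \<open>a\<close> coprime to \<open>f\<close> the choice is immaterial, as conjugate roots of unity
  satisfy the same rational equations.\<close>

definition sig :: "nat \<Rightarrow> nat \<Rightarrow> complex \<Rightarrow> complex" where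
  "sig f a x = poly (SOME P. P \<in> polys_over \<rat> \<and> poly P (zeta f) = x) (zeta f ^ a)"

lemma polys_over_cyclo: "P \<in> polys_over \<rat> \<Longrightarrow> P \<in> polys_over (cyclo f)"
  using polys_over_mono[of \<rat> "cyclo f"] Rats.adjoin_base by blast

locale cyclo_aut =
  fixes f a :: nat
  assumes f_pos: "f > 0" and cop: "Rings.coprime a f"
begin

lemma sig_poly:
  assumes P: "P \<in> polys_over \<rat>"
  shows "sig f a (poly P (zeta f)) = poly P (zeta f ^ a)"
proof -
  define Q where "Q = (SOME Q. Q \<in> polys_over \<rat> \<and> poly Q (zeta f) = poly P (zeta f))"
  have "Q \<in> polys_over \<rat> \<and> poly Q (zeta f) = poly P (zeta f)"
    unfolding Q_def by (rule someI[of _ P]) (simp add: P)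
  then have "poly (Q - P) (zeta f ^ a) = 0"
    using poly_root_of_unity_coprime_power[OF f_pos Rats.polys_over_diff[of Q P] _ cop, of "zeta f"] f_pos P
    by simp
  then show ?thesis by (simp add: sig_def Q_def)
qed

lemma cyclo_cases:
  assumes "x \<in> cyclo f"
  obtains P where "P \<in> polys_over \<rat>" "x = poly P (zeta f)"
  using assms by (auto simp: adjoin_def)

lemma sig_mem: "x \<in> cyclo f \<Longrightarrow> sig f a x \<in> cyclo f"
  by (auto elim!: cyclo_cases simp: sig_poly
      intro!: cyclo.poly_mem cyclo.power_mem Rats.adjoin_gen polys_over_cyclo)

lemma sig_diff: "x \<in> cyclo f \<Longrightarrow> y \<in> cyclo f \<Longrightarrow> sig f a (x - y) = sig f a x - sig f a y"
  by (elim cyclo_cases) (simp add: sig_poly Rats.polys_over_diff flip: poly_diff)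

lemma sig_add: "x \<in> cyclo f \<Longrightarrow> y \<in> cyclo f \<Longrightarrow> sig f a (x + y) = sig f a x + sig f a y"
  by (elim cyclo_cases) (simp add: sig_poly Rats.polys_over_add flip: poly_add)

lemma sig_mult: "x \<in> cyclo f \<Longrightarrow> y \<in> cyclo f \<Longrightarrow> sig f a (x * y) = sig f a x * sig f a y"
  by (elim cyclo_cases) (simp add: sig_poly Rats.polys_over_mult flip: poly_mult)

lemma sig_Rats: "c \<in> \<rat> \<Longrightarrow> sig f a c = c"
  using sig_poly[of "[:c:]"] Rats.polys_over_const by simp

lemma sig_power: "x \<in> cyclo f \<Longrightarrow> sig f a (x ^ k) = sig f a x ^ k"
  by (induction k) (auto simp: sig_Rats sig_mult cyclo.power_mem)

lemma sig_sum: "(\<And>i. i \<in> I \<Longrightarrow> g i \<in> cyclo f) \<Longrightarrow> sig f a (sum g I) = (\<Sum>i\<in>I. sig f a (g i))"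
  by (induction I rule: infinite_finite_induct) (auto simp: sig_Rats sig_add cyclo.sum_mem)

lemma sig_prod: "(\<And>i. i \<in> I \<Longrightarrow> g i \<in> cyclo f) \<Longrightarrow> sig f a (prod g I) = (\<Prod>i\<in>I. sig f a (g i))"
  by (induction I rule: infinite_finite_induct) (auto simp: sig_Rats sig_mult cyclo.prod_mem)

lemma sig_poly_apply:
  assumes "P \<in> polys_over \<rat>" "x \<in> cyclo f"
  shows "sig f a (poly P x) = poly P (sig f a x)"
  using assms(1)
proof (induction P)
  case (pCons c P)
  then have "P \<in> polys_over \<rat>" "c \<in> \<rat>" by (auto simp: Rats.polys_over_pCons_iff)
  moreover from this have "poly P x \<in> cyclo f"
    using assms(2) by (intro cyclo.poly_mem polys_over_cyclo)
  ultimately show ?case using pCons.IH assms(2)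
    by (simp add: sig_add sig_mult sig_Rats Rats.adjoin_base cyclo.mult_mem)
qed (simp add: sig_Rats)

lemma sig_algebraic_int:
  assumes "x \<in> cyclo f" "algebraic_int x" shows "algebraic_int (sig f a x)"
proof -
  obtain P where P: "lead_coeff P = 1" "\<forall>i. coeff P i \<in> \<int>" "poly P x = 0"
    using assms(2) by (auto elim: algebraic_int.cases)
  then have "P \<in> polys_over \<rat>" using Ints_subset_Rats by (auto simp: polys_over_def)
  then have "poly P (sig f a x) = sig f a (poly P x)" using sig_poly_apply[OF _ assms(1)] by simp
  then have "poly P (sig f a x) = 0" using P(3) sig_Rats[OF Rats_0] by simp
  then show ?thesis using P by (auto intro: algebraic_int.intros)
qed

text \<open>The number \<open>1 / p\<close> is rational and hence fixed, so the integrality of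
  \<open>x ^ k / p\<close> passes to its image.\<close>

lemma sig_rad:
  assumes x: "x \<in> cyclo f" "rad p x" shows "rad p (sig f a x)"
proof -
  obtain k where k: "algebraic_int (x ^ k / of_nat p)" using x by (auto simp: rad_def)
  have q: "1 / of_nat p \<in> (\<rat> :: complex set)" by auto
  have "sig f a (x ^ k * (1 / of_nat p)) = sig f a x ^ k * (1 / of_nat p)"
    using x by (simp only: sig_mult[OF cyclo.power_mem Rats.adjoin_base[OF q]] sig_power sig_Rats[OF q])
  moreover have "x ^ k * (1 / of_nat p) \<in> cyclo f"
    by (intro cyclo.mult_mem cyclo.power_mem x Rats.adjoin_base q)
  ultimately have "algebraic_int (sig f a x ^ k / of_nat p)"
    using sig_algebraic_int[of "x ^ k * (1 / of_nat p)"] k by simp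
  then show ?thesis
    using sig_algebraic_int[OF x(1) rad_algebraic_int[OF x(2)]] unfolding rad_def by blast
qed

lemma sig_cong: "[a = b] (mod f) \<Longrightarrow> sig f a x = sig f b x"
  using zeta_power_cong[OF f_pos] by (simp add: sig_def)

text \<open>Since \<open>zeta g = zeta f ^ m\<close>, substituting \<open>X ^ m\<close> turns a
  polynomial in \<open>zeta g\<close> into one in \<open>zeta f\<close>.\<close>

lemma sig_subfield:
  assumes x: "x \<in> cyclo g" and f: "f = m * g"
  shows "sig f a x = sig g a x" and "x \<in> cyclo f"
proof -
  have m: "m > 0" and g: "g > 0" using f_pos f by auto
  interpret g: cyclo_aut g a using g cop f by unfold_locales auto
  obtain P where P: "P \<in> polys_over \<rat>" "x = poly P (zeta g)" using g.cyclo_cases[OF x] .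
  define Q where "Q = pcompose P (Polynomial.monom 1 m)"
  have Q: "Q \<in> polys_over \<rat>" unfolding Q_def using P by (intro Rats.polys_over_pcompose Rats.polys_over_monom) auto
  have zm: "zeta f ^ m = zeta g" using zeta_mult_power[OF m] f by simp
  then have xQ: "x = poly Q (zeta f)" by (simp add: Q_def poly_pcompose poly_monom P)
  then show "x \<in> cyclo f" using Q by (auto simp: adjoin_def)
  have "sig f a x = poly Q (zeta f ^ a)" using xQ sig_poly[OF Q] by simp
  also have "\<dots> = poly P ((zeta f ^ m) ^ a)"
    by (simp add: Q_def poly_pcompose poly_monom power_mult[symmetric] mult.commute)
  also have "\<dots> = sig g a x" using g.sig_poly[OF P(1)] P(2) zm by simp
  finally show "sig f a x = sig g a x" .
qed

end

section \<open>Composition of cyclotomic automorphisms and fixed fields\<close>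

lemma sig_sig:
  assumes "f > 0" "Rings.coprime a f" "Rings.coprime b f" "x \<in> cyclo f"
  shows "sig f b (sig f a x) = sig f (a * b) x"
proof -
  interpret a: cyclo_aut f a using assms by unfold_locales
  interpret b: cyclo_aut f b using assms by unfold_locales
  interpret ab: cyclo_aut f "a * b" using assms by unfold_locales simp_all
  obtain P where P: "P \<in> polys_over \<rat>" "x = poly P (zeta f)" using a.cyclo_cases[OF assms(4)] .
  have "sig f b (zeta f) = zeta f ^ b"
    using b.sig_poly[of "[:0, 1:]"] by (simp add: Rats.polys_over_pCons_iff Rats.polys_over_0)
  then have "sig f b (zeta f ^ a) = (zeta f ^ b) ^ a" by (simp add: b.sig_power Rats.adjoin_gen)
  then have "sig f b (sig f a x) = poly P ((zeta f ^ b) ^ a)"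
    unfolding P(2) a.sig_poly[OF P(1)]
    by (subst b.sig_poly_apply[OF P(1)]) (auto intro: cyclo.power_mem Rats.adjoin_gen)
  also have "\<dots> = sig f (a * b) x" unfolding P(2) ab.sig_poly[OF P(1)] by (simp add: power_mult[symmetric] mult.commute)
  finally show ?thesis .
qed

lemma sig_1: "f > 0 \<Longrightarrow> x \<in> cyclo f \<Longrightarrow> sig f (Suc 0) x = x"
proof -
  assume "f > 0" and x: "x \<in> cyclo f"
  then interpret cyclo_aut f "Suc 0" by unfold_locales auto
  show ?thesis using x by (elim cyclo_cases) (simp add: sig_poly)
qed

lemma sig_inj:
  assumes "f > 0" "Rings.coprime a f" "x \<in> cyclo f" "y \<in> cyclo f" "sig f a x = sig f a y"
  shows "x = y"
proof -
  obtain b where b: "[a * b = Suc 0] (mod f)" using cong_solve_coprime_nat[OF assms(2)] by auto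
  then have cb: "Rings.coprime b f"
    by (metis coprime_iff_invertible_nat mult.commute)
  interpret ab: cyclo_aut f "a * b" using assms cb by unfold_locales simp_all
  have "z = sig f b (sig f a z)" if "z \<in> cyclo f" for z
    using sig_sig[OF assms(1,2) cb that] ab.sig_cong[OF b] sig_1[OF assms(1) that] by simp
  then show ?thesis using assms by metis
qed

text \<open>The set \<open>T\<close> collects the exponents \<open>1 + g * t\<close> of
  automorphisms over \<open>\<rat>(\<zeta>\<^sub>g)\<close>. The sum over all \<open>t < p\<close>
  is a geometric sum with value 0, or else \<open>p\<close> times a power of \<open>zeta g\<close>;
  the exponents outside \<open>T\<close> are multiples of \<open>p\<close>, and their terms are
  powers of \<open>zeta g\<close> as well.\<close>

lemma sum_zeta_powers_mem:
  assumes p: "Factorial_Ring.prime p" and g: "g > 0"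
  defines "T \<equiv> {t. t < p \<and> Rings.coprime (1 + g * t) (p * g)}"
  shows "(\<Sum>t\<in>T. zeta (p * g) ^ ((1 + g * t) * j)) \<in> cyclo g"
proof -
  let ?z = "zeta (p * g)"
  have p0: "p > 0" using prime_gt_0_nat[OF p] .
  have zp: "?z ^ p = zeta g" using zeta_mult_power[OF p0] .
  have zg: "?z ^ g = zeta p" using zeta_mult_power[OF g, of p] by (simp add: mult.commute)
  have pow: "?z ^ ((1 + g * t) * j) = ?z ^ j * (zeta p ^ j) ^ t" for t
  proof -
    have "(1 + g * t) * j = j + g * (j * t)" by (simp add: algebra_simps)
    then show ?thesis by (simp only: power_add power_mult zg)
  qed
  have full: "(\<Sum>t<p. ?z ^ ((1 + g * t) * j)) \<in> cyclo g"
  proof (cases "p dvd j")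
    case True
    then obtain c where c: "j = p * c" by (elim dvdE)
    have "zeta p ^ j = 1" using True zeta_power_eq_1_iff[OF p0] by simp
    then have "(\<Sum>t<p. ?z ^ ((1 + g * t) * j)) = of_nat p * zeta g ^ c"
      unfolding pow by (simp add: c power_mult zp)
    then show ?thesis by (auto intro!: cyclo.mult_mem cyclo.of_nat_mem cyclo.power_mem Rats.adjoin_gen)
  next
    case False
    then have 1: "zeta p ^ j \<noteq> 1" using zeta_power_eq_1_iff[OF p0] by simp
    have "(zeta p ^ j) ^ p = (zeta p ^ p) ^ j" by (simp only: power_mult[symmetric] mult.commute)
    then have "(\<Sum>t<p. (zeta p ^ j) ^ t) = 0" using geometric_sum[OF 1, of p] p0 by simp
    then have "(\<Sum>t<p. ?z ^ ((1 + g * t) * j)) = 0"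
      unfolding pow sum_distrib_left[symmetric] by simp
    then show ?thesis by (simp add: cyclo.zero_mem)
  qed
  have rest: "?z ^ ((1 + g * t) * j) \<in> cyclo g" if "t \<in> {..<p} - T" for t
  proof -
    have "\<not> Rings.coprime (1 + g * t) (p * g)" using that by (auto simp: T_def)
    moreover have "Rings.coprime (1 + g * t) g"
      by (rule coprimeI) (metis dvd_add_left_iff dvd_mult2)
    ultimately have "\<not> Rings.coprime p (1 + g * t)"
      by (simp add: coprime_commute)
    then have "p dvd 1 + g * t" using p prime_imp_coprime_nat by blast
    then obtain c where c: "1 + g * t = p * c" by (elim dvdE)
    then have "?z ^ ((1 + g * t) * j) = zeta g ^ (c * j)" by (simp only: power_mult zp)
    then show ?thesis by (auto intro!: cyclo.power_mem Rats.adjoin_gen)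
  qed
  have "T \<subseteq> {..<p}" by (auto simp: T_def)
  then have "(\<Sum>t\<in>T. ?z ^ ((1 + g * t) * j)) =
      (\<Sum>t<p. ?z ^ ((1 + g * t) * j)) - (\<Sum>t\<in>{..<p} - T. ?z ^ ((1 + g * t) * j))"
    by (simp add: sum_diff)
  also have "\<dots> \<in> cyclo g" by (intro cyclo.diff_mem full cyclo.sum_mem rest)
  finally show ?thesis .
qed

text \<open>Average over the automorphisms that fix \<open>zeta g\<close>.\<close>

lemma cyclo_descent:
  assumes p: "Factorial_Ring.prime p" and g: "g > 0" and x: "x \<in> cyclo (p * g)"
    and fixed: "\<And>a. Rings.coprime a (p * g) \<Longrightarrow> [a = 1] (mod g) \<Longrightarrow> sig (p * g) a x = x"
  shows "x \<in> cyclo g"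
proof -
  let ?z = "zeta (p * g)"
  define T where "T = {t. t < p \<and> Rings.coprime (1 + g * t) (p * g)}"
  have p0: "p > 0" using prime_gt_0_nat[OF p] .
  have T: "finite T" "0 \<in> T" using p0 by (auto simp: T_def)
  then have cT: "card T > 0" by (auto simp: card_gt_0_iff)
  obtain P where P: "P \<in> polys_over \<rat>" "x = poly P ?z" using x by (auto simp: adjoin_def)
  have "x = poly P (?z ^ (1 + g * t))" if "t \<in> T" for t
  proof -
    have c: "Rings.coprime (1 + g * t) (p * g)" using that by (simp add: T_def)
    interpret cyclo_aut "p * g" "1 + g * t" using c p0 g by unfold_locales auto
    have "[1 + g * t = 1 + 0] (mod g)" by (intro cong_add) (auto simp: cong_0_iff)
    then show ?thesis using fixed[OF c] sig_poly[OF P(1)] P(2) by simp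
  qed
  then have "(\<Sum>t\<in>T. x) = (\<Sum>t\<in>T. poly P (?z ^ (1 + g * t)))" by (intro sum.cong) auto
  then have "of_nat (card T) * x = (\<Sum>t\<in>T. poly P (?z ^ (1 + g * t)))" by (simp only: sum_constant)
  also have "\<dots> = (\<Sum>t\<in>T. \<Sum>j\<le>degree P. coeff P j * ?z ^ ((1 + g * t) * j))"
    by (simp only: poly_altdef power_mult)
  also have "\<dots> = (\<Sum>j\<le>degree P. coeff P j * (\<Sum>t\<in>T. ?z ^ ((1 + g * t) * j)))"
    by (subst sum.swap) (simp only: sum_distrib_left)
  also have "\<dots> \<in> cyclo g"
    using P(1) unfolding T_def polys_over_def
    by (intro cyclo.sum_mem cyclo.mult_mem sum_zeta_powers_mem p g Rats.adjoin_base) auto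
  finally have "of_nat (card T) * x \<in> cyclo g" .
  then have "(1 / of_nat (card T)) * (of_nat (card T) * x) \<in> cyclo g"
    by (rule cyclo.mult_mem[OF Rats.adjoin_base, rotated]) auto
  then show ?thesis using cT by simp
qed

text \<open>Descent removes the prime factors of \<open>f\<close> one at a time until
  \<open>\<rat>(\<zeta>\<^sub>1) = \<rat>\<close> is reached.\<close>

lemma cyclo_fixed_imp_Rats:
  assumes "f > 0" "x \<in> cyclo f" "\<And>a. Rings.coprime a f \<Longrightarrow> sig f a x = x"
  shows "x \<in> \<rat>"
  using assms
proof (induction f rule: less_induct)
  case (less f)
  show ?case
  proof (cases "f = 1")
    case True
    have "zeta 1 = 1" by (simp add: zeta_def)
    then show ?thesis using less.prems(2) Rats.adjoin_mono[of \<rat> 1] Rats.num_ring_axioms True by auto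
  next
    case False
    then obtain p where p: "Factorial_Ring.prime p" "p dvd f" using prime_factor_nat by blast
    then obtain g where f: "f = p * g" by (elim dvdE)
    have g: "g > 0" "g < f" using less.prems(1) f prime_gt_1_nat[OF p(1)] by (auto intro: Nat.gr0I)
    have xg: "x \<in> cyclo g"
      using less.prems f by (intro cyclo_descent[OF p(1) g(1)]) auto
    show ?thesis
    proof (rule less.IH[OF g(2,1) xg])
      fix b assume b: "Rings.coprime b g"
      \<comment> \<open>An exponent prime to \<open>g\<close> lifts to one prime to
        \<open>p * g\<close>: take \<open>b\<close> itself unless \<open>p\<close> divides it, and
        then \<open>b + g\<close>, because in this case \<open>p\<close> does not divide
        \<open>g\<close>.\<close>
      obtain a where a: "Rings.coprime a f" "[a = b] (mod g)"
      proof (cases "p dvd b")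
        case False
        then have "Rings.coprime p b" using p(1) prime_imp_coprime_nat by blast
        then have "Rings.coprime b f" using b f by (simp add: coprime_commute)
        then show ?thesis using that cong_refl by metis
      next
        case True
        then have "\<not> p dvd g" using b p(1) by (meson coprime_common_divisor not_prime_unit)
        then have "\<not> p dvd b + g" using True by (simp add: dvd_add_right_iff)
        then have "Rings.coprime p (b + g)" using p prime_imp_coprime_nat by blast
        moreover have "Rings.coprime (b + g) g"
          by (rule coprimeI) (use b in \<open>metis coprime_common_divisor dvd_add_left_iff\<close>)
        ultimately have "Rings.coprime (b + g) f" using f by (simp add: coprime_commute)
        then show ?thesis using that[of "b + g"] by (simp add: cong_def)
      qed
      interpret a: cyclo_aut f a using a less.prems by unfold_locales
      interpret g: cyclo_aut g a using a(1) g f by unfold_locales auto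
      have "sig g b x = sig g a x" using g.sig_cong[OF a(2)] by simp
      also have "\<dots> = sig f a x" using a.sig_subfield(1)[OF xg f] by simp
      finally show "sig g b x = x" using less.prems(3)[OF a(1)] by simp
    qed
  qed
qed

text \<open>With \<open>f = p * h\<close> and \<open>a = 1 + h * t\<close>, the difference
  \<open>\<zeta>\<^sub>f\<^sup>a - \<zeta>\<^sub>f\<close> is a unit times
  \<open>1 - zeta p ^ t\<close> and lies in the radical. It divides \<open>sig f a y - y\<close> for
  every \<open>y\<close> in \<open>\<int>[\<zeta>\<^sub>f]\<close>; the denominator \<open>d\<close>
  of \<open>x\<close>, prime to \<open>p\<close>, is cancelled at the end.\<close>

lemma sig_inertia:
  assumes p: "Factorial_Ring.prime p" "p dvd f" and f: "f > 0" and x: "x \<in> cyclo f" "algebraic_int x"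
    and a: "Rings.coprime a f" "[a = 1] (mod f div p)"
  shows "rad p (sig f a x - x)"
proof -
  interpret cyclo_aut f a using f a by unfold_locales
  define e where "e = multiplicity p f"
  obtain g where g: "f = p ^ e * g" "\<not> p dvd g"
    using multiplicity_decompose'[of f p] f p not_prime_unit unfolding e_def by blast
  have e: "e > 0" using g p by (auto intro: Nat.gr0I)
  have g0: "g > 0" using f g by (auto intro: Nat.gr0I)
  have p1: "p > 1" using p prime_gt_1_nat by blast
  obtain d where d: "d > 0" "Rings.coprime d p" "of_nat d * x \<in> cyclo_ints f"
    using cyclo_integer_denominator[OF p(1) g0 g(2) e] x g(1) by auto
  obtain P where P: "P \<in> polys_over \<int>" "of_nat d * x = poly P (zeta f)" using d by (auto simp: adjoin_def)
  have PQ: "P \<in> polys_over \<rat>" using P(1) polys_over_mono[OF Ints_subset_Rats] by auto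
  have PR: "P \<in> polys_over (cyclo_ints f)" using P(1) polys_over_mono[of \<int> "cyclo_ints f"] Ints.adjoin_base by auto
  have "of_nat d * sig f a x = sig f a (of_nat d * x)"
    using x by (simp add: sig_mult sig_Rats Rats.adjoin_base)
  also have "\<dots> = poly P (zeta f ^ a)" by (simp add: P sig_poly[OF PQ])
  finally have "of_nat d * (sig f a x - x) = poly P (zeta f ^ a) - poly P (zeta f)"
    by (simp add: right_diff_distrib P)
  moreover obtain r where r: "r \<in> cyclo_ints f" "poly P (zeta f ^ a) - poly P (zeta f) = (zeta f ^ a - zeta f) * r"
    using cyclo_ints.poly_diff_dvd[OF PR cyclo_ints.power_mem[OF Ints.adjoin_gen] Ints.adjoin_gen] by blast
  moreover have "rad p (zeta f ^ a - zeta f)"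
  proof -
    obtain h where h: "f = p * h" using p by (elim dvdE)
    have "a \<noteq> 0"
    proof
      assume "a = 0"
      then have "f = 1" using a(1) by simp
      then show False using p(2) p1 by simp
    qed
    have "[a = 1] (mod h)" using a(2) h p1 by simp
    then obtain t where t: "a = t * h + 1" using cong_le_nat[of 1 a h] \<open>a \<noteq> 0\<close> by auto
    have h0: "h > 0" using f h by (auto intro: Nat.gr0I)
    have zh: "zeta f ^ h = zeta p" using zeta_mult_power[OF h0, of p] h by (simp add: mult.commute)
    have "a = 1 + h * t" by (simp add: t mult.commute)
    then have "zeta f ^ a = zeta f * zeta p ^ t" by (simp only: power_add power_mult zh power_one_right)
    then have *: "zeta f ^ a - zeta f = - zeta f * (1 - zeta p ^ t)" by (simp add: algebra_simps)
    have "(zeta p ^ t) ^ (p ^ 1) = (zeta p ^ p) ^ t" by (simp add: power_mult[symmetric] mult.commute)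
    then have "rad p (1 - zeta p ^ t)"
      using p1 by (intro rad_one_minus_prime_power_root[OF p(1), of _ 1]) simp
    then show ?thesis unfolding * using algebraic_int_zeta[OF f] by (intro rad_mult_left) auto
  qed
  ultimately have "rad p (of_int (int d) * (sig f a x - x))"
    using cyclo_ints_algebraic_int[OF f] by (auto intro: rad_mult)
  then show ?thesis
  proof (rule rad_cancel)
    show "algebraic_int (sig f a x - x)" using x sig_algebraic_int by (auto intro: algebraic_int_diff)
    show "Rings.coprime (int d) (int p)" using d by simp
  qed
qed

section \<open>Number fields of prime degree\<close>

lemma complex_field_simps [simp]:
  "carrier complex_field = UNIV"
  "x \<otimes>\<^bsub>complex_field\<^esub> y = x * y"
  "x \<oplus>\<^bsub>complex_field\<^esub> y = x + y"
  "\<one>\<^bsub>complex_field\<^esub> = 1"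
  "\<zero>\<^bsub>complex_field\<^esub> = 0"
  by (simp_all add: ring_of_type_algebra_def)

lemma complex_field_power [simp]: "x [^]\<^bsub>complex_field\<^esub> (n :: nat) = x ^ n"
proof -
  interpret field complex_field by (rule field_from_type_algebra)
  show ?thesis by (induction n) (auto simp: mult.commute)
qed

lemma complex_field_inv [simp]:
  assumes "x \<noteq> 0" shows "inv\<^bsub>complex_field\<^esub> x = inverse x"
proof -
  interpret field complex_field by (rule field_from_type_algebra)
  show ?thesis by (rule inv_char) (use assms in auto)
qed

lemma complex_field_uminus [simp]: "\<ominus>\<^bsub>complex_field\<^esub> x = - x"
proof -
  interpret field complex_field by (rule field_from_type_algebra)
  show ?thesis by (rule minus_equality) auto
qed

lemma subfield_complex_fieldI:
  assumes "num_ring S" "\<And>x. x \<in> S \<Longrightarrow> x \<noteq> 0 \<Longrightarrow> inverse x \<in> S"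
  shows "subfield S complex_field"
proof -
  interpret field complex_field by (rule field_from_type_algebra)
  interpret S: num_ring S by fact
  show ?thesis
    by (intro subfieldI' subringI) (auto intro: assms(2) S.one_mem S.minus_mem S.mult_mem S.add_mem)
qed

lemma
  assumes "subfield S complex_field"
  shows subfield_num_ring: "num_ring S"
    and subfield_inverse_mem: "x \<in> S \<Longrightarrow> x \<noteq> 0 \<Longrightarrow> inverse x \<in> S"
    and subfield_Rats_subset: "\<rat> \<subseteq> S"
proof -
  interpret field complex_field by (rule field_from_type_algebra)
  note * = subringE[OF subfieldE(1)[OF assms]]
  have d: "x - y \<in> S" if "x \<in> S" "y \<in> S" for x y
    using *(7)[OF that(1) *(5)[OF that(2)]] by simp
  show S: "num_ring S"
    by unfold_locales (use * d in auto)
  have i: "inverse x \<in> S" if "x \<in> S" "x \<noteq> 0" for x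
    using subfield_m_inv(1)[OF assms, of x] that by auto
  then show "x \<in> S \<Longrightarrow> x \<noteq> 0 \<Longrightarrow> inverse x \<in> S" .
  interpret S: num_ring S by fact
  show "\<rat> \<subseteq> S"
  proof
    fix x :: complex assume "x \<in> \<rat>"
    then obtain m n :: int where "n > 0" "x = of_int m / of_int n" by (auto elim: Rats_cases')
    then show "x \<in> S" using i[OF S.of_int_mem, of n] S.mult_mem[OF S.of_int_mem[of m]]
      by (auto simp: divide_inverse)
  qed
qed

lemma cyclo_inverse_mem:
  assumes n: "n > 0" and x: "x \<in> cyclo n" "x \<noteq> 0"
  shows "inverse x \<in> cyclo n"
proof -
  obtain d where d: "d > 0" "of_nat d * x \<in> cyclo_ints n" using adjoin_Rats_denominator[OF x(1)] by auto
  let ?z = "of_nat d * x"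
  have zA: "algebraic_int ?z" using cyclo_ints_algebraic_int[OF n d(2)] .
  have z0: "?z \<noteq> 0" using d x by simp
  obtain w c and q :: "int poly" where w: "c \<noteq> 0" "?z * w = of_int c" "w = poly (map_poly of_int q) ?z"
    using algebraic_int_divides_int[OF zA z0] by metis
  have "map_poly of_int q \<in> polys_over \<rat>" by (auto simp: polys_over_def coeff_map_poly)
  then have "w \<in> cyclo n"
    unfolding w(3) using x by (intro cyclo.poly_mem polys_over_cyclo cyclo.mult_mem cyclo.of_nat_mem)
  moreover have "inverse x = of_nat d / of_int c * w"
    using w(1,2) d x by (simp add: field_simps)
  moreover have "of_nat d / of_int c \<in> cyclo n" by (intro Rats.adjoin_base) auto
  ultimately show ?thesis by (metis cyclo.mult_mem)
qed

lemma cyclotomic_field_eq: 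
  assumes "n > 0" shows "cyclotomic_field n = cyclo n"
proof
  interpret field complex_field by (rule field_from_type_algebra)
  have sub: "subfield (cyclo n) complex_field"
    by (intro subfield_complex_fieldI cyclo.num_ring_axioms cyclo_inverse_mem assms)
  show "cyclotomic_field n \<subseteq> cyclo n"
    unfolding cyclotomic_field_def
    by (rule generate_field_min_subfield1[OF _ sub]) (use Rats.adjoin_gen[of "zeta n"] in \<open>auto simp: zeta_def\<close>)
  have "subfield (cyclotomic_field n) complex_field"
    unfolding cyclotomic_field_def by (rule generate_field_is_subfield) simp
  note s = subfield_num_ring[OF this] subfield_Rats_subset[OF this]
  show "cyclo n \<subseteq> cyclotomic_field n"
  proof (rule Rats.adjoin_mono[OF s(2,1)])
    show "zeta n \<in> cyclotomic_field n"
      unfolding cyclotomic_field_def zeta_def by (rule generate_field.incl) simp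
  qed
qed

lemma embeddings_iff:
  "\<sigma> \<in> embeddings K \<longleftrightarrow> \<sigma> \<in> extensional K \<and> \<sigma> 1 = 1 \<and>
     (\<forall>x\<in>K. \<forall>y\<in>K. \<sigma> (x + y) = \<sigma> x + \<sigma> y \<and> \<sigma> (x * y) = \<sigma> x * \<sigma> y)"
  by (auto simp: embeddings_def Ring.ring_hom_def)

lemma eval_complex_field: "ring.eval complex_field xs x = poly (Poly (rev xs)) x"
proof -
  interpret field complex_field by (rule field_from_type_algebra)
  show ?thesis by (induction xs) (auto simp: Poly_snoc poly_monom)
qed

text \<open>Degrees in the tower \<open>\<rat> \<subseteq> \<rat>(t) \<subseteq> K\<close> multiply,
  so \<open>\<rat>(t)\<close> has degree 1 or \<open>l\<close>, and \<open>t \<notin> \<rat>\<close>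
  leaves \<open>l\<close>. The last two claims describe the degree of the minimal polynomial without
  naming it.\<close>

lemma prime_degree_generator:
  assumes K: "number_field K" and l: "field_degree K = l" "Factorial_Ring.prime l"
    and t: "t \<in> K" "t \<notin> \<rat>"
  shows "K = adjoin \<rat> t"
    and "\<exists>h\<in>polys_over \<rat>. h \<noteq> 0 \<and> degree h = l \<and> poly h t = 0"
    and "P \<in> polys_over \<rat> \<Longrightarrow> P \<noteq> 0 \<Longrightarrow> poly P t = 0 \<Longrightarrow> l \<le> degree P"
proof -
  interpret field complex_field by (rule field_from_type_algebra)
  have subK: "subfield K complex_field" and fin: "finite_dimension \<rat> K"
    using K by (auto simp: number_field_def)
  have subQ: "subfield \<rat> complex_field"
    by (intro subfield_complex_fieldI Rats.num_ring_axioms) auto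
  note K_ring = subfield_num_ring[OF subK] and K_Rats = subfield_Rats_subset[OF subK]
  interpret KR: num_ring K by (rule K_ring)
  have alg: "(algebraic over \<rat>) t"
    using finite_dimension_imp_algebraic[OF subQ subfieldE(1)[OF subK] fin t(1)] .
  define E where "E = simple_extension \<rat> t"
  have E_eq: "E = adjoin \<rat> t"
  proof
    interpret A: num_ring "adjoin \<rat> t" by (rule Rats.adjoin_num_ring)
    show "E \<subseteq> adjoin \<rat> t"
    proof
      fix x assume "x \<in> E"
      then show "x \<in> adjoin \<rat> t" unfolding E_def
        by (induction rule: simple_extension.induct)
          (auto intro: A.zero_mem A.add_mem[OF A.mult_mem[OF _ Rats.adjoin_gen] Rats.adjoin_base])
    qed
    have "poly P t \<in> E" if "P \<in> polys_over \<rat>" for P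
      using that
    proof (induction P)
      case 0
      then show ?case using simple_extension.zero[of \<rat> t] by (simp add: E_def)
    next
      case (pCons a P)
      then show ?case using simple_extension.lin[of "poly P t" \<rat> t a]
        by (auto simp: E_def Rats.polys_over_pCons_iff mult.commute add.commute)
    qed
    then show "adjoin \<rat> t \<subseteq> E" by (auto simp: adjoin_def)
  qed
  have subE: "subfield E complex_field"
    unfolding E_def using simple_extension_is_subfield[OF subQ, of t] alg by simp
  have EK: "E \<subseteq> K" unfolding E_eq by (rule Rats.adjoin_mono[OF K_Rats K_ring t(1)])
  have tE: "t \<in> E" unfolding E_eq by (rule Rats.adjoin_gen)
  define H where "H = Irr \<rat> t"
  define n where "n = length H - 1"
  note H = IrrE[OF subQ _ alg, folded H_def, simplified]
  have dimE: "dimension n \<rat> E"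
    using dimension_simple_extension[OF subQ _ alg] by (simp add: E_def n_def H_def)
  obtain k where k: "dimension k \<rat> K" using fin by (auto simp: finite_dimension_def)
  then obtain Us where Us: "Span \<rat> Us = K" using exists_base[OF subQ] by blast
  have "set Us \<subseteq> K" using Span_base_incl[OF subQ, of Us] Us by auto
  have "subgroup K (add_monoid complex_field)"
    using subring.axioms(1)[OF subfieldE(1)[OF subK]] .
  then have "Span E Us \<subseteq> K"
    using EK \<open>set Us \<subseteq> K\<close> KR.mult_mem
    by (intro Span_min[OF subE]) (auto simp: set_mult_def)
  \<comment> \<open>Vectors that generate \<open>K\<close> over \<open>\<rat>\<close> also generate
    it over \<open>E\<close>, which makes the upper step of the tower finite.\<close>
  moreover have "K \<subseteq> Span E Us"
  proof -
    have "\<rat> <#>\<^bsub>complex_field\<^esub> set Us \<subseteq> Span E Us"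
    proof -
      have "\<rat> <#>\<^bsub>complex_field\<^esub> set Us \<subseteq> E <#>\<^bsub>complex_field\<^esub> set Us"
        using subfield_Rats_subset[OF subE] by (auto simp: set_mult_def)
      also have "\<dots> \<subseteq> Span E Us" by (rule Span_incl[OF subE]) simp
      finally show ?thesis .
    qed
    then have "Span \<rat> Us \<subseteq> Span E Us"
      by (intro Span_min[OF subQ] Span_is_add_subgroup[OF subE]) auto
    then show ?thesis by (simp only: Us)
  qed
  ultimately have "Span E Us = K" by auto
  then have "finite_dimension E K" using Span_finite_dimension[OF subE, of Us] by simp
  then obtain m where m: "dimension m E K" by (auto simp: finite_dimension_def)
  have "dimension (n * m) \<rat> K" using telescopic_base[OF subQ subE dimE m] .
  then have "l = n * m" using dimI[OF subQ] l(1) by (simp add: field_degree_def over_def)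
  moreover have "n \<noteq> 1"
  proof
    assume "n = 1"
    have "dimension 1 \<rat> \<rat>" by (rule dimension_one[OF subQ])
    then have dQ: "dimension n \<rat> \<rat>" by (simp add: \<open>n = 1\<close>)
    obtain Vs where Vs: "independent \<rat> Vs" "length Vs = n" "Span \<rat> Vs = \<rat>"
      using exists_base[OF subQ dQ] by auto
    have "set Vs \<subseteq> E" using Span_base_incl[OF subQ, of Vs] Vs subfield_Rats_subset[OF subE] by auto
    then have "Span \<rat> Vs = E" using independent_length_eq_dimension[OF subQ dimE Vs(1)] Vs(2) by simp
    then show False using Vs(3) tE t(2) by simp
  qed
  moreover have "n = 1 \<or> n = l"
    using l(2) \<open>l = n * m\<close> unfolding prime_nat_iff by (metis dvd_triv_left)
  ultimately have nm: "n = l" "m = 1" using prime_gt_0_nat[OF l(2)] by auto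
  obtain Vs where Vs: "independent E Vs" "length Vs = 1" "Span E Vs = E"
    using exists_base[OF subE dimension_one[OF subE]] by auto
  have "set Vs \<subseteq> K" using Span_base_incl[OF subE, of Vs] Vs EK by auto
  then have "Span E Vs = K" using independent_length_eq_dimension[OF subE m Vs(1)] Vs(2) nm by simp
  then show "K = adjoin \<rat> t" using Vs E_eq by simp
  have "H \<noteq> []" using nm(1) prime_gt_0_nat[OF l(2)] by (auto simp: n_def)
  then have Hset: "set H \<subseteq> \<rat>" "H \<noteq> []" using H(1) by (auto simp: univ_poly_def polynomial_def)
  \<comment> \<open>Coefficient lists of \<open>univ_poly\<close> start with the leading
    coefficient, those of \<open>Poly\<close> with the constant one.\<close>
  define h where "h = Poly (rev H)"
  have "coeffs h = rev H" using Hset H(3) unfolding h_def by (cases H) auto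
  then have "degree h = n" "h \<noteq> 0" using Hset by (auto simp: degree_eq_length_coeffs n_def simp flip: coeffs_eq_Nil)
  moreover have "h \<in> polys_over \<rat>"
    unfolding polys_over_def h_def using Hset(1)
    by (auto simp: coeff_Poly_eq nth_default_def rev_nth subset_iff)
  moreover have "poly h t = 0" using H(4) by (simp add: eval_complex_field h_def)
  ultimately show "\<exists>h\<in>polys_over \<rat>. h \<noteq> 0 \<and> degree h = l \<and> poly h t = 0" using nm by blast
  show "l \<le> degree P" if P: "P \<in> polys_over \<rat>" "P \<noteq> 0" "poly P t = 0"
  proof -
    let ?p = "rev (coeffs P)"
    have "set ?p \<subseteq> \<rat>" using P(1) by (auto simp: polys_over_def coeffs_def)
    moreover have "hd ?p \<noteq> 0" using P(2) by (simp add: hd_rev last_coeffs_eq_coeff_degree)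
    ultimately have pc: "?p \<in> carrier (univ_poly complex_field \<rat>)" by (simp add: univ_poly_def polynomial_def)
    have "ring.eval complex_field ?p t = 0" using P(3) by (simp add: eval_complex_field)
    then have "H pdivides\<^bsub>complex_field\<^esub> ?p" using Irr_minimal[OF subQ _ alg pc] by (simp add: H_def)
    then have "length H - 1 \<le> length ?p - 1"
      using pdivides_imp_degree_le[OF subfieldE(1)[OF subQ] H(1) pc] P(2) by simp
    then show ?thesis using nm P(2) by (simp add: n_def degree_eq_length_coeffs)
  qed
qed

section \<open>Embeddings and norms\<close>

text \<open>The Galois group enters through its action on one generator \<open>t\<close>, whose
  minimal polynomial has degree \<open>l\<close> by \<open>t_root\<close> and
  \<open>t_min\<close>.\<close>

locale prime_cyclic =
  fixes K :: "complex set" and f l :: nat and t :: complex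
  assumes f_pos: "f > 0"
    and K_cyclo: "K \<subseteq> cyclo f"
    and K_subfield: "subfield K complex_field"
    and K_gen: "K = adjoin \<rat> t"
    and t_root: "\<exists>h\<in>polys_over \<rat>. h \<noteq> 0 \<and> degree h = l \<and> poly h t = 0"
    and t_min: "\<And>P. P \<in> polys_over \<rat> \<Longrightarrow> P \<noteq> 0 \<Longrightarrow> poly P t = 0 \<Longrightarrow> l \<le> degree P"
    and l_prime: "Factorial_Ring.prime l"
begin

sublocale K: num_ring K
  by (rule subfield_num_ring[OF K_subfield])

lemma K_Rats: "\<rat> \<subseteq> K"
  by (rule subfield_Rats_subset[OF K_subfield])

lemma t_K: "t \<in> K"
  unfolding K_gen by (rule Rats.adjoin_gen)

lemma t_cyclo: "t \<in> cyclo f"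
  using K_cyclo t_K by auto

lemma f_neq_1: "f \<noteq> 1"
proof
  assume "f = 1"
  have "zeta 1 = 1" by (simp add: zeta_def)
  then have "t \<in> \<rat>" using t_cyclo \<open>f = 1\<close> Rats.adjoin_mono[of \<rat> 1] Rats.num_ring_axioms by auto
  then have "l \<le> degree [:- t, 1:]" by (intro t_min) (auto simp: Rats.polys_over_pCons_iff Rats.polys_over_0)
  then show False using prime_gt_1_nat[OF l_prime] by simp
qed

abbreviation unit_exp :: "nat \<Rightarrow> bool" where
  "unit_exp a \<equiv> Rings.coprime a f"

lemma cyclo_aut: "unit_exp a \<Longrightarrow> cyclo_aut f a"
  by unfold_locales (use f_pos in auto)

definition conjs :: "complex set" where
  "conjs = {sig f a t | a. unit_exp a}"

lemma sig_conjs: "unit_exp b \<Longrightarrow> c \<in> conjs \<Longrightarrow> sig f b c \<in> conjs"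
  unfolding conjs_def using sig_sig[OF f_pos _ _ t_cyclo] by auto

lemma conjs_cyclo: "conjs \<subseteq> cyclo f"
  unfolding conjs_def using cyclo_aut.sig_mem[OF cyclo_aut] t_cyclo by auto

lemma t_conjs: "t \<in> conjs"
proof -
  have "t = sig f (Suc 0) t" using sig_1[OF f_pos t_cyclo] by simp
  then show ?thesis unfolding conjs_def by auto
qed

lemma conjs_roots:
  assumes "P \<in> polys_over \<rat>" "poly P t = 0" "c \<in> conjs"
  shows "poly P c = 0"
proof -
  obtain a where a: "unit_exp a" "c = sig f a t" using assms by (auto simp: conjs_def)
  interpret cyclo_aut f a by (rule cyclo_aut[OF a(1)])
  show ?thesis using sig_poly_apply[OF assms(1) t_cyclo] assms(2) a(2) sig_Rats[OF Rats_0] by simp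
qed

lemma finite_conjs: "finite conjs" and card_conjs_le: "card conjs \<le> l"
proof -
  obtain h where h: "h \<in> polys_over \<rat>" "h \<noteq> 0" "degree h = l" "poly h t = 0" using t_root by auto
  have sub: "conjs \<subseteq> {c. poly h c = 0}" using conjs_roots h by auto
  then show "finite conjs" using poly_roots_finite[OF h(2)] finite_subset by blast
  show "card conjs \<le> l"
    using card_mono[OF poly_roots_finite[OF h(2)] sub] card_poly_roots_bound[OF h(2)] h(3) by simp
qed

definition conj_poly :: "complex poly" where
  "conj_poly = (\<Prod>c\<in>conjs. [:- c, 1:])"

lemma sig_coeff_prod:
  assumes "unit_exp b" "finite D" "D \<subseteq> cyclo f"
  shows "coeff (\<Prod>c\<in>D. [:- c, 1:]) i \<in> cyclo f"
    and "sig f b (coeff (\<Prod>c\<in>D. [:- c, 1:]) i) = coeff (\<Prod>c\<in>D. [:- sig f b c, 1:]) i"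
proof -
  interpret cyclo_aut f b by (rule cyclo_aut[OF assms(1)])
  have "coeff (\<Prod>c\<in>D. [:- c, 1:]) i \<in> cyclo f \<and>
    sig f b (coeff (\<Prod>c\<in>D. [:- c, 1:]) i) = coeff (\<Prod>c\<in>D. [:- sig f b c, 1:]) i"
    using assms(2,3)
  proof (induction arbitrary: i rule: finite_induct)
    case empty
    then show ?case by (auto simp: sig_Rats cyclo.one_mem cyclo.zero_mem)
  next
    case (insert c D)
    let ?Q = "\<Prod>c\<in>D. [:- c, 1:]" and ?R = "\<Prod>c\<in>D. [:- sig f b c, 1:]"
    have c: "c \<in> cyclo f" using insert by auto
    have IH: "coeff ?Q j \<in> cyclo f" "sig f b (coeff ?Q j) = coeff ?R j" for j using insert by auto
    have coeff_lin: "coeff ([:- x, 1:] * Q) i = (if i = 0 then 0 else coeff Q (i - 1)) - x * coeff Q i"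
      for x :: complex and Q
      by (cases i) (auto simp: mult_pCons_left)
    have *: "(if i = 0 then 0 else coeff ?Q (i - 1)) \<in> cyclo f" using IH by (simp add: cyclo.zero_mem)
    have s: "sig f b (if i = 0 then 0 else coeff ?Q (i - 1)) = (if i = 0 then 0 else coeff ?R (i - 1))"
      using IH by (simp add: sig_Rats)
    note cQ = cyclo.mult_mem[OF c IH(1)]
    show ?case
      unfolding prod.insert[OF insert(1,2)] coeff_lin sig_diff[OF * cQ] s sig_mult[OF c IH(1)] IH(2)
      using cyclo.diff_mem[OF * cQ] by simp
  qed
  then show "coeff (\<Prod>c\<in>D. [:- c, 1:]) i \<in> cyclo f"
    and "sig f b (coeff (\<Prod>c\<in>D. [:- c, 1:]) i) = coeff (\<Prod>c\<in>D. [:- sig f b c, 1:]) i" by auto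
qed

lemma sig_inj_on: "unit_exp b \<Longrightarrow> inj_on (sig f b) (cyclo f)"
  using sig_inj[OF f_pos] by (auto simp: inj_on_def)

lemma sig_conjs_image: "unit_exp b \<Longrightarrow> sig f b ` conjs = conjs"
  by (rule endo_inj_surj[OF finite_conjs])
    (auto simp: sig_conjs intro: inj_on_subset[OF sig_inj_on conjs_cyclo])

lemma conj_poly_Rats: "conj_poly \<in> polys_over \<rat>"
  unfolding polys_over_def
proof (intro CollectI allI)
  fix i
  show "coeff conj_poly i \<in> \<rat>"
  proof (rule cyclo_fixed_imp_Rats[OF f_pos])
    have "Rings.coprime (Suc 0) f" by simp
    from sig_coeff_prod(1)[OF this finite_conjs conjs_cyclo]
    show "coeff conj_poly i \<in> cyclo f" by (simp add: conj_poly_def)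
    fix b assume b: "Rings.coprime b f"
    have "sig f b (coeff conj_poly i) = coeff (\<Prod>c\<in>conjs. [:- sig f b c, 1:]) i"
      unfolding conj_poly_def by (rule sig_coeff_prod(2)[OF b finite_conjs conjs_cyclo])
    also have "(\<Prod>c\<in>conjs. [:- sig f b c, 1:]) = (\<Prod>c\<in>sig f b ` conjs. [:- c, 1:])"
      by (simp add: prod.reindex inj_on_subset[OF sig_inj_on[OF b] conjs_cyclo])
    also have "\<dots> = conj_poly" unfolding sig_conjs_image[OF b] conj_poly_def ..
    finally show "sig f b (coeff conj_poly i) = coeff conj_poly i" .
  qed
qed

lemma poly_conj_poly: "poly conj_poly x = 0 \<longleftrightarrow> x \<in> conjs"
  using finite_conjs by (auto simp: conj_poly_def poly_prod)

text \<open>The polynomial \<open>conj_poly\<close> is invariant under all automorphisms and so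
  rational. As it vanishes at \<open>t\<close>, its degree, the number of conjugates, is at least
  \<open>l\<close>.\<close>

lemma card_conjs: "card conjs = l"
proof -
  have "degree conj_poly = card conjs"
    unfolding conj_poly_def by (subst degree_prod_eq_sum_degree) auto
  moreover have "conj_poly \<noteq> 0" using finite_conjs by (simp add: conj_poly_def)
  ultimately have "l \<le> card conjs"
    using t_min[OF conj_poly_Rats] poly_conj_poly t_conjs by simp
  then show ?thesis using card_conjs_le by simp
qed

section \<open>Embeddings as restrictions of cyclotomic automorphisms\<close>

lemma K_poly: "x \<in> K \<Longrightarrow> \<exists>P\<in>polys_over \<rat>. x = poly P t"
  unfolding K_gen adjoin_def by auto

lemma embedding_poly:
  assumes s: "\<sigma> \<in> embeddings K" and P: "P \<in> polys_over \<rat>" and x: "x \<in> K"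
  shows "\<sigma> (poly P x) = poly P (\<sigma> x)"
proof -
  have add: "\<sigma> (u + v) = \<sigma> u + \<sigma> v" and mult: "\<sigma> (u * v) = \<sigma> u * \<sigma> v" if "u \<in> K" "v \<in> K" for u v
    using s that by (auto simp: embeddings_iff)
  have one: "\<sigma> 1 = 1" using s by (auto simp: embeddings_iff)
  have zero: "\<sigma> 0 = 0" using add[OF K.zero_mem K.zero_mem] by simp
  have nat: "\<sigma> (of_nat n) = of_nat n" for n
    by (induction n) (auto simp: zero one add K.one_mem K.of_nat_mem)
  have int: "\<sigma> (of_int n) = of_int n" for n
  proof (cases "n \<ge> 0")
    case True
    then show ?thesis using nat[of "nat n"] by simp
  next
    case False
    have "0 = \<sigma> (of_int n + of_nat (nat (- n)))" using False zero by simp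
    also have "\<dots> = \<sigma> (of_int n) + of_nat (nat (- n))" by (simp only: add[OF K.of_int_mem K.of_nat_mem] nat)
    finally show ?thesis using False by (simp add: eq_neg_iff_add_eq_0)
  qed
  have rat: "\<sigma> c = c" if c: "c \<in> \<rat>" for c
  proof -
    obtain m n :: int where mn: "n > 0" "c = of_int m / of_int n" using c by (auto elim: Rats_cases')
    have "\<sigma> c * \<sigma> (of_int n) = \<sigma> (c * of_int n)" using mult[of c "of_int n"] c K_Rats K.of_int_mem by auto
    also have c_eq: "c * of_int n = of_int m" using mn by simp
    finally have "\<sigma> c * of_int n = c * of_int n" by (simp only: int c_eq)
    then show ?thesis using mn(1) by simp
  qed
  show ?thesis using P
  proof (induction P)
    case (pCons a P)
    then have P: "P \<in> polys_over \<rat>" "a \<in> \<rat>" by (auto simp: Rats.polys_over_pCons_iff)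
    then have "poly P x \<in> K" using K.poly_mem[OF _ x] polys_over_mono[OF K_Rats] by auto
    moreover have "a \<in> K" using P(2) K_Rats by auto
    ultimately show ?case using pCons.IH[OF P(1)] x P(2) by (simp add: add mult rat K.mult_mem)
  qed (simp add: zero)
qed

text \<open>An embedding maps \<open>t\<close> to a root of \<open>conj_poly\<close>, that is, to
  some \<open>sig f a t\<close>, and is determined by this value.\<close>

lemma embeddings_eq: "embeddings K = {restrict (sig f a) K | a. unit_exp a}"
proof (intro equalityI subsetI)
  fix \<sigma> assume "\<sigma> \<in> {restrict (sig f a) K | a. unit_exp a}"
  then obtain a where a: "unit_exp a" "\<sigma> = restrict (sig f a) K" by auto
  interpret cyclo_aut f a by (rule cyclo_aut[OF a(1)])
  show "\<sigma> \<in> embeddings K"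
    unfolding embeddings_iff a(2) using K_cyclo
    by (auto simp: K.one_mem K.add_mem K.mult_mem sig_Rats subset_iff sig_add sig_mult)
next
  fix \<sigma> assume s: "\<sigma> \<in> embeddings K"
  have "poly conj_poly (\<sigma> t) = \<sigma> (poly conj_poly t)" using embedding_poly[OF s conj_poly_Rats t_K] by simp
  also have "poly conj_poly t = 0" using poly_conj_poly t_conjs by simp
  also have "\<sigma> 0 = 0" using embedding_poly[OF s Rats.polys_over_0 t_K] by simp
  finally obtain a where a: "unit_exp a" "\<sigma> t = sig f a t" using poly_conj_poly by (auto simp: conjs_def)
  interpret cyclo_aut f a by (rule cyclo_aut[OF a(1)])
  have "\<sigma> = restrict (sig f a) K"
  proof (rule extensionalityI[of _ K])
    show "\<sigma> \<in> extensional K" using s by (auto simp: embeddings_iff)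
    fix x assume x: "x \<in> K"
    then obtain P where P: "P \<in> polys_over \<rat>" "x = poly P t" using K_poly by auto
    show "\<sigma> x = restrict (sig f a) K x"
      using x by (simp add: P embedding_poly[OF s P(1) t_K] sig_poly_apply[OF P(1) t_cyclo] a(2))
  qed simp
  then show "\<sigma> \<in> {restrict (sig f a) K | a. unit_exp a}" using a by auto
qed

lemma embedding_cases:
  assumes "\<sigma> \<in> embeddings K"
  obtains a where "unit_exp a" "\<And>x. x \<in> K \<Longrightarrow> \<sigma> x = sig f a x"
  using assms unfolding embeddings_eq by auto

lemma sig_eq_on_K:
  assumes "unit_exp a" "unit_exp b" "sig f a t = sig f b t" "x \<in> K"
  shows "sig f a x = sig f b x"
proof -
  obtain P where "P \<in> polys_over \<rat>" "x = poly P t" using K_poly[OF assms(4)] by auto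
  then show ?thesis
    using cyclo_aut.sig_poly_apply[OF cyclo_aut] assms t_cyclo by metis
qed

lemma bij_embeddings_conjs: "bij_betw (\<lambda>\<sigma>. \<sigma> t) (embeddings K) conjs"
  unfolding bij_betw_def
proof
  show "inj_on (\<lambda>\<sigma>. \<sigma> t) (embeddings K)"
  proof (rule inj_onI)
    fix \<sigma> \<tau> assume s: "\<sigma> \<in> embeddings K" "\<tau> \<in> embeddings K" "\<sigma> t = \<tau> t"
    show "\<sigma> = \<tau>"
    proof (rule extensionalityI[of _ K])
      fix x assume "x \<in> K"
      then obtain P where "P \<in> polys_over \<rat>" "x = poly P t" using K_poly by auto
      then show "\<sigma> x = \<tau> x" using embedding_poly[OF _ _ t_K] s by metis
    qed (use s in \<open>auto simp: embeddings_iff\<close>)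
  qed
  show "(\<lambda>\<sigma>. \<sigma> t) ` embeddings K = conjs"
    unfolding embeddings_eq conjs_def using t_K by (auto simp: image_iff) (metis restrict_apply')
qed

lemma finite_embeddings: "finite (embeddings K)" and card_embeddings: "card (embeddings K) = l"
  using bij_betw_finite[OF bij_embeddings_conjs] bij_betw_same_card[OF bij_embeddings_conjs]
    finite_conjs card_conjs by auto

text \<open>For the rationality of norms and traces: an automorphism only permutes their factors or
  summands.\<close>

lemma embeddings_compose:
  assumes b: "unit_exp b"
  shows "bij_betw (\<lambda>\<sigma>. restrict (\<lambda>x. sig f b (\<sigma> x)) K) (embeddings K) (embeddings K)"
proof -
  let ?F = "\<lambda>\<sigma>. restrict (\<lambda>x. sig f b (\<sigma> x)) K"
  have into: "?F \<sigma> \<in> embeddings K" if s: "\<sigma> \<in> embeddings K" for \<sigma>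
  proof -
    obtain a where a: "unit_exp a" "\<And>x. x \<in> K \<Longrightarrow> \<sigma> x = sig f a x" using embedding_cases[OF s] by blast
    have "?F \<sigma> = restrict (sig f (a * b)) K"
      using a K_cyclo sig_sig[OF f_pos a(1) b] by (auto simp: restrict_def fun_eq_iff)
    then show ?thesis unfolding embeddings_eq using a(1) b by auto
  qed
  have inj: "inj_on ?F (embeddings K)"
  proof (rule inj_onI)
    fix \<sigma> \<tau> assume s: "\<sigma> \<in> embeddings K" "\<tau> \<in> embeddings K" "?F \<sigma> = ?F \<tau>"
    show "\<sigma> = \<tau>"
    proof (rule extensionalityI[of _ K])
      fix x assume x: "x \<in> K"
      then have "sig f b (\<sigma> x) = sig f b (\<tau> x)" using fun_cong[OF s(3), of x] by simp
      moreover have "\<rho> x \<in> cyclo f" if "\<rho> \<in> embeddings K" for \<rho>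
        using that x K_cyclo cyclo_aut.sig_mem[OF cyclo_aut] by (elim embedding_cases) auto
      ultimately show "\<sigma> x = \<tau> x" using sig_inj[OF f_pos b] s by blast
    qed (use s in \<open>auto simp: embeddings_iff\<close>)
  qed
  have "?F ` embeddings K = embeddings K"
    by (rule endo_inj_surj[OF finite_embeddings _ inj]) (intro image_subsetI into)
  with inj show ?thesis by (simp only: bij_betw_def)
qed

lemma embedding_algebraic_int: "\<sigma> \<in> embeddings K \<Longrightarrow> x \<in> K \<Longrightarrow> algebraic_int x \<Longrightarrow> algebraic_int (\<sigma> x)"
  using K_cyclo cyclo_aut.sig_algebraic_int[OF cyclo_aut] by (elim embedding_cases) auto

lemma embedding_mem_cyclo: "\<sigma> \<in> embeddings K \<Longrightarrow> x \<in> K \<Longrightarrow> \<sigma> x \<in> cyclo f"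
  using K_cyclo cyclo_aut.sig_mem[OF cyclo_aut] by (elim embedding_cases) auto

lemma norm_trace_Rats:
  assumes x: "x \<in> K"
  shows "absolute_norm K x \<in> \<rat>" "(\<Sum>\<sigma>\<in>embeddings K. \<sigma> x) \<in> \<rat>"
proof -
  have m: "\<sigma> x \<in> cyclo f" if "\<sigma> \<in> embeddings K" for \<sigma> by (rule embedding_mem_cyclo[OF that x])
  show "absolute_norm K x \<in> \<rat>"
  proof (rule cyclo_fixed_imp_Rats[OF f_pos])
    show "absolute_norm K x \<in> cyclo f" unfolding absolute_norm_def by (intro cyclo.prod_mem m)
    fix b assume b: "Rings.coprime b f"
    interpret cyclo_aut f b by (rule cyclo_aut[OF b])
    have "sig f b (absolute_norm K x) = (\<Prod>\<sigma>\<in>embeddings K. sig f b (\<sigma> x))"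
      unfolding absolute_norm_def by (rule sig_prod[OF m])
    also have "\<dots> = (\<Prod>\<sigma>\<in>embeddings K. restrict (\<lambda>x. sig f b (\<sigma> x)) K x)" using x by simp
    also have "\<dots> = absolute_norm K x"
      unfolding absolute_norm_def by (rule prod.reindex_bij_betw[OF embeddings_compose[OF b], of "\<lambda>\<sigma>. \<sigma> x"])
    finally show "sig f b (absolute_norm K x) = absolute_norm K x" .
  qed
  show "(\<Sum>\<sigma>\<in>embeddings K. \<sigma> x) \<in> \<rat>"
  proof (rule cyclo_fixed_imp_Rats[OF f_pos])
    show "(\<Sum>\<sigma>\<in>embeddings K. \<sigma> x) \<in> cyclo f" by (intro cyclo.sum_mem m)
    fix b assume b: "Rings.coprime b f"
    interpret cyclo_aut f b by (rule cyclo_aut[OF b])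
    have "sig f b (\<Sum>\<sigma>\<in>embeddings K. \<sigma> x) = (\<Sum>\<sigma>\<in>embeddings K. sig f b (\<sigma> x))" by (rule sig_sum[OF m])
    also have "\<dots> = (\<Sum>\<sigma>\<in>embeddings K. restrict (\<lambda>x. sig f b (\<sigma> x)) K x)" using x by simp
    also have "\<dots> = (\<Sum>\<sigma>\<in>embeddings K. \<sigma> x)"
      by (rule sum.reindex_bij_betw[OF embeddings_compose[OF b], of "\<lambda>\<sigma>. \<sigma> x"])
    finally show "sig f b (\<Sum>\<sigma>\<in>embeddings K. \<sigma> x) = (\<Sum>\<sigma>\<in>embeddings K. \<sigma> x)" .
  qed
qed

end

section \<open>Ramification and the conductor\<close>

lemma one_plus_power_expansion:
  fixes y :: nat
  shows "\<exists>r. (1 + y) ^ n = 1 + n * y + (n choose 2) * y ^ 2 + y ^ 3 * r"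
proof (induction n)
  case 0
  show ?case by (simp add: numeral_2_eq_2)
next
  case (Suc n)
  then obtain r where r: "(1 + y) ^ n = 1 + n * y + (n choose 2) * y ^ 2 + y ^ 3 * r" by auto
  have "Suc n choose 2 = n + (n choose 2)" by (simp add: numeral_2_eq_2)
  moreover have "(1 + y) ^ Suc n = (1 + y) * (1 + n * y + (n choose 2) * y ^ 2 + y ^ 3 * r)"
    by (simp only: power_Suc r)
  ultimately have "(1 + y) ^ Suc n = 1 + Suc n * y + (Suc n choose 2) * y ^ 2 + y ^ 3 * ((n choose 2) + r + y * r)"
    by (simp add: algebra_simps power2_eq_square power3_eq_cube)
  then show ?case by blast
qed

text \<open>The quadratic term gains one factor \<open>p\<close> from the binomial coefficient, as
  \<open>p\<close> is odd, and another one from \<open>g\<close>; the cubic term contains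
  \<open>g ^ 3\<close>. This serves to write an inertia exponent as a \<open>p\<close>-th power
  modulo the conductor.\<close>

lemma prime_power_cong_lift:
  assumes p: "Factorial_Ring.prime p" and odd: "p > 2" and g: "p dvd g"
  shows "[(1 + g * s) ^ p = 1 + p * g * s] (mod (p * p * g))"
proof -
  obtain r where r: "(1 + g * s) ^ p = 1 + p * (g * s) + (p choose 2) * (g * s) ^ 2 + (g * s) ^ 3 * r"
    using one_plus_power_expansion by blast
  obtain h where h: "g = p * h" using g by (elim dvdE)
  have "p dvd p choose 2" using p odd by (intro dvd_choose_prime) auto
  then obtain c where c: "p choose 2 = p * c" by (elim dvdE)
  have "(p choose 2) * (g * s) ^ 2 + (g * s) ^ 3 * r = p * p * g * (c * h * s ^ 2 + h * h * s ^ 3 * r)"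
    unfolding c h by (simp add: algebra_simps power2_eq_square power3_eq_cube)
  then have "(1 + g * s) ^ p = (1 + p * g * s) + p * p * g * (c * h * s ^ 2 + h * h * s ^ 3 * r)"
    using r by (simp add: mult.assoc)
  then show ?thesis by (simp add: cong_def)
qed

lemma cong_one_decomp:
  fixes a g :: nat
  assumes "[a = 1] (mod g)" "a > 0" obtains s where "a = 1 + g * s"
proof -
  have "\<exists>q. a = q * g + 1" using assms cong_le_nat[of 1 a g] by simp
  then show thesis using that by (metis add.commute mult.commute)
qed

context prime_cyclic
begin

section \<open>The order of an automorphism on a field of prime degree\<close>

lemma unit_exp_power: "unit_exp a \<Longrightarrow> unit_exp (a ^ k)"
  by simp

lemma sig_power_add:
  assumes "unit_exp a" shows "sig f (a ^ k) (sig f (a ^ j) t) = sig f (a ^ (j + k)) t"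
  using sig_sig[OF f_pos _ _ t_cyclo, of "a ^ j" "a ^ k"] assms by (simp add: power_add)

lemma sig_power_cancel:
  assumes a: "unit_exp a" and eq: "sig f (a ^ (i + k)) t = sig f (a ^ (j + k)) t"
  shows "sig f (a ^ i) t = sig f (a ^ j) t"
proof (rule sig_inj[OF f_pos unit_exp_power[OF a, of k]])
  have "unit_exp (a ^ n)" for n using a by simp
  then show "sig f (a ^ i) t \<in> cyclo f" "sig f (a ^ j) t \<in> cyclo f"
    using cyclo_aut.sig_mem[OF cyclo_aut] t_cyclo by blast+
  show "sig f (a ^ k) (sig f (a ^ i) t) = sig f (a ^ k) (sig f (a ^ j) t)"
    using eq by (simp only: sig_power_add[OF a])
qed

definition orbit :: "nat \<Rightarrow> complex \<Rightarrow> complex set" where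
  "orbit a c = range (\<lambda>k. sig f (a ^ k) c)"

lemma orbit_conjs: "unit_exp a \<Longrightarrow> c \<in> conjs \<Longrightarrow> orbit a c \<subseteq> conjs"
  unfolding orbit_def using sig_conjs by auto

lemma orbit_self: "c \<in> conjs \<Longrightarrow> c \<in> orbit a c"
proof -
  assume "c \<in> conjs"
  then have "c = sig f (a ^ 0) c" using sig_1[OF f_pos] conjs_cyclo by auto
  then show ?thesis unfolding orbit_def by blast
qed

lemma orbit_sub:
  assumes a: "unit_exp a" and c: "c \<in> conjs" and d: "d \<in> orbit a c"
  shows "orbit a d = orbit a c"
proof -
  have cc: "c \<in> cyclo f" using c conjs_cyclo by auto
  have ss: "sig f (a ^ k) (sig f (a ^ j) c) = sig f (a ^ (j + k)) c" for j k
    using sig_sig[OF f_pos _ _ cc, of "a ^ j" "a ^ k"] a by (simp add: power_add)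
  obtain k where k: "d = sig f (a ^ k) c" using d by (auto simp: orbit_def)
  have tot: "totient f > 0" using f_pos by simp
  have per: "sig f (a ^ (j + totient f * m)) c = sig f (a ^ j) c" for j m
  proof -
    have "[a ^ (j + totient f * m) = a ^ j * 1] (mod f)"
      unfolding power_add power_mult
      using cong_pow[OF euler_theorem[OF a], of m] by (intro cong_mult) auto
    then show ?thesis using cyclo_aut.sig_cong[OF cyclo_aut] a by simp
  qed
  show ?thesis
  proof
    show "orbit a d \<subseteq> orbit a c" unfolding orbit_def k ss by auto
    have "sig f (a ^ j) c \<in> orbit a d" for j
    proof -
      \<comment> \<open>Going back \<open>k\<close> steps in the orbit is replaced by going forward:
        the multiple \<open>totient f * k\<close> of a period is added before \<open>k\<close> is
        subtracted.\<close>
      have "k \<le> totient f * k" using tot by (cases "totient f") auto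
      then have "k + (j + totient f * k - k) = j + totient f * k" by linarith
      then have "sig f (a ^ j) c = sig f (a ^ (k + (j + totient f * k - k))) c"
        using per[of j k] by (simp only:)
      also have "\<dots> = sig f (a ^ (j + totient f * k - k)) d" unfolding k ss ..
      finally show ?thesis unfolding orbit_def by auto
    qed
    then show "orbit a c \<subseteq> orbit a d" unfolding orbit_def[of a c] by auto
  qed
qed

text \<open>Automorphisms commute, so one that maps \<open>t\<close> to \<open>c\<close> carries the
  orbit of \<open>t\<close> bijectively onto that of \<open>c\<close>.\<close>

lemma card_orbit:
  assumes a: "unit_exp a" and c: "c \<in> conjs"
  shows "card (orbit a c) = card (orbit a t)"
proof -
  obtain b where b: "unit_exp b" "c = sig f b t" using c by (auto simp: conjs_def)
  have "sig f (a ^ k) c = sig f b (sig f (a ^ k) t)" for k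
    using sig_sig[OF f_pos b(1) _ t_cyclo, of "a ^ k"] sig_sig[OF f_pos _ b(1) t_cyclo, of "a ^ k"] a b(2)
    by (simp add: mult.commute)
  then have "orbit a c = sig f b ` orbit a t" unfolding orbit_def by auto
  moreover have "inj_on (sig f b) (orbit a t)"
    using inj_on_subset[OF sig_inj_on[OF b(1)]] orbit_conjs[OF a t_conjs] conjs_cyclo by blast
  ultimately show ?thesis by (simp add: card_image)
qed

lemma card_orbit_dvd:
  assumes a: "unit_exp a" shows "card (orbit a t) dvd l"
proof -
  have U: "\<Union> (orbit a ` conjs) = conjs" using orbit_self orbit_conjs[OF a] by blast
  have "card (orbit a t) * card (orbit a ` conjs) = card (\<Union> (orbit a ` conjs))"
  proof (rule card_partition)
    show "finite (orbit a ` conjs)" using finite_conjs by simp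
    show "finite (\<Union> (orbit a ` conjs))" unfolding U by (rule finite_conjs)
    show "card c = card (orbit a t)" if "c \<in> orbit a ` conjs" for c using that card_orbit[OF a] by auto
    show "c \<inter> d = {}" if "c \<in> orbit a ` conjs" "d \<in> orbit a ` conjs" "c \<noteq> d" for c d
      using that orbit_sub[OF a] by blast
  qed
  then show ?thesis unfolding U card_conjs by (metis dvd_triv_left)
qed

text \<open>The Galois group permutes the \<open>l\<close> conjugates of \<open>t\<close> transitively and is abelian, so all
  orbits of one of its elements have the same length, which is \<open>1\<close> or \<open>l\<close>.\<close>

lemma orbit_eq_conjs:
  assumes a: "unit_exp a" and moved: "sig f a t \<noteq> t"
  shows "orbit a t = conjs"
proof -
  have fin: "finite (orbit a t)" using orbit_conjs[OF a t_conjs] finite_conjs finite_subset by blast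
  have "t \<in> orbit a t" by (rule orbit_self[OF t_conjs])
  moreover have "sig f (a ^ 1) t \<in> orbit a t" unfolding orbit_def by blast
  ultimately have sub: "{t, sig f a t} \<subseteq> orbit a t" by simp
  have "card (orbit a t) \<noteq> 1" using card_mono[OF fin sub] moved by simp
  then have "card (orbit a t) = l" using card_orbit_dvd[OF a] l_prime by (auto simp: prime_nat_iff)
  then show ?thesis using card_subset_eq[OF finite_conjs orbit_conjs[OF a t_conjs]] card_conjs by simp
qed

text \<open>The least period \<open>e\<close> of \<open>t\<close> under \<open>sig f a\<close> is
  the size of its orbit, which consists of all \<open>l\<close> conjugates.\<close>

lemma sig_power_fixed_iff:
  assumes a: "unit_exp a" and moved: "sig f a t \<noteq> t"
  shows "sig f (a ^ m) t = t \<longleftrightarrow> l dvd m"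
proof -
  define fixing where "fixing k \<longleftrightarrow> k > 0 \<and> sig f (a ^ k) t = t" for k
  define e where "e = (LEAST k. fixing k)"
  have t0: "sig f (a ^ 0) t = t" using sig_1[OF f_pos t_cyclo] by simp
  have "sig f (a ^ totient f) t = sig f 1 t"
    using cyclo_aut.sig_cong[OF cyclo_aut euler_theorem[OF a]] a by simp
  then have "fixing (totient f)" using f_pos t0 by (simp add: fixing_def)
  then have e: "fixing e" unfolding e_def by (rule LeastI)
  have e_min: "\<And>k. k < e \<Longrightarrow> \<not> fixing k" unfolding e_def by (rule not_less_Least)
  have shift: "sig f (a ^ (j + e * q)) t = sig f (a ^ j) t" for j q
  proof (induction q)
    case (Suc q)
    have "sig f (a ^ (j + e * Suc q)) t = sig f (a ^ (j + e * q)) (sig f (a ^ e) t)"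
      unfolding sig_power_add[OF a] by (simp add: algebra_simps)
    then show ?case using e Suc by (simp add: fixing_def)
  qed simp
  have red: "sig f (a ^ m) t = sig f (a ^ (m mod e)) t" for m
    using shift[of "m mod e" "m div e"] by simp
  have inj: "inj_on (\<lambda>k. sig f (a ^ k) t) {..<e}"
  proof (rule inj_onI)
    have *: "i = j" if "i \<le> j" "j < e" "sig f (a ^ i) t = sig f (a ^ j) t" for i j
    proof (rule ccontr)
      assume "i \<noteq> j"
      have "sig f (a ^ (0 + i)) t = sig f (a ^ ((j - i) + i)) t" using that by simp
      then have "sig f (a ^ 0) t = sig f (a ^ (j - i)) t" by (rule sig_power_cancel[OF a])
      then have "fixing (j - i)" using \<open>i \<noteq> j\<close> that t0 by (simp add: fixing_def)
      then show False using e_min[of "j - i"] that by simp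
    qed
    show "i = j" if "i \<in> {..<e}" "j \<in> {..<e}" "sig f (a ^ i) t = sig f (a ^ j) t" for i j
      using *[of i j] *[of j i] that by (cases i j rule: linorder_cases) auto
  qed
  have "orbit a t = (\<lambda>k. sig f (a ^ k) t) ` {..<e}"
    unfolding orbit_def using red e by (auto simp: fixing_def) (metis imageI lessThan_iff mod_less_divisor)
  then have "e = l" using orbit_eq_conjs[OF a moved] card_conjs inj by (simp add: card_image)
  show ?thesis
  proof
    assume "l dvd m"
    then show "sig f (a ^ m) t = t" using red[of m] \<open>e = l\<close> t0 by simp
  next
    assume "sig f (a ^ m) t = t"
    then have "\<not> m mod e > 0" using red[of m] e_min[of "m mod e"] e by (auto simp: fixing_def)
    then show "l dvd m" using \<open>e = l\<close> by (simp add: mod_greater_zero_iff_not_dvd)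
  qed
qed

end

section \<open>Consequences of the minimality of the conductor\<close>

locale conductor_field = prime_cyclic +
  assumes f_min: "\<And>g. g > 0 \<Longrightarrow> K \<subseteq> cyclo g \<Longrightarrow> f \<le> g"
begin

text \<open>If all these exponents fixed \<open>t\<close>, then \<open>cyclo_descent\<close> would
  put \<open>t\<close>, and with it \<open>K\<close>, into the cyclotomic field of level
  \<open>f div p\<close>.\<close>

lemma moving_inertia_element:
  assumes p: "Factorial_Ring.prime p" "p dvd f"
  obtains a where "unit_exp a" "[a = 1] (mod f div p)" "a > 0" "sig f a t \<noteq> t"
proof -
  obtain g where g: "f = p * g" using p by (elim dvdE)
  have g0: "g > 0" "g < f" "f div p = g" using f_pos g prime_gt_1_nat[OF p(1)] by (auto intro: Nat.gr0I)
  have "\<not> K \<subseteq> cyclo g" using f_min[OF g0(1)] g0(2) by auto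
  then have "t \<notin> cyclo g"
    using Rats.adjoin_mono[OF _ cyclo.num_ring_axioms, of g t] Rats.adjoin_base K_gen by blast
  then obtain a where a: "unit_exp a" "[a = 1] (mod g)" "sig f a t \<noteq> t"
    using cyclo_descent[OF p(1) g0(1), of t] t_cyclo g by auto
  have "a \<noteq> 0"
  proof
    assume "a = 0"
    then have "f = 1" using a(1) by simp
    then show False using p by (metis nat_dvd_1_iff_1 not_prime_1)
  qed
  then show thesis using that a g0 by auto
qed

text \<open>On \<open>K\<close> every automorphism is a power of the moving one, and powers of an
  exponent \<open>\<equiv> 1 (mod f div p)\<close> satisfy the same congruence: inertia at
  \<open>p\<close> is the whole group.\<close>

lemma inertia_all:
  assumes p: "Factorial_Ring.prime p" "p dvd f" and b: "unit_exp b" and x: "x \<in> K" "algebraic_int x"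
  shows "rad p (sig f b x - x)"
proof -
  obtain a where a: "unit_exp a" "[a = 1] (mod f div p)" "sig f a t \<noteq> t"
    using moving_inertia_element[OF p] by blast
  have "sig f b t \<in> conjs" using b by (auto simp: conjs_def)
  then obtain k where "sig f b t = sig f (a ^ k) t"
    using orbit_eq_conjs[OF a(1,3)] by (auto simp: orbit_def)
  then have eq: "sig f b x = sig f (a ^ k) x" using sig_eq_on_K[OF b _ _ x(1), of "a ^ k"] a(1) by simp
  have "[a ^ k = 1] (mod f div p)" using cong_pow[OF a(2), of k] by simp
  then show ?thesis unfolding eq
    using sig_inertia[OF p f_pos _ x(2), of "a ^ k"] a(1) x(1) K_cyclo by auto
qed

text \<open>Write \<open>f = p * g\<close> and let an exponent \<open>a \<equiv> 1 (mod g)\<close>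
  move \<open>t\<close>; then \<open>l\<close> divides every \<open>m\<close> with
  \<open>a ^ m \<equiv> 1 (mod f)\<close>. If \<open>p\<close> divides \<open>g\<close>, the
  binomial expansion allows \<open>m = p\<close>; otherwise Fermat's theorem allows
  \<open>m = p - 1\<close>.\<close>

lemma conductor_prime_divisor:
  assumes p: "Factorial_Ring.prime p" "p dvd f"
  shows "p = l \<and> l\<^sup>2 dvd f \<or> l dvd p - 1 \<and> \<not> p\<^sup>2 dvd f"
proof -
  obtain a where a: "unit_exp a" "[a = 1] (mod f div p)" "a > 0" "sig f a t \<noteq> t"
    using moving_inertia_element[OF p] by blast
  obtain g where g: "f = p * g" using p by (elim dvdE)
  have p0: "p > 0" using prime_gt_0_nat[OF p(1)] .
  then have a1: "[a = 1] (mod g)" using a(2) g by simp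
  have dvd: "l dvd m" if "[a ^ m = 1] (mod f)" for m
  proof -
    have "sig f (a ^ m) t = sig f 1 t" using cyclo_aut.sig_cong[OF cyclo_aut that] a(1) by simp
    then show ?thesis using sig_power_fixed_iff[OF a(1,4)] sig_1[OF f_pos t_cyclo] by simp
  qed
  show ?thesis
  proof (cases "p dvd g")
    case True
    obtain s where s: "a = 1 + g * s" using cong_one_decomp[OF a1 a(3)] .
    obtain r where r: "(1 + g * s) ^ p = 1 + p * (g * s) + (p choose 2) * (g * s) ^ 2 + (g * s) ^ 3 * r"
      using one_plus_power_expansion by blast
    obtain h where h: "g = p * h" using True by (elim dvdE)
    have "(p choose 2) * (g * s) ^ 2 + (g * s) ^ 3 * r = f * ((p choose 2) * h * s ^ 2 + g * h * s ^ 3 * r)"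
      unfolding g h by (simp add: algebra_simps power2_eq_square power3_eq_cube)
    then have "a ^ p = 1 + f * (s + (p choose 2) * h * s ^ 2 + g * h * s ^ 3 * r)"
      using r g by (simp add: s algebra_simps)
    then have "[a ^ p = 1] (mod f)" by (metis cong_add_lcancel_0_nat cong_mult_self_left)
    then have "l dvd p" by (rule dvd)
    then have "p = l" using p(1) l_prime by (metis primes_dvd_imp_eq)
    moreover have "l\<^sup>2 dvd f" using \<open>p = l\<close> g h by (simp add: power2_eq_square)
    ultimately show ?thesis by simp
  next
    case False
    have cop: "Rings.coprime p g" using p(1) False prime_imp_coprime_nat by blast
    have "\<not> p dvd a" using a(1) p by (meson coprime_common_divisor not_prime_unit)
    then have "[a ^ (p - 1) = 1] (mod p)" by (rule fermat_theorem[OF p(1)])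
    moreover have "[a ^ (p - 1) = 1] (mod g)" using cong_pow[OF a1, of "p - 1"] by simp
    ultimately have "[a ^ (p - 1) = 1] (mod f)" unfolding g using cop by (rule coprime_cong_mult_nat)
    then have "l dvd p - 1" by (rule dvd)
    moreover have "\<not> p\<^sup>2 dvd f" using False p0 unfolding g by (simp add: power2_eq_square)
    ultimately show ?thesis by simp
  qed
qed

text \<open>If \<open>l ^ 3\<close> divided \<open>f\<close>, the moving exponent would be an
  \<open>l\<close>-th power modulo \<open>f\<close>. But \<open>l\<close>-th powers act trivially on
  \<open>K\<close>, as its group has order \<open>l\<close>.\<close>

lemma not_cube_dvd_conductor:
  assumes odd: "l > 2" shows "\<not> l ^ 3 dvd f"
proof
  assume "l ^ 3 dvd f"
  then obtain h where h: "f = l ^ 3 * h" by (elim dvdE)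
  define g where "g = l * h"
  have f: "f = l * l * g" by (simp add: h g_def power3_eq_cube)
  have l0: "l > 0" using odd by simp
  obtain a where a: "unit_exp a" "[a = 1] (mod f div l)" "a > 0" "sig f a t \<noteq> t"
    using moving_inertia_element[OF l_prime] f by (metis dvd_triv_left mult.assoc)
  have "f div l = l * g" using f l0 by simp
  then obtain s where s: "a = 1 + l * g * s" using cong_one_decomp[OF a(2,3)] by auto
  define w where "w = 1 + g * s"
  have w: "[w ^ l = a] (mod f)"
    unfolding w_def s f by (rule prime_power_cong_lift[OF l_prime odd]) (simp add: g_def)
  then have "Rings.coprime (w ^ l) f" using a(1) by (metis cong_imp_coprime cong_sym)
  then have w_unit: "unit_exp w" using l0 by simp
  have wa: "sig f (w ^ l) t = sig f a t" using cyclo_aut.sig_cong[OF cyclo_aut w] w_unit by simp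
  show False
  proof (cases "sig f w t = t")
    case True
    have "sig f (w ^ k) t = t" for k
    proof (induction k)
      case 0
      show ?case using sig_1[OF f_pos t_cyclo] by simp
    next
      case (Suc k)
      then show ?case using sig_power_add[OF w_unit, of 1 k] True by (simp add: add.commute)
    qed
    then show False using wa a(4) by simp
  next
    case False
    then show False using sig_power_fixed_iff[OF w_unit False, of l] wa a(4) by simp
  qed
qed

end

section \<open>Norm-Euclidean fields\<close>

lemma prod_diff_divisible:
  fixes m :: complex
  assumes "\<And>i. i \<in> I \<Longrightarrow> \<exists>w. algebraic_int w \<and> g i - h i = m * w"
    and "\<And>i. i \<in> I \<Longrightarrow> algebraic_int (g i)" "\<And>i. i \<in> I \<Longrightarrow> algebraic_int (h i)"
  shows "\<exists>w. algebraic_int w \<and> prod g I - prod h I = m * w"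
  using assms
proof (induction I rule: infinite_finite_induct)
  case (insert i I)
  then obtain v w where v: "algebraic_int v" "g i - h i = m * v"
    and w: "algebraic_int w" "prod g I - prod h I = m * w" by (metis insert_iff)
  have "prod g (insert i I) - prod h (insert i I) = (g i - h i) * prod g I + h i * (prod g I - prod h I)"
    using insert(1,2) by (simp add: algebra_simps)
  also have "\<dots> = m * (v * prod g I + h i * w)" by (simp add: v w algebra_simps)
  finally show ?case
    using v w insert.prems by (intro exI[of _ "v * prod g I + h i * w"])
      (auto intro!: algebraic_int_plus algebraic_int_times algebraic_int_prod)
qed (auto intro!: exI[of _ 0])

lemma of_int_eq_mult_algebraic_int_imp_dvd:
  fixes w :: complex
  assumes "algebraic_int w" "of_int a = of_int m * w"
  shows "m dvd a"
proof (cases "m = 0")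
  case False
  then have "w = of_int a / of_int m" using assms(2) by (simp add: field_simps)
  then have "w \<in> \<rat>" by simp
  then have "w \<in> \<int>" using assms(1) rational_algebraic_int_is_int by blast
  then obtain c where "w = of_int c" by (auto elim: Ints_cases)
  then have "(of_int a :: complex) = of_int (m * c)" using assms(2) by simp
  then have "a = m * c" by (simp only: of_int_eq_iff)
  then show ?thesis by simp
qed (use assms in simp)

context prime_cyclic
begin

section \<open>Integral norms\<close>

abbreviation OK :: "complex set" where
  "OK \<equiv> ring_of_integers K"

lemma OK_iff: "x \<in> OK \<longleftrightarrow> x \<in> K \<and> algebraic_int x"
  by (simp add: ring_of_integers_def)

sublocale OK: num_ring OK
  by unfold_locales (auto simp: OK_iff K.one_mem K.diff_mem K.mult_mem algebraic_int_diff algebraic_int_times)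

definition inorm :: "complex \<Rightarrow> int" where
  "inorm x = (THE m. absolute_norm K x = of_int m)"

lemma inorm_eqI: "absolute_norm K x = of_int m \<Longrightarrow> inorm x = m"
  unfolding inorm_def by (rule the_equality) auto

lemma absolute_norm_eq: "x \<in> OK \<Longrightarrow> absolute_norm K x = of_int (inorm x)"
proof -
  assume x: "x \<in> OK"
  then have xA: "x \<in> K" "algebraic_int x" by (auto simp: OK_iff)
  have "algebraic_int (absolute_norm K x)"
    unfolding absolute_norm_def by (rule algebraic_int_prod) (rule embedding_algebraic_int[OF _ xA])
  then have "absolute_norm K x \<in> \<int>"
    by (rule rational_algebraic_int_is_int[OF _ norm_trace_Rats(1)[OF xA(1)]])
  then obtain m where "absolute_norm K x = of_int m" by (auto elim: Ints_cases)
  then show ?thesis using inorm_eqI by simp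
qed

lemma embedding_mult: "\<sigma> \<in> embeddings K \<Longrightarrow> x \<in> K \<Longrightarrow> y \<in> K \<Longrightarrow> \<sigma> (x * y) = \<sigma> x * \<sigma> y"
  and embedding_add: "\<sigma> \<in> embeddings K \<Longrightarrow> x \<in> K \<Longrightarrow> y \<in> K \<Longrightarrow> \<sigma> (x + y) = \<sigma> x + \<sigma> y"
  by (auto simp: embeddings_iff)

lemma embedding_of_int: "\<sigma> \<in> embeddings K \<Longrightarrow> \<sigma> (of_int n) = of_int n"
  using embedding_poly[of \<sigma> "[:of_int n:]" t] t_K by (simp add: Rats.polys_over_const)

lemma embedding_diff: "\<sigma> \<in> embeddings K \<Longrightarrow> x \<in> K \<Longrightarrow> y \<in> K \<Longrightarrow> \<sigma> (x - y) = \<sigma> x - \<sigma> y"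
  using embedding_add[of \<sigma> "x - y" y] K.diff_mem by simp

lemma inorm_mult: "x \<in> OK \<Longrightarrow> y \<in> OK \<Longrightarrow> inorm (x * y) = inorm x * inorm y"
proof -
  assume x: "x \<in> OK" and y: "y \<in> OK"
  have "absolute_norm K (x * y) = absolute_norm K x * absolute_norm K y"
    unfolding absolute_norm_def using x y by (simp add: OK_iff embedding_mult prod.distrib)
  then show ?thesis using x y by (intro inorm_eqI) (simp add: absolute_norm_eq)
qed

lemma inorm_of_int: "inorm (of_int n) = n ^ l"
  by (rule inorm_eqI) (simp add: absolute_norm_def embedding_of_int card_embeddings)

lemma inorm_eq_0_iff: "x \<in> OK \<Longrightarrow> inorm x = 0 \<longleftrightarrow> x = 0"
proof
  assume x: "x \<in> OK" and "inorm x = 0"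
  then have "(\<Prod>\<sigma>\<in>embeddings K. \<sigma> x) = 0" using absolute_norm_eq by (simp add: absolute_norm_def)
  then obtain \<sigma> where s: "\<sigma> \<in> embeddings K" "\<sigma> x = 0" using finite_embeddings by auto
  then obtain a where a: "unit_exp a" "\<sigma> x = sig f a x" using embedding_cases x by (metis OK_iff)
  have "sig f a 0 = 0" using cyclo_aut.sig_Rats[OF cyclo_aut[OF a(1)]] by simp
  then show "x = 0" using sig_inj[OF f_pos a(1), of x 0] a s x K_cyclo cyclo.zero_mem by (auto simp: OK_iff)
next
  assume "x = 0"
  then show "inorm x = 0" using inorm_of_int[of 0] prime_gt_0_nat[OF l_prime] by simp
qed

text \<open>Meant for the elements of an ideal \<open>(x, m)\<close>: if \<open>m\<close> divides
  the norm of \<open>x\<close>, it divides the norms of all of them.\<close>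

lemma inorm_cong:
  assumes "u \<in> OK" "v \<in> OK" "x \<in> OK"
  shows "[inorm (u * x + v * of_int m) = inorm u * inorm x] (mod m)"
proof -
  let ?y = "u * x + v * of_int m"
  have ux: "u * x \<in> OK" and vm: "v * of_int m \<in> OK" using assms by (auto intro: OK.mult_mem OK.of_int_mem)
  then have y: "?y \<in> OK" by (rule OK.add_mem)
  have "\<exists>w. algebraic_int w \<and> (\<Prod>\<sigma>\<in>embeddings K. \<sigma> ?y) - (\<Prod>\<sigma>\<in>embeddings K. \<sigma> (u * x)) = of_int m * w"
  proof (rule prod_diff_divisible)
    fix \<sigma> assume s: "\<sigma> \<in> embeddings K"
    show "algebraic_int (\<sigma> ?y)" "algebraic_int (\<sigma> (u * x))"
      using embedding_algebraic_int[OF s] y ux by (auto simp: OK_iff)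
    have "\<sigma> ?y - \<sigma> (u * x) = of_int m * \<sigma> v"
      using s assms ux vm by (simp add: OK_iff embedding_add embedding_mult K.of_int_mem embedding_of_int)
    then show "\<exists>w. algebraic_int w \<and> \<sigma> ?y - \<sigma> (u * x) = of_int m * w"
      using embedding_algebraic_int[OF s] assms by (auto simp: OK_iff)
  qed
  then obtain w where w: "algebraic_int w" "absolute_norm K ?y - absolute_norm K (u * x) = of_int m * w"
    by (auto simp: absolute_norm_def)
  have "of_int (inorm ?y - inorm (u * x)) = of_int m * w"
    using w(2) absolute_norm_eq[OF y] absolute_norm_eq[OF ux] by simp
  then have "m dvd inorm ?y - inorm (u * x)" by (rule of_int_eq_mult_algebraic_int_imp_dvd[OF w(1)])
  then show ?thesis using inorm_mult assms by (simp add: cong_iff_dvd_diff)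
qed

text \<open>Conjugation preserves the radical of \<open>p\<close>, so each of the \<open>l\<close>
  conjugates of \<open>x\<close> is congruent to \<open>n\<close>.\<close>

lemma inorm_rad_cong:
  assumes p: "Factorial_Ring.prime p" and x: "x \<in> OK" and r: "rad p (x - of_int n)"
  shows "[inorm x = n ^ l] (mod int p)"
proof -
  have xK: "x \<in> K" using x by (simp add: OK_iff)
  have "rad p ((\<Prod>\<sigma>\<in>embeddings K. \<sigma> x) - (\<Prod>\<sigma>\<in>embeddings K. of_int n))"
  proof (rule rad_prod_diff)
    fix \<sigma> assume s: "\<sigma> \<in> embeddings K"
    obtain a where a: "unit_exp a" "\<And>x. x \<in> K \<Longrightarrow> \<sigma> x = sig f a x" using embedding_cases[OF s] by blast
    interpret cyclo_aut f a by (rule cyclo_aut[OF a(1)])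
    have m: "x - of_int n \<in> K" using xK by (intro K.diff_mem K.of_int_mem)
    have "\<sigma> x - of_int n = \<sigma> (x - of_int n)" using s xK by (simp add: embedding_diff embedding_of_int K.of_int_mem)
    also have "\<dots> = sig f a (x - of_int n)" by (rule a(2)[OF m])
    finally show "rad p (\<sigma> x - of_int n)" using sig_rad[OF _ r] m K_cyclo by auto
    show "algebraic_int (\<sigma> x)" using embedding_algebraic_int[OF s] x by (auto simp: OK_iff)
  qed simp
  then have "rad p (of_int (inorm x - n ^ l))"
    using absolute_norm_eq[OF x] by (simp add: absolute_norm_def card_embeddings)
  then show ?thesis using rad_of_int_iff[OF p] by (simp only: cong_iff_dvd_diff)
qed

text \<open>Up to sign, \<open>inverse x\<close> is the product of the other conjugates of
  \<open>x\<close>, hence an algebraic integer.\<close>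

lemma inverse_unit_mem:
  assumes x: "x \<in> OK" and n: "\<bar>inorm x\<bar> = 1"
  shows "inverse x \<in> OK"
proof -
  have xK: "x \<in> K" "x \<in> cyclo f" using x K_cyclo by (auto simp: OK_iff)
  define i where "i = restrict (sig f (Suc 0)) K"
  have i: "i \<in> embeddings K" "i x = x"
    unfolding i_def embeddings_eq using xK sig_1[OF f_pos] by (auto intro!: exI[of _ "Suc 0"])
  define y where "y = (\<Prod>\<sigma>\<in>embeddings K - {i}. \<sigma> x)"
  have y: "algebraic_int y"
    unfolding y_def using embedding_algebraic_int[OF _ xK(1)] x
    by (intro algebraic_int_prod) (simp add: OK_iff)
  have "absolute_norm K x = x * y"
    unfolding absolute_norm_def y_def using prod.remove[OF finite_embeddings i(1), of "\<lambda>\<sigma>. \<sigma> x"] i(2) by simp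
  then have xy: "x * y = of_int (inorm x)" using absolute_norm_eq[OF x] by simp
  have "of_int (inorm x) * of_int (inorm x) = (1 :: complex)"
    using n by (metis abs_mult_self_eq mult.right_neutral of_int_1 of_int_mult)
  then have "x * (y * of_int (inorm x)) = 1" using xy by (metis mult.assoc)
  then have "inverse x = y * of_int (inorm x)" by (rule inverse_unique)
  moreover have "algebraic_int (y * of_int (inorm x))" using y by (intro algebraic_int_times) auto
  moreover have "x \<noteq> 0" using \<open>x * (y * of_int (inorm x)) = 1\<close> by auto
  then have "inverse x \<in> K" using subfield_inverse_mem[OF K_subfield xK(1)] by simp
  ultimately show ?thesis by (simp add: OK_iff)
qed

end

context conductor_field
begin

text \<open>All conjugates of \<open>x\<close> are congruent to \<open>x\<close>. For
  \<open>p \<noteq> l\<close> the trace is congruent to \<open>l * x\<close>, and \<open>l\<close>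
  is invertible modulo \<open>p\<close>. For \<open>p = l\<close> the trace carries no information;
  there the norm \<open>n\<close> is congruent to \<open>x ^ p\<close>, and
  \<open>n \<equiv> n ^ p\<close> gives \<open>(x - n) ^ p \<equiv> 0\<close>.\<close>

lemma totally_ramified:
  assumes p: "Factorial_Ring.prime p" "p dvd f" and x: "x \<in> OK"
  shows "\<exists>n. rad p (x - of_int n)"
proof -
  have xA: "x \<in> K" "algebraic_int x" using x by (auto simp: OK_iff)
  have d: "rad p (\<sigma> x - x)" if s: "\<sigma> \<in> embeddings K" for \<sigma>
    using inertia_all[OF p _ xA] s xA(1) by (elim embedding_cases) auto
  show ?thesis
  proof (cases "p = l")
    case False
    define T where "T = (\<Sum>\<sigma>\<in>embeddings K. \<sigma> x)"
    have "algebraic_int T" unfolding T_def by (rule algebraic_int_sum) (rule embedding_algebraic_int[OF _ xA])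
    then have "T \<in> \<int>" using norm_trace_Rats(2)[OF xA(1)] rational_algebraic_int_is_int by (simp add: T_def)
    then obtain m where m: "T = of_int m" by (auto elim: Ints_cases)
    have "T - of_nat l * x = (\<Sum>\<sigma>\<in>embeddings K. \<sigma> x - x)"
      by (simp add: T_def sum_subtractf card_embeddings)
    also have "rad p \<dots>" by (intro rad_sum d)
    finally have r: "rad p (of_nat l * x - T)" by (rule rad_diff_sym)
    have "Rings.coprime l p" using False l_prime p(1) by (simp add: primes_coprime)
    then obtain u v where uv: "u * int l + v * int p = 1"
      using bezout_int[of "int l" "int p"] by auto
    have "of_int (u * int l + v * int p) * x = x" by (simp add: uv)
    then have "x - of_int (u * m) = of_int u * (of_nat l * x - T) + of_nat p * (of_int v * x)"
      by (simp add: m algebra_simps)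
    moreover have "rad p \<dots>" using r xA by (intro rad_add rad_mult_left rad_of_nat_mult algebraic_int_times) auto
    ultimately show ?thesis by metis
  next
    case True
    define n where "n = inorm x"
    have "rad p ((\<Prod>\<sigma>\<in>embeddings K. \<sigma> x) - (\<Prod>\<sigma>\<in>embeddings K. x))"
      by (rule rad_prod_diff[OF d embedding_algebraic_int[OF _ xA] xA(2)])
    then have r1: "rad p (of_int n - x ^ p)"
      using absolute_norm_eq[OF x] True by (simp add: absolute_norm_def card_embeddings n_def)
    \<comment> \<open>For a constant polynomial the Frobenius congruence is Fermat's
      \<open>n ^ p \<equiv> n (mod p)\<close>.\<close>
    obtain r where r: "r \<in> adjoin \<int> 0" "(of_int n :: complex) ^ p = of_int n + of_nat p * r"
      using poly_frobenius[OF p(1), of "[:of_int n:]" 0] by (auto simp: Ints.polys_over_const)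
    have rA: "algebraic_int r"
      using r(1) Ints.adjoin_mono[OF _ alg_ints.num_ring_axioms, of 0] by (auto intro: int_imp_algebraic_int)
    obtain s where s: "algebraic_int s"
        "((x - of_int n) + of_int n) ^ p = (x - of_int n) ^ p + of_int n ^ p + of_nat p * s"
      using alg_ints.freshman_dream[OF p(1), of "x - of_int n" "of_int n"] xA
      by (auto intro: algebraic_int_diff)
    have "(x - of_int n) ^ p = - (of_int n - x ^ p) - of_nat p * (r + s)"
      using s(2) r(2) by (simp add: algebra_simps)
    also have "rad p \<dots>" by (rule rad_diff[OF rad_minus[OF r1] rad_of_nat_mult[OF algebraic_int_plus[OF rA s(1)]]])
    finally have "rad p ((x - of_int n) ^ p)" .
    then have "rad p (x - of_int n)" by (rule rad_power_iff) (simp add: algebraic_int_diff xA)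
    then show ?thesis by blast
  qed
qed

text \<open>Iterating the assumption, the image under \<open>\<sigma>\<^sub>a - 1\<close> of a non-rational integer becomes divisible by
  all powers of \<open>p\<close>.\<close>

lemma integers_not_Z_plus_p:
  assumes p: "p > 1" and all: "\<And>x. x \<in> OK \<Longrightarrow> \<exists>n. \<exists>y\<in>OK. x = of_int n + of_nat p * y"
  shows False
proof -
  have it: "\<exists>n. \<exists>y\<in>OK. x = of_int n + of_nat p ^ k * y" if "x \<in> OK" for x k
  proof (induction k)
    case 0
    then show ?case using that by (intro exI[of _ 0] bexI[of _ x]) auto
  next
    case (Suc k)
    then obtain n y where ny: "y \<in> OK" "x = of_int n + of_nat p ^ k * y" by auto
    obtain m z where mz: "z \<in> OK" "y = of_int m + of_nat p * z" using all[OF ny(1)] by auto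
    have "x = of_int (n + int p ^ k * m) + of_nat p ^ Suc k * z"
      by (simp add: ny(2) mz(2) algebra_simps)
    then show ?case using mz(1) by blast
  qed
  obtain q where q: "Factorial_Ring.prime q" "q dvd f" using f_neq_1 prime_factor_nat by blast
  obtain a where a: "unit_exp a" "sig f a t \<noteq> t" using moving_inertia_element[OF q] by blast
  interpret cyclo_aut f a by (rule cyclo_aut[OF a(1)])
  obtain d where d: "d > 0" "of_nat d * t \<in> cyclo_ints f" using adjoin_Rats_denominator[OF t_cyclo] by auto
  define x where "x = of_nat d * t"
  have x: "x \<in> OK" using d cyclo_ints_algebraic_int[OF f_pos] t_K
    by (auto simp: OK_iff x_def intro: K.mult_mem K.of_nat_mem)
  define z where "z = sig f a x - x"
  have sx: "sig f a x = of_nat d * sig f a t"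
    unfolding x_def using t_cyclo by (simp add: sig_mult sig_Rats cyclo.of_nat_mem)
  then have "z = of_nat d * (sig f a t - t)" by (simp add: z_def x_def right_diff_distrib)
  then have z0: "z \<noteq> 0" using a d by simp
  have zA: "algebraic_int z" unfolding z_def
    using x K_cyclo sig_algebraic_int by (auto simp: OK_iff intro!: algebraic_int_diff)
  obtain w c where w: "algebraic_int w" "c \<noteq> 0" "z * w = of_int c"
    using algebraic_int_divides_int[OF zA z0] by metis
  have "int p ^ k dvd c" for k
  proof -
    obtain n y where y: "y \<in> OK" "x = of_int n + of_nat p ^ k * y" using it[OF x] by blast
    have yf: "y \<in> cyclo f" using y K_cyclo by (auto simp: OK_iff)
    have "sig f a x = of_int n + of_nat p ^ k * sig f a y"
      unfolding y(2) using yf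
      by (simp add: sig_add sig_mult sig_power sig_Rats cyclo.of_int_mem cyclo.of_nat_mem cyclo.mult_mem cyclo.power_mem)
    then have "z = of_nat p ^ k * (sig f a y - y)" by (simp add: z_def y(2) algebra_simps)
    then have eq: "of_int c = of_int (int p ^ k) * ((sig f a y - y) * w)"
      using w(3) by (simp flip: mult.assoc)
    have "algebraic_int ((sig f a y - y) * w)"
      using y yf w(1) sig_algebraic_int by (auto simp: OK_iff intro!: algebraic_int_times algebraic_int_diff)
    then show ?thesis using eq by (rule of_int_eq_mult_algebraic_int_imp_dvd)
  qed
  \<comment> \<open>A nonzero \<open>c\<close> is not divisible by all powers of \<open>p\<close>;
    its own absolute value is already too large an exponent.\<close>
  then have "int p ^ nat \<bar>c\<bar> \<le> \<bar>c\<bar>" using w(2) by (intro zdvd_imp_le) auto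
  moreover have "nat \<bar>c\<bar> < p ^ nat \<bar>c\<bar>" using p by (simp add: power_gt_expt)
  then have "int (nat \<bar>c\<bar>) < int (p ^ nat \<bar>c\<bar>)" by (simp only: of_nat_less_iff)
  then have "\<bar>c\<bar> < int p ^ nat \<bar>c\<bar>" by simp
  ultimately show False by simp
qed

end


section \<open>Principal ideals, power residues and Heilbronn's argument\<close>

locale euclidean_field = conductor_field +
  assumes euclidean: "norm_euclidean K"
begin

lemma division:
  assumes "a \<in> OK" "b \<in> OK" "b \<noteq> 0"
  obtains c where "c \<in> OK" "\<bar>inorm (a - c * b)\<bar> < \<bar>inorm b\<bar>"
proof -
  obtain c where c: "c \<in> OK" "cmod (absolute_norm K (a - c * b)) < cmod (absolute_norm K b)"
    using euclidean assms unfolding norm_euclidean_def by blast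
  have "a - c * b \<in> OK" using assms c by (intro OK.diff_mem OK.mult_mem)
  then have "real_of_int \<bar>inorm (a - c * b)\<bar> < real_of_int \<bar>inorm b\<bar>"
    using c(2) assms by (simp add: absolute_norm_eq)
  then have "\<bar>inorm (a - c * b)\<bar> < \<bar>inorm b\<bar>" by (simp only: of_int_less_iff)
  then show thesis using that c by blast
qed

text \<open>A nonzero element of least absolute norm divides all others, since a nonzero remainder
  would have smaller norm. The assumption \<open>closed\<close> combines closure under differences
  and under multiples.\<close>

lemma ideal_principal:
  assumes I: "I \<subseteq> OK" "b \<in> I" "b \<noteq> 0"
    and closed: "\<And>x y c. x \<in> I \<Longrightarrow> y \<in> I \<Longrightarrow> c \<in> OK \<Longrightarrow> x - c * y \<in> I"
  obtains d where "d \<in> I" "d \<noteq> 0" "\<And>x. x \<in> I \<Longrightarrow> \<exists>y\<in>OK. x = d * y"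
proof -
  define P where "P x \<longleftrightarrow> x \<in> I \<and> x \<noteq> 0" for x
  define d where "d = arg_min (\<lambda>x. nat \<bar>inorm x\<bar>) P"
  have "P b" using I by (simp add: P_def)
  then have d: "P d" unfolding d_def by (rule arg_min_natI)
  have min: "nat \<bar>inorm d\<bar> \<le> nat \<bar>inorm x\<bar>" if "P x" for x
    using that unfolding d_def by (rule arg_min_nat_le)
  have "\<exists>y\<in>OK. x = d * y" if x: "x \<in> I" for x
  proof -
    obtain c where c: "c \<in> OK" "\<bar>inorm (x - c * d)\<bar> < \<bar>inorm d\<bar>"
      using division[of x d] x d I(1) by (auto simp: P_def)
    have "x - c * d \<in> I" using closed x d c by (simp add: P_def)
    moreover have "\<not> P (x - c * d)" using min[of "x - c * d"] c(2) by linarith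
    ultimately have "x = d * c" by (simp add: P_def mult.commute)
    then show ?thesis using c(1) by blast
  qed
  then show thesis using that d by (auto simp: P_def)
qed

text \<open>If \<open>d\<close> generates the radical of \<open>p\<close> and \<open>p = d ^ m * y\<close> with \<open>m\<close> maximal, then \<open>y\<close> is a unit. So
  \<open>N(d) ^ m = \<plusminus>p ^ l\<close>, and \<open>m = 1\<close> is impossible since then every integer would lie in \<open>\<int> + p OK\<close>.\<close>

lemma uniformizer:
  assumes p: "Factorial_Ring.prime p" "p dvd f"
  obtains d where "d \<in> OK" "rad p d" "\<bar>inorm d\<bar> = int p"
proof -
  have p1: "p > 1" using prime_gt_1_nat[OF p(1)] .
  define I where "I = {x \<in> OK. rad p x}"
  have "x - c * y \<in> I" if "x \<in> I" "y \<in> I" "c \<in> OK" for x y c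
    using that by (auto simp: I_def OK_iff intro!: OK.diff_mem OK.mult_mem rad_diff rad_mult_left)
      (auto intro: K.diff_mem K.mult_mem algebraic_int_diff algebraic_int_times)
  moreover have "of_nat p \<in> I" by (auto simp: I_def rad_self OK.of_nat_mem)
  moreover have "(of_nat p :: complex) \<noteq> 0" using p1 by simp
  moreover have "I \<subseteq> OK" by (auto simp: I_def)
  ultimately obtain d where d: "d \<in> I" "d \<noteq> 0" and gen: "\<And>x. x \<in> I \<Longrightarrow> \<exists>y\<in>OK. x = d * y"
    using ideal_principal[of I "of_nat p"] by metis
  have dO: "d \<in> OK" "rad p d" using d by (auto simp: I_def)
  have "[inorm d = 0 ^ l] (mod int p)" by (rule inorm_rad_cong[OF p(1) dO(1)]) (use dO in simp)
  then have pd: "int p dvd inorm d" using prime_gt_0_nat[OF l_prime]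
    by (simp add: power_0_left cong_0_iff)
  define N where "N = nat \<bar>inorm d\<bar>"
  have N0: "N > 0" using inorm_eq_0_iff[OF dO(1)] d(2) by (simp add: N_def)
  have pN: "p dvd N" using pd by (simp add: N_def flip: int_dvd_int_iff)
  have norm_p: "inorm (of_nat p) = int p ^ l" using inorm_of_int[of "int p"] by simp
  \<comment> \<open>These are the exponents of powers of \<open>d\<close> dividing \<open>p\<close>.
    As \<open>p\<close> divides the norm of \<open>d\<close>, comparing norms bounds them by
    \<open>l\<close>, so there is a largest one.\<close>
  define good where "good m \<longleftrightarrow> (\<exists>y\<in>OK. of_nat p = d ^ m * y)" for m
  have good_norm: "N ^ m * nat \<bar>inorm y\<bar> = p ^ l" if "y \<in> OK" "of_nat p = d ^ m * y" for m y
  proof -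
    have "inorm (d ^ m) = inorm d ^ m" for m
      using inorm_of_int[of 1] by (induction m) (auto simp: inorm_mult dO OK.power_mem)
    then have "inorm d ^ m * inorm y = int p ^ l"
      using that norm_p inorm_mult[of "d ^ m" y] dO by (simp add: OK.power_mem)
    then have "\<bar>inorm d\<bar> ^ m * \<bar>inorm y\<bar> = int p ^ l"
      by (metis abs_mult abs_of_nat of_nat_power power_abs)
    then show ?thesis unfolding N_def by (metis abs_ge_zero nat_int nat_mult_distrib nat_power_eq of_nat_power zero_le_power)
  qed
  have "m \<le> l" if "good m" for m
  proof -
    from that obtain y where "y \<in> OK" "of_nat p = d ^ m * y" by (auto simp: good_def)
    then have "N ^ m * nat \<bar>inorm y\<bar> = p ^ l" by (rule good_norm)
    then have "N ^ m dvd p ^ l" by (metis dvd_triv_left)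
    moreover have "p ^ m dvd N ^ m" using pN by (rule dvd_power_same)
    ultimately have "p ^ m dvd p ^ l" by (rule dvd_trans[rotated])
    then show ?thesis using p1 by (simp add: power_dvd_imp_le)
  qed
  moreover have "good 0" using OK.of_nat_mem[of p] by (auto simp: good_def)
  ultimately obtain m where m: "good m" and max: "\<And>k. good k \<Longrightarrow> k \<le> m"
    using Nat.ex_has_greatest_nat[of good 0 l] by blast
  obtain y where y: "y \<in> OK" "of_nat p = d ^ m * y" using m by (auto simp: good_def)
  have "\<not> rad p y"
  proof
    assume "rad p y"
    then obtain z where "z \<in> OK" "y = d * z" using gen[of y] y(1) by (auto simp: I_def)
    then have "good (Suc m)" using y(2) by (auto simp: good_def mult.assoc intro!: bexI[of _ z])
    then show False using max[of "Suc m"] by simp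
  qed
  \<comment> \<open>Outside the radical, \<open>y\<close> is congruent to an integer prime to
    \<open>p\<close>, so its norm is prime to \<open>p\<close>. Since this norm also divides
    \<open>p ^ l\<close>, it is \<open>\<plusminus>1\<close>.\<close>
  obtain n where n: "rad p (y - of_int n)" using totally_ramified[OF p y(1)] by auto
  have "\<not> int p dvd n"
    using \<open>\<not> rad p y\<close> rad_add[OF n, of "of_int n"] rad_of_int_iff[OF p(1)] by auto
  then have "\<not> int p dvd n ^ l" using p(1) prime_dvd_power by (metis prime_nat_int_transfer)
  then have "\<not> int p dvd inorm y" using inorm_rad_cong[OF p(1) y(1) n] by (simp add: cong_dvd_iff)
  then have "\<not> p dvd nat \<bar>inorm y\<bar>" by (simp flip: int_dvd_int_iff)
  moreover have "nat \<bar>inorm y\<bar> dvd p ^ l" using good_norm[OF y] by (metis dvd_triv_right)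
  ultimately have y1: "nat \<bar>inorm y\<bar> = 1"
    using p(1) by (metis divides_primepow_nat dvd_power power_0 gr0I)
  then have Nm: "N ^ m = p ^ l" using good_norm[OF y] by simp
  have "m \<noteq> 1"
  proof
    assume "m = 1"
    then have pd_eq: "of_nat p = d * y" using y by simp
    have yi: "inverse y \<in> OK" using y1 by (intro inverse_unit_mem y) linarith
    have "y \<noteq> 0" using pd_eq p1 by auto
    then have d_eq: "d = of_nat p * inverse y" using pd_eq by (simp add: field_simps)
    show False
    proof (rule integers_not_Z_plus_p[OF p1])
      fix x assume x: "x \<in> OK"
      then obtain n where n: "rad p (x - of_int n)" using totally_ramified[OF p] by auto
      then have "x - of_int n \<in> I" using x by (simp add: I_def OK.diff_mem OK.of_int_mem)
      then obtain z where z: "z \<in> OK" "x - of_int n = d * z" using gen by blast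
      then have "x = of_int n + of_nat p * (inverse y * z)" using d_eq by (simp add: algebra_simps)
      then show "\<exists>n. \<exists>y\<in>OK. x = of_int n + of_nat p * y" using OK.mult_mem[OF yi z(1)] by blast
    qed
  qed
  moreover have "m \<noteq> 0" using Nm one_less_power[OF p1 prime_gt_0_nat[OF l_prime]] by (cases "m = 0") auto
  \<comment> \<open>Now \<open>j * m\<close> is the prime \<open>l\<close>, so
    \<open>m \<noteq> 1\<close> leaves only \<open>j = 1\<close>.\<close>
  moreover obtain j where j: "N = p ^ j"
    using Nm p(1) \<open>m \<noteq> 0\<close> by (metis divides_primepow_nat dvd_power not_gr_zero)
  then have "p ^ (j * m) = p ^ l" using Nm by (simp add: power_mult)
  then have "j * m = l" using p1 by simp
  then have "j = 1 \<or> m = 1" using l_prime by (metis dvd_triv_left mult.right_neutral mult_cancel_left not_prime_0 prime_nat_iff)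
  ultimately have "N = p" using j by simp
  then show thesis using that[OF dO] by (simp add: N_def)
qed

text \<open>Let \<open>d\<close> generate the ideal \<open>(x, u)\<close>. Its norm is a multiple of
  \<open>u\<close> because that of \<open>x\<close> is. Conversely it divides \<open>u * v\<close>
  and \<open>u ^ l\<close>, the norms of \<open>x\<close> and \<open>u\<close> up to sign; being
  prime to \<open>v\<close>, it divides \<open>u\<close>.\<close>

lemma norm_coprime_factor:
  assumes x: "x \<in> OK" and n: "\<bar>inorm x\<bar> = u * v" and u: "u > 0" and uv: "Rings.coprime u v"
  obtains d where "d \<in> OK" "\<bar>inorm d\<bar> = u"
proof -
  define I where "I = {a * x + b * of_int u | a b. a \<in> OK \<and> b \<in> OK}"
  have "I \<subseteq> OK" using x by (auto simp: I_def intro!: OK.add_mem OK.mult_mem OK.of_int_mem)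
  moreover have uI: "of_int u \<in> I" unfolding I_def using OK.zero_mem OK.one_mem by force
  moreover have "(of_int u :: complex) \<noteq> 0" using u by simp
  moreover have "y - c * z \<in> I" if yz: "y \<in> I" "z \<in> I" and c: "c \<in> OK" for y z c
  proof -
    obtain a b a' b' where "y = a * x + b * of_int u" "z = a' * x + b' * of_int u"
      "a \<in> OK" "b \<in> OK" "a' \<in> OK" "b' \<in> OK"
      using yz unfolding I_def by blast
    moreover from this have "y - c * z = (a - c * a') * x + (b - c * b') * of_int u" by (simp add: algebra_simps)
    ultimately show ?thesis using c unfolding I_def
      by (intro CollectI exI[of _ "a - c * a'"] exI[of _ "b - c * b'"]) (auto intro: OK.diff_mem OK.mult_mem)
  qed
  ultimately obtain d where d: "d \<in> I" "d \<noteq> 0" and gen: "\<And>y. y \<in> I \<Longrightarrow> \<exists>z\<in>OK. y = d * z"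
    using ideal_principal[of I "of_int u"] by metis
  have dO: "d \<in> OK" using d(1) \<open>I \<subseteq> OK\<close> by auto
  obtain a b where ab: "a \<in> OK" "b \<in> OK" "d = a * x + b * of_int u" using d(1) by (auto simp: I_def)
  have "u dvd inorm x" using n by (metis dvd_abs_iff dvd_triv_left)
  then have "u dvd inorm d" using inorm_cong[OF ab(1,2) x, of u] unfolding ab(3) by (simp add: cong_dvd_iff dvd_mult)
  moreover have "inorm d dvd u"
  proof -
    have "x \<in> I" unfolding I_def using OK.zero_mem OK.one_mem by force
    then obtain z where "z \<in> OK" "x = d * z" using gen by blast
    then have "inorm d dvd inorm x" using inorm_mult[OF dO] by simp
    then have 1: "inorm d dvd u * v" using n by (metis dvd_abs_iff)
    obtain w where "w \<in> OK" "of_int u = d * w" using gen[OF uI] by blast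
    then have dl: "inorm d dvd u ^ l" using inorm_mult[OF dO, of w] inorm_of_int[of u] by (metis dvd_triv_left)
    have "Rings.coprime (u ^ l) v" using uv by simp
    then have "Rings.coprime (inorm d) v" by (rule coprime_divisors[OF dl dvd_refl])
    then show ?thesis using 1 by (simp add: coprime_dvd_mult_left_iff)
  qed
  ultimately have "\<bar>inorm d\<bar> = u" using u by (metis abs_of_pos zdvd_antisym_abs)
  then show thesis using that dO by blast
qed

text \<open>The norm is congruent to some \<open>n ^ l\<close>, and Fermat's theorem applies to
  \<open>n\<close>. Passing to the absolute value is harmless because \<open>(p - 1) div l\<close>
  is even.\<close>

lemma norm_power_residue:
  assumes l: "l > 2" and p: "Factorial_Ring.prime p" "p dvd f" "l dvd p - 1"
    and x: "x \<in> OK" "\<bar>inorm x\<bar> = u" and pu: "\<not> int p dvd u"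
  shows "[u ^ ((p - 1) div l) = 1] (mod int p)"
proof -
  obtain n where n: "rad p (x - of_int n)" using totally_ramified[OF p(1,2) x(1)] by auto
  have c: "[inorm x = n ^ l] (mod int p)" by (rule inorm_rad_cong[OF p(1) x(1) n])
  have p1: "p > 1" using prime_gt_1_nat[OF p(1)] .
  define k where "k = (p - 1) div l"
  have k: "l * k = p - 1" using p(3) by (simp add: k_def)
  have "\<not> int p dvd inorm x" using pu x(2) by auto
  then have "\<not> int p dvd n ^ l" using cong_dvd_iff[OF c] by simp
  then have pn: "\<not> int p dvd n" using prime_gt_0_nat[OF l_prime] by (metis dvd_power dvd_trans)
  have pl: "p > l" using dvd_imp_le[OF p(3)] p1 by simp
  have "odd p" using p(1) pl l prime_odd_nat[OF p(1)] by simp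
  moreover have "odd l" using l prime_odd_nat[OF l_prime] by simp
  moreover from calculation have "even (l * k)" using p1 by (simp add: k)
  ultimately have "even k" by simp
  have "[inorm x ^ k = (n ^ l) ^ k] (mod int p)" by (rule cong_pow[OF c])
  also have "(n ^ l) ^ k = n ^ (p - 1)" by (simp only: power_mult[symmetric] k)
  also have "[n ^ (p - 1) = 1] (mod int p)"
  proof -
    have "n ^ p = n * n ^ (p - 1)" using p1 by (simp add: power_eq_if)
    then have "int p dvd n * (n ^ (p - 1) - 1)"
      using fermat_int[OF p(1), of n] by (simp add: cong_iff_dvd_diff right_diff_distrib)
    then have "int p dvd n ^ (p - 1) - 1" using pn p(1) by (simp add: prime_dvd_mult_iff)
    then show ?thesis by (simp add: cong_iff_dvd_diff)
  qed
  finally have "[inorm x ^ k = 1] (mod int p)" .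
  moreover have "inorm x ^ k = u ^ k" using x(2) \<open>even k\<close> by (metis power_even_abs)
  ultimately show ?thesis by (simp add: k_def)
qed

lemma product_uniformizer:
  assumes "finite P" "\<And>p. p \<in> P \<Longrightarrow> Factorial_Ring.prime p \<and> p dvd f"
  shows "\<exists>d\<in>OK. \<bar>inorm d\<bar> = int (\<Prod>P) \<and> (\<forall>p\<in>P. rad p d)"
  using assms
proof (induction P rule: finite_induct)
  case empty
  then show ?case using inorm_of_int[of 1] by (auto intro!: bexI[of _ 1] OK.one_mem)
next
  case (insert p P)
  then obtain d where d: "d \<in> OK" "\<bar>inorm d\<bar> = int (\<Prod>P)" "\<forall>p\<in>P. rad p d" by auto
  obtain e where e: "e \<in> OK" "rad p e" "\<bar>inorm e\<bar> = int p" using uniformizer insert.prems by blast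
  show ?case
  proof (intro bexI conjI ballI)
    show "\<bar>inorm (e * d)\<bar> = int (\<Prod>(insert p P))"
      using insert(1,2) d e by (simp add: inorm_mult abs_mult)
    show "e * d \<in> OK" using d e by (intro OK.mult_mem)
    show "rad q (e * d)" if "q \<in> insert p P" for q
      using that d e by (auto simp: OK_iff intro: rad_mult rad_mult_left)
  qed
qed

text \<open>Heilbronn's argument: divide \<open>n\<close> by an element of norm \<open>M\<close> that is divisible by the totally
  ramified primes over the prime factors of \<open>M\<close>; modulo \<open>M\<close> the norm of the remainder is
  \<open>n ^ l\<close>.\<close>

lemma heilbronn:
  assumes P: "finite P" "\<And>p. p \<in> P \<Longrightarrow> Factorial_Ring.prime p \<and> p dvd f"
    and M: "M = int (\<Prod>P)" and a: "a = n ^ l mod M"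
  shows "\<exists>x\<in>OK. \<bar>inorm x\<bar> = a \<or> \<bar>inorm x\<bar> = M - a"
proof -
  obtain d where d: "d \<in> OK" "\<bar>inorm d\<bar> = M" "\<And>p. p \<in> P \<Longrightarrow> rad p d"
    using product_uniformizer[OF P] M by auto
  have "\<Prod>P > 0" using P by (auto intro!: prod_pos prime_gt_0_nat)
  then have M0: "M > 0" by (simp only: M of_nat_0_less_iff)
  then have "d \<noteq> 0" using d(2) inorm_eq_0_iff[OF d(1)] by auto
  then obtain c where c: "c \<in> OK" "\<bar>inorm (of_int n - c * d)\<bar> < M"
    using division[OF OK.of_int_mem d(1)] d(2) by metis
  define x where "x = of_int n - c * d"
  have x: "x \<in> OK" unfolding x_def using c d by (intro OK.diff_mem OK.mult_mem OK.of_int_mem)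
  have "int p dvd inorm x - n ^ l" if "p \<in> P" for p
  proof -
    have "rad p (x - of_int n)" using rad_minus[OF rad_mult_left[OF d(3)[OF that], of c]] c(1)
      by (simp add: x_def OK_iff)
    then have "[inorm x = n ^ l] (mod int p)" using inorm_rad_cong[OF _ x] P(2)[OF that] by blast
    then show ?thesis by (simp add: cong_iff_dvd_diff)
  qed
  moreover have "int (\<Prod>Q) dvd z" if "finite Q" "Q \<subseteq> P" "\<And>p. p \<in> P \<Longrightarrow> int p dvd z" for Q z
    using that(1,2)
  proof (induction Q rule: finite_induct)
    case (insert p Q)
    have "Rings.coprime p (\<Prod>Q)"
      using insert P(2) by (intro prod_coprime_right) (auto intro!: primes_coprime)
    then have "Rings.coprime (int p) (int (\<Prod>Q))" by (simp only: coprime_int_iff)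
    moreover have "int p dvd z" "int (\<Prod>Q) dvd z" using insert that(3)[of p] by auto
    ultimately have "int p * int (\<Prod>Q) dvd z" by (intro divides_mult)
    then show ?case using insert(1,2) by simp
  qed simp
  ultimately have "M dvd inorm x - n ^ l" using P(1) M by blast
  then have m: "inorm x mod M = a" unfolding a by (metis mod_eq_dvd_iff)
  have b: "\<bar>inorm x\<bar> < M" using c(2) by (simp add: x_def)
  \<comment> \<open>The norm lies strictly between \<open>- M\<close> and \<open>M\<close> and has
    residue \<open>a\<close>, so it is \<open>a\<close> or \<open>a - M\<close>.\<close>
  show ?thesis
  proof (cases "inorm x \<ge> 0")
    case True
    then have "inorm x = a" using m b by simp
    then show ?thesis using x True by (intro bexI[of _ x]) auto
  next
    case False
    have "(inorm x + M) mod M = inorm x + M" by (rule mod_pos_pos_trivial) (use b False in linarith)+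
    then have "inorm x + M = a" using m by simp
    then show ?thesis using x False by (intro bexI[of _ x]) auto
  qed
qed

end

section \<open>Checking certificates\<close>

text \<open>With \<open>r\<close> as an argument, the simplifier evaluates the recursive call of
  \<open>pow_mod\<close> before it is squared.\<close>

definition mul_mod :: "int \<Rightarrow> int \<Rightarrow> int \<Rightarrow> int" where
  "mul_mod m u r = r * r * u mod m"

function pow_mod :: "int \<Rightarrow> int \<Rightarrow> int \<Rightarrow> int" where
  "pow_mod m u e =
     (if e \<le> 0 then 1 else mul_mod m (if e mod 2 = 0 then 1 else u) (pow_mod m u (e div 2)))"
  by auto
termination by (relation "measure (\<lambda>(m, u, e). nat e)") auto

declare pow_mod.simps [simp del]

lemma pow_mod_eq:
  assumes "m > 1" "e \<ge> 0" shows "pow_mod m u e = u ^ nat e mod m"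
  using assms
proof (induction m u e rule: pow_mod.induct)
  case (1 m u e)
  show ?case
  proof (cases "e \<le> 0")
    case True
    then show ?thesis using 1 by (simp add: pow_mod.simps)
  next
    case False
    then have IH: "pow_mod m u (e div 2) = u ^ nat (e div 2) mod m" using 1 by simp
    define c where "c = (if e mod 2 = 0 then 1 else u)"
    have "nat (e div 2) = nat e div 2" "nat (e mod 2) = nat e mod 2"
      using False by (simp_all add: nat_div_distrib nat_mod_distrib)
    moreover have "k = k div 2 + k div 2 + k mod 2" for k :: nat by presburger
    ultimately have "nat e = nat (e div 2) + nat (e div 2) + nat (e mod 2)" by metis
    then have "u ^ nat e = u ^ nat (e div 2) * u ^ nat (e div 2) * u ^ nat (e mod 2)"
      by (simp only: power_add)
    also have "u ^ nat (e mod 2) = c"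
    proof -
      have "e mod 2 = 0 \<or> e mod 2 = 1" by presburger
      then show ?thesis by (auto simp: c_def)
    qed
    finally have "u ^ nat e mod m = (u ^ nat (e div 2) mod m) * (u ^ nat (e div 2) mod m) * c mod m"
      by (metis mod_mult_eq mod_mult_left_eq)
    moreover have "pow_mod m u e = mul_mod m c (pow_mod m u (e div 2))"
      unfolding pow_mod.simps[of m u e] c_def if_not_P[OF False] ..
    ultimately show ?thesis by (simp only: mul_mod_def IH)
  qed
qed

text \<open>A factor \<open>u\<close> of \<open>a\<close> that is coprime to \<open>a div u\<close> and not an \<open>l\<close>-th power residue of
  one of the totally ramified primes \<open>w\<close> prevents \<open>a\<close> from being a norm. Conditional expressions
  stand for conjunctions and disjunctions here and below, as the simplifier evaluates them lazily.\<close>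

definition unitary_nonresidue :: "int \<Rightarrow> int list \<Rightarrow> int \<Rightarrow> int \<Rightarrow> bool" where
  "unitary_nonresidue l ws a u \<longleftrightarrow>
     (if u dvd a then if gcd u (a div u) = 1 then list_ex (\<lambda>w. 1 < pow_mod w u ((w - 1) div l)) ws
      else False else False)"

fun exists_in :: "(int \<Rightarrow> bool) \<Rightarrow> int list \<Rightarrow> bool" where
  "exists_in P [] = False"
| "exists_in P (u # us) = (if P u then True else exists_in P us)"

text \<open>The candidates are the prime powers up to 31. Products of coprime candidates would add
  nothing: if all factors are power residues of \<open>w\<close>, so is the product.\<close>

definition has_unitary_nonresidue :: "int \<Rightarrow> int list \<Rightarrow> int \<Rightarrow> bool" where
  "has_unitary_nonresidue l ws a \<longleftrightarrow>
     exists_in (unitary_nonresidue l ws a) [2, 3, 4, 5, 7, 8, 9, 11, 13, 16, 17, 19, 23, 25, 27, 29, 31]"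

definition both_non_norms :: "int \<Rightarrow> int list \<Rightarrow> int \<Rightarrow> int \<Rightarrow> bool" where
  "both_non_norms l ws a b \<longleftrightarrow>
     (if has_unitary_nonresidue l ws a then has_unitary_nonresidue l ws b else False)"

definition refutes_at :: "int \<Rightarrow> int list \<Rightarrow> int \<Rightarrow> int \<Rightarrow> bool" where
  "refutes_at l ws m a \<longleftrightarrow> both_non_norms l ws a (m - a)"

definition refutes :: "int \<Rightarrow> int list \<Rightarrow> int \<Rightarrow> int \<Rightarrow> bool" where
  "refutes l ws m n \<longleftrightarrow> refutes_at l ws m (pow_mod m n l)"

lemma exists_in_iff: "exists_in P us \<longleftrightarrow> (\<exists>u\<in>set us. P u)"
  by (induction us) auto

context euclidean_field
begin

text \<open>The test asks for a value above 1 because the value 0, which occurs when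
  \<open>p\<close> divides the norm, proves nothing.\<close>

lemma norm_pow_mod:
  assumes l: "l > 2" and p: "Factorial_Ring.prime p" "p dvd f" "l dvd p - 1" and x: "x \<in> OK"
  shows "\<not> 1 < pow_mod (int p) \<bar>inorm x\<bar> ((int p - 1) div int l)"
proof
  define u where "u = \<bar>inorm x\<bar>"
  define k where "k = (p - 1) div l"
  have p1: "p > 1" using prime_gt_1_nat[OF p(1)] .
  then have "p - 1 = l * k" "p - 1 > 0" using p(3) by (auto simp: k_def)
  then have k: "k > 0" by (auto intro: Nat.gr0I)
  have "(int p - 1) div int l = int k" using p1 by (simp add: k_def zdiv_int of_nat_diff)
  moreover assume "1 < pow_mod (int p) \<bar>inorm x\<bar> ((int p - 1) div int l)"
  ultimately have r: "1 < u ^ k mod int p" using p1 by (simp add: pow_mod_eq u_def)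
  have "\<not> int p dvd u"
  proof
    assume "int p dvd u"
    then have "int p dvd u ^ k" using k by (meson dvd_power dvd_trans)
    then show False using r by simp
  qed
  then have "[u ^ k = 1] (mod int p)"
    unfolding k_def by (intro norm_power_residue[OF l p x]) (simp_all add: u_def)
  then show False using r p1 by (simp add: cong_def)
qed

lemma not_norm_if_unitary_nonresidue:
  assumes l: "l > 2" and ws: "\<And>w. w \<in> set ws \<Longrightarrow> Factorial_Ring.prime w \<and> w dvd f \<and> l dvd w - 1"
    and x: "x \<in> OK" and nonres: "has_unitary_nonresidue (int l) (map int ws) \<bar>inorm x\<bar>"
  shows False
proof -
  obtain u where "u > 0" and nonres: "unitary_nonresidue (int l) (map int ws) \<bar>inorm x\<bar> u"
    using nonres unfolding has_unitary_nonresidue_def exists_in_iff by force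
  then have u: "u > 0" "\<bar>inorm x\<bar> = u * (\<bar>inorm x\<bar> div u)" "Rings.coprime u (\<bar>inorm x\<bar> div u)"
    by (auto simp: unitary_nonresidue_def coprime_iff_gcd_eq_1 split: if_splits)
  obtain d where d: "d \<in> OK" "\<bar>inorm d\<bar> = u" using norm_coprime_factor[OF x u(2,1,3)] .
  obtain w where "w \<in> set ws" "1 < pow_mod (int w) u ((int w - 1) div int l)"
    using nonres by (auto simp: unitary_nonresidue_def list_ex_iff split: if_splits)
  then show False using norm_pow_mod[OF l _ _ _ d(1), of w] ws d(2) by blast
qed

text \<open>The set \<open>P\<close> holds the ramified primes that make up the modulus,
  \<open>ws\<close> those at which power residues are tested. They differ when \<open>l\<close>
  itself belongs to \<open>P\<close>.\<close>

lemma refutes_imp_False: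
  assumes l: "l > 2" and P: "finite P" "\<And>p. p \<in> P \<Longrightarrow> Factorial_Ring.prime p \<and> p dvd f"
    and ws: "set ws \<subseteq> P" "\<And>w. w \<in> set ws \<Longrightarrow> l dvd w - 1"
    and M: "M = int (\<Prod>P)" "M > 1" and ref: "refutes (int l) (map int ws) M n"
  shows False
proof -
  define a where "a = n ^ l mod M"
  have a: "pow_mod M n (int l) = a" using M(2) by (simp add: pow_mod_eq a_def)
  have W: "\<And>w. w \<in> set ws \<Longrightarrow> Factorial_Ring.prime w \<and> w dvd f \<and> l dvd w - 1" using ws P by auto
  obtain x where x: "x \<in> OK" "\<bar>inorm x\<bar> = a \<or> \<bar>inorm x\<bar> = M - a"
    using heilbronn[OF P M(1) a_def] by blast
  then show False
    using ref not_norm_if_unitary_nonresidue[OF l W x(1)] by (auto simp: refutes_def refutes_at_def both_non_norms_def a split: if_splits)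
qed

end

text \<open>A ramified prime is itself the absolute value of a norm, so each prime of a pair must be
  an \<open>l\<close>-th power residue of the other. Only pairs that pass this need a Heilbronn
  certificate, with a base from the pool \<open>cs\<close>. Products above 10000 exceed the bound on
  the conductor.\<close>

definition tame_pairs_refuted :: "int \<Rightarrow> int list \<Rightarrow> int list \<Rightarrow> bool" where
  "tame_pairs_refuted l S cs \<longleftrightarrow> list_all (\<lambda>p. list_all (\<lambda>q.
     if p = q \<or> 10000 < p * q then True
     else if 1 < pow_mod q p ((q - 1) div l) then True
     else if 1 < pow_mod p q ((p - 1) div l) then True
     else list_ex (refutes l [p, q] (p * q)) cs) S) S"

text \<open>As \<open>l\<close> divides a conductor only together with its square, the size bound
  involves \<open>l * l * p\<close>, while Heilbronn's modulus is \<open>l * p\<close>.\<close>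

definition wild_pairs_refuted :: "int \<Rightarrow> int list \<Rightarrow> int list \<Rightarrow> bool" where
  "wild_pairs_refuted l S cs \<longleftrightarrow> list_all (\<lambda>p.
     if 10000 < l * l * p then True
     else if 1 < pow_mod p l ((p - 1) div l) then True
     else list_ex (refutes l [p] (l * p)) cs) S"

text \<open>A refuted prime cannot divide the conductor at all, so all prime factors other than
  \<open>l\<close> lie in \<open>S\<close>. A second prime factor would form a refuted pair with
  \<open>l\<close> or with the first one: the product in the size bound divides \<open>f\<close> and
  is therefore at most 10000.\<close>

lemma (in euclidean_field) conductor_cases:
  assumes l: "l > 2" and f: "f \<le> 10 ^ 4"
    and single: "\<And>p. Factorial_Ring.prime p \<Longrightarrow> l dvd p - 1 \<Longrightarrow> p \<le> 10 ^ 4 \<Longrightarrow>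
      int p \<in> set S \<or> (\<exists>c. refutes (int l) [int p] (int p) c)"
    and tame: "tame_pairs_refuted (int l) S cs" and wild: "wild_pairs_refuted (int l) S cs'"
  shows "f = l\<^sup>2 \<or> int f \<in> set S"
proof -
  have "\<not> l dvd l - 1" using l by (auto dest: dvd_imp_le)
  then have tame_dvd: "l dvd p - 1" if "Factorial_Ring.prime p" "p dvd f" "p \<noteq> l" for p
    using conductor_prime_divisor[OF that(1,2)] that(3) by auto
  have mem: "int p \<in> set S" if p: "Factorial_Ring.prime p" "p dvd f" "p \<noteq> l" for p
  proof (rule ccontr)
    assume "int p \<notin> set S"
    moreover have "p \<le> 10 ^ 4" using dvd_imp_le[OF p(2) f_pos] f by simp
    ultimately obtain c where "refutes (int l) [int p] (int p) c"
      using single[OF p(1) tame_dvd[OF p]] by blast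
    then show False
      using refutes_imp_False[OF l, of "{p}" "[p]" "int p" c] p tame_dvd[OF p] prime_gt_1_nat[OF p(1)] by simp
  qed
  show ?thesis
  proof (cases "l dvd f")
    case True
    then have "l\<^sup>2 dvd f" using conductor_prime_divisor[OF l_prime] \<open>\<not> l dvd l - 1\<close> by auto
    then obtain g where g: "f = l\<^sup>2 * g" by (elim dvdE)
    have "g = 1"
    proof (rule ccontr)
      assume "g \<noteq> 1"
      then obtain q where q: "Factorial_Ring.prime q" "q dvd g" using prime_factor_nat by blast
      then have qf: "q dvd f" and lqf: "l\<^sup>2 * q dvd f" by (auto simp: g)
      have ql: "q \<noteq> l"
      proof
        assume "q = l"
        then have "l ^ 3 dvd f" using lqf by (simp add: power2_eq_square power3_eq_cube)
        then show False using not_cube_dvd_conductor[OF l] by simp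
      qed
      note d = tame_dvd[OF q(1) qf ql]
      have "l * l * q \<le> 10000" using dvd_imp_le[OF lqf f_pos] f by (simp add: power2_eq_square)
      then have "int (l * l * q) \<le> int 10000" by (simp only: of_nat_le_iff)
      then have small: "\<not> 10000 < int l * int l * int q" by simp
      obtain x where x: "x \<in> OK" "\<bar>inorm x\<bar> = int l" using uniformizer[OF l_prime True] by blast
      have "\<not> 1 < pow_mod (int q) (int l) ((int q - 1) div int l)"
        using norm_pow_mod[OF l q(1) qf d x(1)] x(2) by simp
      then have "list_ex (refutes (int l) [int q] (int l * int q)) cs'"
        using wild mem[OF q(1) qf ql] small by (auto simp: wild_pairs_refuted_def list_all_iff)
      then obtain c where c: "refutes (int l) [int q] (int l * int q) c" by (auto simp: list_ex_iff)
      have "1 < l * q" using l prime_gt_1_nat[OF q(1)] by (intro less_1_mult) linarith+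
      then have "1 < int l * int q" by (metis of_nat_1 of_nat_less_iff of_nat_mult)
      then show False
        using refutes_imp_False[OF l, of "{l, q}" "[q]" "int l * int q" c] c q qf d ql l_prime True by auto
    qed
    then show ?thesis using g by simp
  next
    case False
    obtain p where p: "Factorial_Ring.prime p" "p dvd f" using f_neq_1 prime_factor_nat by blast
    have pl: "p \<noteq> l" using p False by auto
    note dp = tame_dvd[OF p pl]
    have p2: "\<not> p\<^sup>2 dvd f" using conductor_prime_divisor[OF p] pl by auto
    obtain g where g: "f = p * g" using p by (elim dvdE)
    have "g = 1"
    proof (rule ccontr)
      assume "g \<noteq> 1"
      then obtain q where q: "Factorial_Ring.prime q" "q dvd g" using prime_factor_nat by blast
      then have qf: "q dvd f" and pqf: "p * q dvd f" by (auto simp: g)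
      have ql: "q \<noteq> l" using qf False by auto
      have pq: "p \<noteq> q" using p2 pqf by (auto simp: power2_eq_square)
      note dq = tame_dvd[OF q(1) qf ql]
      have "p * q \<le> 10000" using dvd_imp_le[OF pqf f_pos] f by simp
      then have "int (p * q) \<le> int 10000" by (simp only: of_nat_le_iff)
      then have small: "\<not> 10000 < int p * int q" by simp
      obtain x where x: "x \<in> OK" "\<bar>inorm x\<bar> = int p" using uniformizer[OF p] by blast
      obtain y where y: "y \<in> OK" "\<bar>inorm y\<bar> = int q" using uniformizer[OF q(1) qf] by blast
      have "\<not> 1 < pow_mod (int q) (int p) ((int q - 1) div int l)"
        using norm_pow_mod[OF l q(1) qf dq x(1)] x(2) by simp
      moreover have "\<not> 1 < pow_mod (int p) (int q) ((int p - 1) div int l)"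
        using norm_pow_mod[OF l p dp y(1)] y(2) by simp
      moreover have "if int p = int q \<or> 10000 < int p * int q then True
          else if 1 < pow_mod (int q) (int p) ((int q - 1) div int l) then True
          else if 1 < pow_mod (int p) (int q) ((int p - 1) div int l) then True
          else list_ex (refutes (int l) [int p, int q] (int p * int q)) cs"
        using tame mem[OF p pl] mem[OF q(1) qf ql] unfolding tame_pairs_refuted_def list_all_iff by blast
      ultimately have "list_ex (refutes (int l) [int p, int q] (int p * int q)) cs"
        using small pq by simp
      then obtain c where c: "refutes (int l) [int p, int q] (int p * int q) c" by (auto simp: list_ex_iff)
      have "1 < p * q" using prime_gt_1_nat[OF p(1)] prime_gt_1_nat[OF q(1)] by (intro less_1_mult)
      then have "1 < int p * int q" by (metis of_nat_1 of_nat_less_iff of_nat_mult)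
      then show False
        using refutes_imp_False[OF l, of "{p, q}" "[p, q]" "int p * int q" c] c p q qf dp dq pq by auto
    qed
    then show ?thesis using mem[OF p pl] g by simp
  qed
qed

lemma field_conductor_cases:
  assumes K: "number_field K" "norm_euclidean K" "field_degree K = l" "Factorial_Ring.prime l" "has_conductor K f"
    and l: "l > 2" and f: "f \<le> 10 ^ 4"
    and single: "\<And>p. Factorial_Ring.prime p \<Longrightarrow> l dvd p - 1 \<Longrightarrow> p \<le> 10 ^ 4 \<Longrightarrow>
      int p \<in> set S \<or> (\<exists>c. refutes (int l) [int p] (int p) c)"
    and tame: "tame_pairs_refuted (int l) S cs" and wild: "wild_pairs_refuted (int l) S cs'"
  shows "f = l\<^sup>2 \<or> int f \<in> set S"
proof -
  have f0: "f > 0" and Kf: "K \<subseteq> cyclo f" and fmin: "\<And>g. g > 0 \<Longrightarrow> K \<subseteq> cyclo g \<Longrightarrow> f \<le> g"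
    using K(5) by (auto simp: has_conductor_def cyclotomic_field_eq)
  have subK: "subfield K complex_field" using K(1) by (simp add: number_field_def)
  have "K \<noteq> \<rat>"
  proof
    assume "K = \<rat>"
    interpret field complex_field by (rule field_from_type_algebra)
    have subQ: "subfield \<rat> complex_field"
      by (intro subfield_complex_fieldI Rats.num_ring_axioms) auto
    have "(dim over \<rat>) \<rat> = 1" by (rule dimI[OF subQ dimension_one[OF subQ]])
    then show False using K(3) \<open>K = \<rat>\<close> l by (simp add: field_degree_def over_def)
  qed
  then obtain t where t: "t \<in> K" "t \<notin> \<rat>" using subfield_Rats_subset[OF subK] by auto
  note gen = prime_degree_generator[OF K(1,3,4) t]
  interpret euclidean_field K f l t
    by (intro euclidean_field.intro euclidean_field_axioms.intro conductor_field.intro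
        conductor_field_axioms.intro prime_cyclic.intro f0 Kf subK gen K(2,4) fmin)
  show ?thesis by (rule conductor_cases[OF l f single tame wild])
qed

text \<open>Trial division spares many composite numbers an entry in the certificate lists. The
  numbers tested are odd, and excluding \<open>p \<le> 13\<close> ensures that a divisor found is
  proper.\<close>

definition has_small_factor :: "int \<Rightarrow> bool" where
  "has_small_factor p \<longleftrightarrow> (if p \<le> 13 then False else if 3 dvd p then True else if 5 dvd p then True
     else if 7 dvd p then True else if 11 dvd p then True else 13 dvd p)"

definition checked :: "int \<Rightarrow> int list \<Rightarrow> int \<Rightarrow> int \<Rightarrow> bool" where
  "checked l S p c \<longleftrightarrow>
     (if c = 0 then p \<in> set S else if 0 < c then refutes l [p] p c else - c < p \<and> - c dvd p \<and> c \<noteq> - 1)"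

text \<open>The list provides one certificate for each number \<open>\<equiv> p (mod 2 * l)\<close> in \<open>{p..b}\<close> that has no
  factor up to 13: the base \<open>n\<close> for \<^const>\<open>refutes\<close>, or \<open>-d\<close> with a proper divisor \<open>d\<close>, or
  \<open>0\<close> for an element of \<open>S\<close>.\<close>

function all_checked :: "int \<Rightarrow> int list \<Rightarrow> int \<Rightarrow> int \<Rightarrow> int list \<Rightarrow> bool" where
  "all_checked l S b p cs =
     (if b < p \<or> l \<le> 0 then True
      else if has_small_factor p then all_checked l S b (p + 2 * l) cs
      else case cs of [] \<Rightarrow> False | c # cs' \<Rightarrow> checked l S p c \<and> all_checked l S b (p + 2 * l) cs')"
  by auto
termination by (relation "measure (\<lambda>(l, S, b, p, cs). nat (b + 1 - p))") auto

declare all_checked.simps [simp del]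

lemma proper_divisor_imp_not_prime:
  assumes "int p = q" "d dvd q" "1 < d" "d < q" shows "\<not> Factorial_Ring.prime p"
proof
  assume "Factorial_Ring.prime p"
  moreover have "nat d dvd p" using assms by (simp add: nat_dvd_iff)
  ultimately have "nat d = 1 \<or> nat d = p" by (simp add: prime_nat_iff)
  then show False using assms by auto
qed

lemma has_small_factor_imp_not_prime:
  assumes "has_small_factor (int p)" shows "\<not> Factorial_Ring.prime p"
proof -
  obtain d where "d dvd int p" "1 < d" "d < int p"
    using assms unfolding has_small_factor_def by (force split: if_splits)
  then show ?thesis using proper_divisor_imp_not_prime by blast
qed

lemma checked_sound:
  assumes "checked l S (int p) c" "Factorial_Ring.prime p"
  shows "int p \<in> set S \<or> (\<exists>c. refutes l [int p] (int p) c)"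
  using assms proper_divisor_imp_not_prime[OF refl, of "- c" p]
  by (auto simp: checked_def split: if_splits)

lemma all_checked_sound:
  assumes "all_checked l S b q cs" "l > 0" "Factorial_Ring.prime p" "int p = q + 2 * l * int k" "int p \<le> b"
  shows "int p \<in> set S \<or> (\<exists>c. refutes l [int p] (int p) c)"
  using assms
proof (induction l S b q cs arbitrary: k rule: all_checked.induct)
  case (1 l S b q cs)
  have "0 \<le> 2 * l * int k" using 1(4) by simp
  then have qb: "\<not> (b < q \<or> l \<le> 0)" using 1(4,6,7) by linarith
  note step = 1(3)[unfolded all_checked.simps[of l S b q cs] if_not_P[OF qb]]
  show ?case
  proof (cases k)
    case 0
    then have q: "q = int p" using 1(6) by simp
    then have "\<not> has_small_factor q" using has_small_factor_imp_not_prime 1(5) by blast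
    then obtain c cs' where "checked l S q c" using step by (auto split: list.splits)
    then show ?thesis using checked_sound 1(5) q by blast
  next
    case (Suc j)
    then have p: "int p = q + 2 * l + 2 * l * int j" using 1(6) by (simp add: algebra_simps)
    show ?thesis
    proof (cases "has_small_factor q")
      case True
      then show ?thesis using 1(1)[OF qb True _ 1(4,5) p 1(7)] step by simp
    next
      case False
      then obtain c cs' where "cs = c # cs'" "all_checked l S b (q + 2 * l) cs'"
        using step by (auto split: list.splits)
      then show ?thesis using 1(2)[OF qb False _ _ 1(4,5) p 1(7)] by blast
    qed
  qed
qed

lemma all_checked_soundI:
  assumes "all_checked (int l) S b q cs" "Factorial_Ring.prime p" "l dvd p - 1" "odd l"
    and "2 * int l dvd q - 1" "q \<le> int p" "int p \<le> b" "p > 2"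
  shows "int p \<in> set S \<or> (\<exists>c. refutes (int l) [int p] (int p) c)"
proof -
  have "odd p" using assms(2,8) prime_odd_nat by blast
  then have "2 dvd p - 1" by simp
  moreover have "Rings.coprime 2 l" using assms(4) by simp
  ultimately have "2 * l dvd p - 1" using assms(3) by (simp add: divides_mult)
  then have "int (2 * l) dvd int (p - 1)" by (simp only: int_dvd_int_iff)
  then have "2 * int l dvd int p - 1" using assms(8) by (simp add: of_nat_diff)
  then have "2 * int l dvd (int p - 1) - (q - 1)" using assms(5) by (rule dvd_diff)
  then obtain k where k: "int p - q = 2 * int l * k" by (auto elim!: dvdE)
  have l0: "int l > 0" using assms(4) by (auto intro: Nat.gr0I)
  then have "k \<ge> 0" using k assms(6) by (metis diff_ge_0_iff_ge mult_pos_pos zero_le_mult_iff zero_less_numeral not_le)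
  then have "int p = q + 2 * int l * int (nat k)" using k by simp
  then show ?thesis by (rule all_checked_sound[OF assms(1) l0 assms(2) _ assms(7)])
qed

section \<open>Certificates\<close>

text \<open>The certificates are hidden here, so that a long range can be verified in pieces and
  joined afterwards.\<close>

definition covered :: "int \<Rightarrow> int list \<Rightarrow> int \<Rightarrow> int \<Rightarrow> bool" where
  "covered l S q b \<longleftrightarrow> (\<forall>p. Factorial_Ring.prime p \<and> l dvd int p - 1 \<and> q \<le> int p \<and> int p \<le> b \<longrightarrow>
     int p \<in> set S \<or> (\<exists>c. refutes l [int p] (int p) c))"

lemma coveredI:
  assumes "all_checked l S b q cs" "0 < l" "odd l" "2 * l dvd q - 1" "2 < q"
  shows "covered l S q b"
  unfolding covered_def
proof (intro allI impI, elim conjE)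
  fix p assume p: "Factorial_Ring.prime p" "l dvd int p - 1" "q \<le> int p" "int p \<le> b"
  define k where "k = nat l"
  have l: "l = int k" using assms(2) by (simp add: k_def)
  have "int (p - 1) = int p - 1" using prime_gt_0_nat[OF p(1)] by linarith
  then have "int k dvd int (p - 1)" using p(2) l by simp
  then have "k dvd p - 1" by (simp only: int_dvd_int_iff)
  moreover have "p > 2" "odd k" using assms(3,5) p(3) l by auto
  ultimately show "int p \<in> set S \<or> (\<exists>c. refutes l [int p] (int p) c)"
    unfolding l using all_checked_soundI[OF assms(1)[unfolded l] p(1)] assms(4)[unfolded l] p(3,4) by blast
qed

lemma covered_join: "covered l S q b \<Longrightarrow> covered l S q' c \<Longrightarrow> q' \<le> b + 1 \<Longrightarrow> covered l S q c"
  unfolding covered_def by (metis int_one_le_iff_zero_less linorder_not_le order_trans zle_add1_eq_le)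

lemma conductor_classification:
  assumes K: "number_field K" "norm_euclidean K" "field_degree K = l" "Factorial_Ring.prime l" "has_conductor K f"
    and l: "int l = l'" "2 < l'" and f: "f \<le> 10 ^ 4"
    and cov: "covered l' S (2 * l' + 1) 10000"
    and tame: "tame_pairs_refuted l' S cs" and wild: "wild_pairs_refuted l' S cs'"
  shows "f = l\<^sup>2 \<or> int f \<in> set S"
proof (rule field_conductor_cases[OF K])
  show "l > 2" using l by simp
  show "f \<le> 10 ^ 4" by (rule f)
  show "tame_pairs_refuted (int l) S cs" "wild_pairs_refuted (int l) S cs'" using tame wild l(1) by auto
  fix p assume p: "Factorial_Ring.prime p" "l dvd p - 1" "p \<le> 10 ^ 4"
  have p1: "p > 1" using prime_gt_1_nat[OF p(1)] .
  then have "l \<le> p - 1" using p(2) by (intro dvd_imp_le) auto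
  then have "odd p" using prime_odd_nat[OF p(1)] l by linarith
  moreover have "odd l" using prime_odd_nat[OF K(4)] l by linarith
  ultimately have "2 * l dvd p - 1" using p(2) by (intro divides_mult) auto
  then have "2 * l \<le> p - 1" using p1 by (intro dvd_imp_le) auto
  then have "2 * l' + 1 \<le> int p" using p1 l(1) by linarith
  moreover have "int l dvd int (p - 1)" using p(2) by (simp only: int_dvd_int_iff)
  then have "l' dvd int p - 1" using p1 l(1) by (simp add: of_nat_diff)
  moreover have "int p \<le> 10000" using p(3) by simp
  ultimately show "int p \<in> set S \<or> (\<exists>c. refutes (int l) [int p] (int p) c)"
    using cov p(1) \<open>int p \<le> 10000\<close> unfolding covered_def l(1) by blast
qed

text \<open>For instance, the base 5 refutes the conductor 79: \<open>5 ^ 3\<close> is 46 modulo 79,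
  and 46 and \<open>79 - 46 = 33\<close> have the unitary divisors 2 and 3, neither of which is a
  cube modulo 79. The first negative entry belongs to \<open>289 = 17 * 17\<close>.\<close>

lemma covered_3_1: "covered 3 [7, 13, 19, 31, 37, 43, 61, 67, 73, 103, 109, 127, 157] 7 1044"
  by (rule coveredI[of _ _ _ _ "[
      0, 0, 0, 0, 0, 0, 0, 0, 0, 5, 6, 0, 0, 0, 9, 6, 0, 10, 28, 10, 19, 13, 13, 10, 19, 17, 8, 30, -17,
      26, 30, 26, 17, 15, -19, 19, 23, 21, -17, 28, 18, 19, 21, 57, 26, 13, 11, -17, 59, 23, -23, 14, 9,
      10, 18, -19, 15, 10, 18, 24, 11, 10, 12, -23, 10, 26, -17, -19, 10, 74, 32, 24, 10, 23, 10, 24, -17,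
      11, -19, 10, 11, -29, 20, 10, 10, 12, -17, 10, 22, 11, -23, -31, 17, 29, 12, -17, 24, 24, 11, 31]"], code_simp, simp_all)

lemma covered_3_2: "covered 3 [7, 13, 19, 31, 37, 43, 61, 67, 73, 103, 109, 127, 157] 1045 2076"
  by (rule coveredI[of _ _ _ _ "[
      11, 11, 19, -23, 31, 11, 31, 28, 28, -31, 11, -19, 29, -29, 28, -17, 11, -23, 30, 30, 19, -19, 30,
      30, 11, 26, 17, 16, -31, -23, -29, -37, 19, -19, 12, -17, 13, 21, 21, 19, 20, 13, 12, 19, -19, -17,
      38, -29, 12, 16, 20, 14, -37, 23, 12, 29, 13, -23, 19, 21, 22, -41, 17, 27, -29, -17, 28, 29, 19,
      13, 15, 18, 16, 30, 19, -17, 16, -19, -43, 23, 21, 17, 14, -31, -23, -17, -41, 16, 18, -19, 18, 18,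
      26, 18, 24, 14, -23, 17, -29, -19]"], code_simp, simp_all)

lemma covered_3_3: "covered 3 [7, 13, 19, 31, 37, 43, 61, 67, 73, 103, 109, 127, 157] 2077 3126"
  by (rule coveredI[of _ _ _ _ "[
      -31, 16, 14, 30, 13, 16, 25, 17, -41, 17, 18, -47, 20, -17, 16, 16, -37, -31, 16, 30, 56, 16, 16,
      -23, -17, 27, 26, 16, 17, 19, 23, -29, -19, -41, 16, -31, -23, 17, 16, -37, -47, 17, 18, -17, 17,
      16, 18, -29, 18, -23, 21, -43, -19, 17, 16, 31, 16, 17, 14, -37, 16, 23, 17, 22, 20, 21, -47, 22,
      16, 17, -53, 17, -17, 20, 16, -19, -43, 16, -41, 22, -37, -29, -17, 28, 25, -19, 21, -31, -23, 24,
      16, -17, 21, 20, 18, 25, -19, -29, 17, 16]"], code_simp, simp_all)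

lemma covered_3_4: "covered 3 [7, 13, 19, 31, 37, 43, 61, 67, 73, 103, 109, 127, 157] 3127 4158"
  by (rule coveredI[of _ _ _ _ "[
      -53, -43, -23, 21, 26, 18, 18, -31, 18, 20, -17, 21, 21, 22, -29, 16, 16, 26, 19, 22, -47, 18, -17,
      16, 21, -31, 27, -43, -41, -23, 16, -19, 17, 21, 16, -59, 31, 17, 18, 29, 27, 17, 16, 16, 17, -37,
      25, 16, 18, 27, 16, -41, -19, 27, 17, 16, 27, -61, 17, 22, 17, -53, 16, -19, 16, -29, -37, 31, -23,
      18, 19, -17, 16, 18, -47, 31, 16, 16, -31, 17, -17, 22, -29, -23, 16, -19, 16, 19, -37, 21, 27, -17,
      -61, 22, 17, 17, -23, 29, -41, 17]"], code_simp, simp_all)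

lemma covered_3_5: "covered 3 [7, 13, 19, 31, 37, 43, 61, 67, 73, 103, 109, 127, 157] 4159 5214"
  by (rule coveredI[of _ _ _ _ "[
      17, -43, 28, -47, -59, 23, 17, 17, -19, 24, 25, -17, 21, 25, -31, -29, 17, 19, -19, 25, 17, -17,
      -41, -23, -53, 21, -43, 25, 17, -61, -17, 27, -67, 17, 26, 25, -23, 28, 23, 19, -17, -19, 17, 23,
      24, 24, -41, 24, 19, 29, 28, -31, -43, -37, -53, 17, 23, -47, 23, -17, 17, 24, 24, 24, -61, 17, -29,
      24, -31, -67, -59, 17, 19, 30, 22, 19, 30, -17, 23, 30, 24, 22, -29, 23, -47, -71, -31, 24, 31, 28,
      24, 43, 23, -37, -19, 28, 20, -29, 51, 23]"], code_simp, simp_all)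

lemma covered_3_6: "covered 3 [7, 13, 19, 31, 37, 43, 61, 67, 73, 103, 109, 127, 157] 5215 6246"
  by (rule coveredI[of _ _ _ _ "[
      -23, 54, 33, -59, -19, 24, -17, -67, -47, 21, -73, 24, -53, -23, -41, -19, -17, 22, 21, 19, 22, 27,
      22, 19, -43, 22, -17, -23, 19, 31, 18, -29, 22, 23, 26, 29, -37, -31, -41, 21, 22, 22, 27, 30, -53,
      22, 24, 22, -29, 18, 23, 22, -73, -23, 23, 23, -37, 27, 22, -19, 28, 29, 22, 24, 22, -71, -17, -23,
      -61, 23, -19, 24, -59, -43, -31, -53, -17, 19, -37, 27, 26, -23, 21, 22, 20, 22, -17, -41, 23, 28,
      27, -47, 19, -31, -23, 22, 26, 27, 23, -79]"], code_simp, simp_all)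

lemma covered_3_7: "covered 3 [7, 13, 19, 31, 37, 43, 61, 67, 73, 103, 109, 127, 157] 6247 7296"
  by (rule coveredI[of _ _ _ _ "[
      26, 21, 22, -61, -19, 21, -59, -71, 23, 22, 22, 22, 23, 22, 22, -19, 27, 20, -47, 31, -23, 22, 29,
      -43, -67, -17, 22, -31, 22, 25, 24, 22, -29, 24, -17, 22, -19, 19, -61, 28, -59, 26, 28, 22, -37,
      21, 19, 23, -23, -43, -29, 22, 22, 22, -17, 24, 22, 23, -41, -19, 22, 21, -83, -67, 22, -31, -29,
      -53, 23, 31, 23, -19, 28, 22, -47, -43, 26, 24, 28, 20, -73, -19, -41, -31, -17, 23, -37, -23, 22,
      -71, 29, -19, 22, 26, 26, 23, 22, -53, -29, -23]"], code_simp, simp_all)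

lemma covered_3_8: "covered 3 [7, 13, 19, 31, 37, 43, 61, 67, 73, 103, 109, 127, 157] 7297 8322"
  by (rule coveredI[of _ _ _ _ "[
      22, -67, 23, 32, -17, 44, -41, 25, -37, 35, -83, 22, 22, 23, -17, -29, 22, -31, 22, 23, 27, -73,
      -17, 27, -19, 22, 29, 20, 27, -71, 22, 22, -29, -17, 31, -79, 24, 26, 26, 27, 24, 23, -59, 20, -61,
      22, 31, -19, -43, 22, -29, -37, -41, -17, -47, 31, 23, 22, -53, -89, 23, 22, -17, 27, -73, 21, -23,
      23, -19, 30, 22, -71, 24, 22, -41, -59, 24, 21, -23, -47, -79, -17, -29, 24, 30, 22, 33, 23, 26,
      -19, 26, -37, -23, 31, 22, 23, 22, -43, 22, 43]"], code_simp, simp_all)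

lemma covered_3_9: "covered 3 [7, 13, 19, 31, 37, 43, 61, 67, 73, 103, 109, 127, 157] 8323 9354"
  by (rule coveredI[of _ _ _ _ "[
      22, -19, -17, 27, 31, -83, 27, -31, -47, 29, 22, 31, 24, 22, -37, -61, -29, -67, 22, 26, 22, -17,
      -43, 22, 23, -31, 22, -79, 31, 25, 23, 22, -17, 26, -19, 22, 24, 23, 22, 31, 26, 25, -31, 48, -59,
      -19, 21, -23, 23, 31, -53, -17, 23, -83, 22, 27, -37, 22, 28, 31, -23, -17, 22, -47, -89, 24, 22,
      29, -29, 29, 22, 31, -43, 30, 27, 31, 30, 27, 22, 22, -53, 26, 23, -29, 30, -61, -23, 22, -19, -47,
      -73, 41, 22, -71, -41, -67, 22, 22, 22, 22]"], code_simp, simp_all)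

lemma covered_3_10: "covered 3 [7, 13, 19, 31, 37, 43, 61, 67, 73, 103, 109, 127, 157] 9355 10000"
  by (rule coveredI[of _ _ _ _ "[
      -17, -83, 22, 23, 26, -97, 26, 23, 57, 30, -17, -19, -53, 29, -31, -89, 22, -41, -17, -61, -43, 22,
      22, 24, 26, -23, 22, 27, 22, -17, 22, 22, -31, 26, -71, 22, 27, 22, 26, 31, -41, 26, 23, 23, -43,
      -59, 24, 22, 30, 27, 22, -23, 23, -19, -61, 27, 22, 28, -17, -97]"], code_simp, simp_all)

lemma covered_5_1: "covered 5 [11, 31, 41] 11 2090"
  by (rule coveredI[of _ _ _ _ "[
      0, 0, 0, 10, 7, 4, 14, 11, 11, 4, 26, 17, 14, 15, 9, 14, 27, -19, -17, 16, 7, 12, 13, 25, 6, 4, -19,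
      15, 7, 4, 8, 22, 13, 21, -17, 4, 14, 4, 5, -29, -23, 5, -17, 13, 10, -31, 7, 4, 5, 17, 21, 8, -23,
      7, -19, 15, 13, 26, 5, 17, -17, -31, 25, 7, 5, 12, 5, -17, 28, 7, 17, -19, 24, 7, -23, 12, -37, 11,
      10, -41, -19, -29, 11, 11, -17, 7, 10, 5, 7, 11, -31, 7, -17, 9, 5, -37, 17, -43, -19, 7]"], code_simp, simp_all)

lemma covered_5_2: "covered 5 [11, 31, 41] 2091 4180"
  by (rule coveredI[of _ _ _ _ "[
      12, 11, 10, 25, -31, 24, -23, 12, 12, -29, 5, 10, 18, 5, 13, 14, 8, -23, -47, -41, 15, 11, 5, -29,
      21, 10, -19, 5, -37, 6, 22, 6, -17, 5, 6, -19, 20, 6, -43, -41, -23, -17, 6, 6, 6, 6, 13, -37, 21,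
      -31, -23, -29, 6, 25, 15, 9, 6, -17, 13, 21, 25, 6, 6, -19, -47, 6, -59, 6, 6, 22, -53, 6, 6, -23,
      6, 6, 28, 6, -61, 21, -19, -17, -37, 30, -23, 30, 23, -47, 26, 10, -17, 11, 7, -29, 27, -31, 11, 6,
      -41, -43]"], code_simp, simp_all)

lemma covered_5_3: "covered 5 [11, 31, 41] 4181 6250"
  by (rule coveredI[of _ _ _ _ "[
      -37, 16, 8, 11, 17, 11, 16, -29, -61, -19, 10, 14, 17, 10, -17, 10, -23, -19, 16, 9, -43, 30, 7,
      -59, -31, 8, 6, 26, 6, -17, 7, -47, 20, 16, -67, 18, 14, -17, 7, 30, -71, 8, 9, 9, -19, -53, 16,
      -29, -23, 8, -59, 9, 9, -47, -17, 12, -41, 14, 7, 28, -43, 17, -17, 6, 8, 14, -67, 27, 18, -31, 30,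
      7, -53, 8, 8, 11, -29, 8, 10, 25, 8, 23, 8, -43, -23, -31, 13, -17, 6, -37, 6, 24, 8, 19, 8, -61,
      -41, 8, 19, -79]"], code_simp, simp_all)

lemma covered_5_4: "covered 5 [11, 31, 41] 6251 8330"
  by (rule coveredI[of _ _ _ _ "[
      19, 22, 6, -17, 10, -23, -37, 18, -59, 12, 6, 12, -17, 6, -31, 7, 10, 17, -19, -29, 29, 17, 18, -53,
      -43, 6, 28, 14, -19, 6, 17, -67, 7, -29, 16, 7, 15, 17, -79, -23, -73, 24, -37, 7, -71, -43, -19,
      11, -53, -23, 10, 6, 12, -17, -19, 10, -41, 18, -31, 11, -17, 6, 10, -67, 6, 6, -47, 10, 7, 11, -23,
      -19, -31, -29, -73, -41, 15, -17, 15, -89, 15, -19, -23, -61, 21, -83, 14, 18, 14, -47, 20, 7, 31,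
      -59, 14, 7, -37, 21, 11, -53]"], code_simp, simp_all)

lemma covered_5_5: "covered 5 [11, 31, 41] 8331 10000"
  by (rule coveredI[of _ _ _ _ "[
      -19, -17, -31, 28, -23, 14, -43, 8, 9, -19, -17, 9, -79, -37, 9, -41, 26, -31, 27, 9, 9, -59, 9, 15,
      -53, 7, -83, -17, 9, 21, 9, 9, 14, 8, -47, 7, -19, -23, 13, 7, 9, -61, 11, 9, -73, 9, -71, 19, 15,
      10, 18, 7, 15, 31, -19, 20, 7, 8, 10, -17, 9, 15, -31, 9, -19, -89, 9, -37, -43, 23, 10, 9, 17, 9,
      -41, 29, 9, 7, -97]"], code_simp, simp_all)

lemma covered_7_1: "covered 7 [29, 43] 15 3122"
  by (rule coveredI[of _ _ _ _ "[
      0, 0, 2, 2, 9, 8, 7, 7, 4, -17, 6, 3, 3, 11, 13, 15, 8, -19, 6, 6, 18, 3, 9, 4, 8, -17, 6, -29, 12,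
      4, 19, 25, 16, -17, 6, 7, -19, 5, -23, -29, 31, 10, 11, -19, 21, -31, 10, 4, -17, -23, 3, 4, 12,
      -41, 21, 17, -17, -43, 12, -31, -19, 10, -37, 18, 5, -29, 12, 8, 4, 11, -17, 20, 26, 26, 5, 20, 8,
      16, -37, -23, 4, 16, 13, 10, 4, 23, 20, -31, -47, 4, 26, 25, 22, -17, 7, -19, 4, -43, 5, 10]"], code_simp, simp_all)

lemma covered_7_2: "covered 7 [29, 43] 3123 6300"
  by (rule coveredI[of _ _ _ _ "[
      4, -23, -31, 6, -29, 30, 6, 25, 29, -41, -47, -23, 9, 16, 21, -59, 13, -29, 21, 8, 6, -19, 25, 5,
      -17, 16, -41, 6, -37, -31, -23, 22, -53, 7, 22, 17, 9, -19, 15, -17, 13, -23, -61, 9, 7, -19, -17,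
      12, 14, 13, 7, 9, -47, 8, 21, 6, -43, 14, 10, 4, -71, -37, -19, 8, 6, 5, 8, -59, 19, -67, -17, -31,
      -19, 25, -43, 6, 27, 6, -37, 7, -53, -41, -29, 14, 14, 5, 10, 11, -19, 11, 5, -23, -59, 5, -29, 8,
      -61, 14, 16, 26]"], code_simp, simp_all)

lemma covered_7_3: "covered 7 [29, 43] 6301 9366"
  by (rule coveredI[of _ _ _ _ "[
      11, 13, 12, -23, 9, 15, -73, -17, 20, 9, -37, 7, 4, -19, -17, 8, 14, 8, -41, -83, 10, -29, 9, -19,
      21, 4, 10, -31, 18, -37, -67, 6, 5, 10, 7, -47, 19, -41, -17, 14, -73, 21, 19, 19, 13, 9, 19, -59,
      8, -19, 11, 5, -53, -17, -31, -23, 11, -71, -83, 19, -29, 19, 5, 10, -19, 9, 5, -31, 6, 4, -43, 8,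
      26, 13, -79, -53, -17, 24, 4, 4, 13, 4, 15, 4, -17, 23, -23, -89, -71, 27, -43, -19, -41, 25, 4, 13,
      4, 19, 16, -47]"], code_simp, simp_all)

lemma covered_7_4: "covered 7 [29, 43] 9367 10000"
  by (rule coveredI[of _ _ _ _ "[
      -17, -97, 9, 7, 13, -73, -61, 4, 8, 4, -31, -37, -29, 8, 19, 7, 4, -19, -23, 10, -67]"], code_simp, simp_all)

lemma covered_11_1: "covered 11 [23, 67, 331] 23 5258"
  by (rule coveredI[of _ _ _ _ "[
      0, 0, 5, 2, 0, 8, 2, 4, 6, -23, -19, 4, 7, 13, 2, 11, 6, 7, 8, 20, 11, -29, 2, 9, -17, -19, 7, 4,
      -23, 7, -17, -37, 5, -43, 4, 2, -23, 17, 15, 6, -31, 3, 5, 10, 14, 12, 7, -19, 3, 5, 8, -47, -17, 9,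
      7, 3, -41, 25, -29, 8, 25, 24, 5, 4, 15, 10, 25, -17, 8, 5, 3, -53, 29, 3, -17, 10, 6, 25, 3, -37,
      -31, -19, 9, -29, 30, -67, -23, 7, 7, -43, -17, -61, -47, 8, 21, -29, 6, -19, 29, 12]"], code_simp, simp_all)

lemma covered_11_2: "covered 11 [23, 67, 331] 5259 10000"
  by (rule coveredI[of _ _ _ _ "[
      21, 3, 19, 4, 7, 3, -19, -31, -43, -41, 16, -37, 3, -67, 7, 3, 3, -61, 23, 14, 9, -19, 7, 10, -79,
      -37, -59, 6, 20, -19, -71, -29, -17, 12, 31, 3, 27, -53, 8, -17, 3, 3, 3, 3, 3, 3, -23, 7, 12, -73,
      23, -89, 11, 21, -23, -29, -37, 5, 13, -31, -83, -43, 14, 5, 12, 28, 4, 6, 4, 30, -47, 4, 19, 3,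
      -23, -17, 17, -59, -41, -19, 3, 15, -17, -53, -23, -31, 12, 9, 9, 15, 6, 12]"], code_simp, simp_all)

lemma covered_13_1: "covered 13 [53, 131] 27 6344"
  by (rule coveredI[of _ _ _ _ "[
      0, 2, 0, 2, 2, -17, 4, 3, 3, 2, 5, -19, 11, 19, 8, -23, 29, 28, 3, 4, 2, 19, -31, 2, 3, -19, -17,
      -29, 9, 9, 6, 7, 3, 5, -17, 11, -31, 7, 7, -41, 5, -37, 3, -53, 5, 7, 30, -17, 3, -19, 2, -29, 4, 4,
      7, 3, -37, -19, 2, 4, 12, -47, -59, -23, -29, 14, -53, -43, -17, 20, 4, -23, 9, -31, 30, 3, -17, 13,
      2, 7, -47, -19, 9, 2, -43, -37, -29, 7, -41, 6, -23, 10, 2, 14, 2, -73, -17, 3, -79, -71]"], code_simp, simp_all)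

lemma covered_13_2: "covered 13 [53, 131] 6345 10000"
  by (rule coveredI[of _ _ _ _ "[
      -23, 8, 2, -61, 29, -19, -41, 4, 5, 2, -53, -31, 2, 2, 9, 2, 9, 22, -17, 7, 2, -19, -43, 5, -29, 27,
      6, -73, 2, 2, 5, 14, 3, -53, -17, -37, 28, -89, -31, 23, 5, 13, 9, 10, -19, 3, -67, 30, 9, 24, 5, 3,
      -31, -17, 4, 11, -41, 8, -23]"], code_simp, simp_all)

lemma covered_17: "covered 17 [137] 35 10000"
  by (rule coveredI[of _ _ _ _ "[
      4, 0, 3, 10, 21, 8, 14, 10, -19, -23, 2, 3, 16, 3, 9, 2, 24, 11, 4, -23, 5, -29, 19, 2, 14, -43, 3,
      3, -31, 28, 10, 9, 15, -41, 4, 2, -23, 5, -19, 15, -31, 11, 2, 28, 3, -23, 4, -47, 3, -41, 2, -67,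
      11, 19, -29, -59, 2, 6, 18, 2, -19, 29, 5, -23, -31, -29, 2, -61, 26, 3, 3, 6, 3, 10, 17, -19, 2,
      -67, 2, 7, 4, -37, 2, -19, -47, 2, 2, 3, 10, -73, -61, 6, 3, 6, 5, 3, -37, 4, 7, -31, 3, -59, -47,
      22, 2, 8, 2, -53, 7, -43, 31, -31, 22]"], code_simp, simp_all)

lemma covered_19: "covered 19 [] 39 10000"
  by (rule coveredI[of _ _ _ _ "[
      8, 3, 10, 15, 11, 2, 4, -17, -23, 8, 5, -37, 2, 14, 7, -29, 9, 3, 4, 3, 3, 9, 5, -43, 3, -29, 13, 5,
      6, 6, -31, 5, -17, -23, -41, -53, 10, -59, -37, 8, 7, 11, 2, 14, 5, 7, 6, 10, -29, -41, -17, -23,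
      -31, -37, 6, -53, -43, 7, -29, -47, -23, 3, -67, -17, 2, 5, 3, 7, -79, 2, 9, -73, 2, 14, 16, 10, 2,
      3, -23, 3, 5, -37, 2, -17, 3, 9, 6, 2, 15, 2, -31, -17, 8, 2, 13, 2, -61, 3, -41]"], code_simp, simp_all)

lemma covered_23: "covered 23 [47, 139] 47 10000"
  by (rule coveredI[of _ _ _ _ "[
      0, 0, 5, -17, 7, 8, 6, 9, 9, 3, 5, 2, 3, 3, 5, 13, 24, -19, -29, -47, 3, 6, 6, -43, -17, 3, 13, 17,
      3, 2, -37, 5, 10, 4, 4, -41, -53, 28, -43, 22, 6, 11, 2, 4, -61, 20, -19, 4, 6, 4, 5, -29, 3, 9,
      -47, 20, -67, 3, 3, 3, -31, -17, -29, 4, 18, -59, 3, -41, -83, -17, -19, 6, -43, 9, 3, -71, 10, 11,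
      2, -89, 2, -17, -41, -19, -67]"], code_simp, simp_all)

lemma covered_29: "covered 29 [59] 59 10000"
  by (rule coveredI[of _ _ _ _ "[
      0, 3, 9, 2, -17, 14, 3, -23, 7, 3, 2, 2, 3, 19, -19, -31, 3, -17, 3, 21, 4, -59, 3, -47, 2, -31, 2,
      -19, 6, 3, -37, -67, 9, -23, 10, 5, -17, 8, 5, -61, 2, 11, -47, -73, -17, 5, 6, 3, 2, -53, 12, -41,
      3, 3, 10, 4, -19, 7, 3, -23, 2, 14, -17, 17, 5]"], code_simp, simp_all)

lemma covered_3: "covered 3 [7, 13, 19, 31, 37, 43, 61, 67, 73, 103, 109, 127, 157] 7 10000"
  by (rule covered_join[OF covered_join[OF covered_join[OF covered_join[OF covered_join[OF covered_join[OF covered_join[OF covered_join[OF covered_join[OF covered_3_1 covered_3_2] covered_3_3] covered_3_4] covered_3_5] covered_3_6] covered_3_7] covered_3_8] covered_3_9] covered_3_10]; simp)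

lemma pairs_3: "tame_pairs_refuted 3 [7, 13, 19, 31, 37, 43, 61, 67, 73, 103, 109, 127, 157] [20, 16, 24]" "wild_pairs_refuted 3 [7, 13, 19, 31, 37, 43, 61, 67, 73, 103, 109, 127, 157] [10, 8, 8, 8]"
  by code_simp+

lemma covered_5: "covered 5 [11, 31, 41] 11 10000"
  by (rule covered_join[OF covered_join[OF covered_join[OF covered_join[OF covered_5_1 covered_5_2] covered_5_3] covered_5_4] covered_5_5]; simp)

text \<open>The empty pool means that the mutual residue tests already dispose of all pairs of
  distinct primes within the bound.\<close>

lemma pairs_5: "tame_pairs_refuted 5 [11, 31, 41] []" "wild_pairs_refuted 5 [11, 31, 41] [6]"
  by code_simp+

lemma covered_7: "covered 7 [29, 43] 15 10000"
  by (rule covered_join[OF covered_join[OF covered_join[OF covered_7_1 covered_7_2] covered_7_3] covered_7_4]; simp)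

lemma pairs_7: "tame_pairs_refuted 7 [29, 43] []" "wild_pairs_refuted 7 [29, 43] [10]"
  by code_simp+

lemma covered_11: "covered 11 [23, 67, 331] 23 10000"
  by (rule covered_join[OF covered_11_1 covered_11_2]; simp)

lemma pairs_11: "tame_pairs_refuted 11 [23, 67, 331] []" "wild_pairs_refuted 11 [23, 67, 331] []"
  by code_simp+

lemma covered_13: "covered 13 [53, 131] 27 10000"
  by (rule covered_join[OF covered_13_1 covered_13_2]; simp)

lemma pairs_13: "tame_pairs_refuted 13 [53, 131] []" "wild_pairs_refuted 13 [53, 131] []"
  by code_simp+

lemma pairs_17: "tame_pairs_refuted 17 [137] []" "wild_pairs_refuted 17 [137] []"
  by code_simp+

lemma pairs_19: "tame_pairs_refuted 19 [] []" "wild_pairs_refuted 19 [] []"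
  by code_simp+

lemma pairs_23: "tame_pairs_refuted 23 [47, 139] []" "wild_pairs_refuted 23 [47, 139] []"
  by code_simp+

lemma pairs_29: "tame_pairs_refuted 29 [59] []" "wild_pairs_refuted 29 [59] []"
  by code_simp+

theorem theorem1p4:
  fixes K :: "complex set" and l f :: nat
  assumes "number_field K"
    and "galois_over_rat K"
    and "norm_euclidean K"
    and "field_degree K = l"
    and "Factorial_Ring.prime l"
    and "has_conductor K f"
    and "3 \<le> l" and "l \<le> 30"
    and "f \<le> 10 ^ 4"
  shows "(l = 3 \<longrightarrow> f \<in> {7, 9, 13, 19, 31, 37, 43, 61, 67, 73, 103, 109, 127, 157, 277,
                          439, 643, 997, 1597}) \<and>
         (l = 5 \<longrightarrow> f \<in> {11, 25, 31, 41, 61, 71, 151, 311, 431}) \<and>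
         (l = 7 \<longrightarrow> f \<in> {29, 43, 49, 127, 239, 673, 701, 911}) \<and>
         (l = 11 \<longrightarrow> f \<in> {23, 67, 89, 121, 331, 353, 419, 617}) \<and>
         (l = 13 \<longrightarrow> f \<in> {53, 79, 131, 157, 169, 313, 443, 521, 937}) \<and>
         (l = 17 \<longrightarrow> f \<in> {137, 289, 443, 1259, 2687}) \<and>
         (l = 19 \<longrightarrow> f \<in> {191, 229, 361, 1103}) \<and>
         (l = 23 \<longrightarrow> f \<in> {47, 139, 277, 461, 529, 599, 691, 967, 1013, 1289}) \<and>
         (l = 29 \<longrightarrow> f \<in> {59, 233, 523, 841, 929, 2843, 3191})"
proof -
  have f: "f = l\<^sup>2 \<or> int f \<in> set S"
    if "int l = l'" "2 < l'" "covered l' S (2 * l' + 1) 10000"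
      "tame_pairs_refuted l' S cs" "wild_pairs_refuted l' S cs'" for l' S cs cs'
    by (rule conductor_classification[OF assms(1,3,4,5,6) that(1,2) assms(9) that(3-5)])
  \<comment> \<open>The lists obtained for the nine degrees are shorter than those to be shown. For
    example, 277 is refuted for \<open>l = 3\<close> by the base 8.\<close>
  have f3: "f = 3\<^sup>2 \<or> int f \<in> set [7, 13, 19, 31, 37, 43, 61, 67, 73, 103, 109, 127, 157]" if "l = 3"
    using f[OF _ _ _ pairs_3] covered_3 that by simp
  have f5: "f = 5\<^sup>2 \<or> int f \<in> set [11, 31, 41]" if "l = 5"
    using f[OF _ _ _ pairs_5] covered_5 that by simp
  have f7: "f = 7\<^sup>2 \<or> int f \<in> set [29, 43]" if "l = 7"
    using f[OF _ _ _ pairs_7] covered_7 that by simp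
  have f11: "f = 11\<^sup>2 \<or> int f \<in> set [23, 67, 331]" if "l = 11"
    using f[OF _ _ _ pairs_11] covered_11 that by simp
  have f13: "f = 13\<^sup>2 \<or> int f \<in> set [53, 131]" if "l = 13"
    using f[OF _ _ _ pairs_13] covered_13 that by simp
  have f17: "f = 17\<^sup>2 \<or> int f \<in> set [137]" if "l = 17"
    using f[OF _ _ _ pairs_17] covered_17 that by simp
  have f19: "f = 19\<^sup>2 \<or> int f \<in> set []" if "l = 19"
    using f[OF _ _ _ pairs_19] covered_19 that by simp
  have f23: "f = 23\<^sup>2 \<or> int f \<in> set [47, 139]" if "l = 23"
    using f[OF _ _ _ pairs_23] covered_23 that by simp
  have f29: "f = 29\<^sup>2 \<or> int f \<in> set [59]" if "l = 29"
    using f[OF _ _ _ pairs_29] covered_29 that by simp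
  show ?thesis
  proof (intro conjI impI, goal_cases)
    case 1
    from f3[OF this] show ?case by auto
  next
    case 2
    from f5[OF this] show ?case by auto
  next
    case 3
    from f7[OF this] show ?case by auto
  next
    case 4
    from f11[OF this] show ?case by auto
  next
    case 5
    from f13[OF this] show ?case by auto
  next
    case 6
    from f17[OF this] show ?case by auto
  next
    case 7
    from f19[OF this] show ?case by auto
  next
    case 8
    from f23[OF this] show ?case by auto
  next
    case 9
    from f29[OF this] show ?case by auto
  qed
qed

end
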